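(* Let $\lambda$ be an $(m|n)$-hook partition and let $(I|J)=(i_1\ldots i_k|j_1\ldots j_k)$ be an admissible multiindex of length $k$ (with $\mu=\lambda^+-\iota$ a partition, where $(\iota|\kappa)=cont(I|J)$). Then for any choice of positioning maps $P^+$ and $P^-$, the vector $v_{I|J}\,\sigma.\rho_{I|J}$ (which is an integral linear combination of vectors $\pi_{K|L}=v_{K|L}\rho_{K|L}$ with $cont(K|L)=cont(I|J)$) is a $G_{ev}$-primitive vector in $H^0_{G_{ev}}(\lambda)\otimes Y^{\otimes k}$.
   Context: $K$ is an algebraically closed field of characteristic zero, $m,n\ge 1$, $G=GL(m|n)$, $G_{ev}=GL(m)\times GL(n)$. Put $|i|=0$ for $1\le i\le m$ and $|i|=1$ for $m<i\le m+n$. $A(m|n)$ is the free supercommutative $K$-superalgebra on $c_{ij}$ ($1\le i,j\le m+n$) with $c_{ij}$ of parity $|i|+|j|$ mod $2$; $A_{ev}(m|n)$ is the polynomial subalgebra generated by those $c_{ij}$ with $|i|=|j|$; $K(m|n)=A(m|n)(A_{ev}(m|n)\setminus 0)^{-1}$. Write $C=(c_{ij})$ in blocks $C_{11}$ ($m\times m$), $C_{12},C_{21},C_{22}$ ($n\times n$). For $1\le k\le m<l\le m+n$, $y_{kl}$ is the entry of $C_{11}^{-1}C_{12}$ in row $k$ and in the column labelled $l$; $Y$ is the $K$-span of all $y_{kl}$. Let $\phi(c_{m+a,m+b})$ be the $(a,b)$ entry of $C_{22}-C_{21}C_{11}^{-1}C_{12}$. Define $D^+(i_1,\ldots,i_s)=\det(c_{a,i_b})_{1\le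 a,b\le s}$ for $i_b\in\{1,\ldots,m\}$ and $D^-(j_1,\ldots,j_t)=\det(\phi(c_{m+a,j_b}))_{1\le a,b\le t}$ for $j_b\in\{m+1,\ldots,m+n\}$, with $D^-(\emptyset)=1$. Tensor products are over $K$. The even superderivations ${}_{ij}D$ ($|i|=|j|$) are the derivations of $K(m|n)$ with $(c_{kl})\,{}_{ij}D=\delta_{li}c_{kj}$; they preserve $Y$ and act on tensor products by the Leibniz rule. A weight vector is $G_{ev}$-primitive (even-primitive) if it is annihilated by ${}_{ij}D$ for all $i>j$ with $1\le i,j\le m$ or $m+1\le i,j\le m+n$ (zero is allowed). An $(m|n)$-hook partition is a partition $\lambda$ with $\lambda_{m+1}\le n$; $\lambda^+=(\lambda_1,\ldots,\lambda_m)$, and $\lambda^-=(\lambda^-_1,\ldots,\lambda^-_n)$ is the transpose of $(\lambda_{m+1},\lambda_{m+2},\ldots)$; $\lambda$ is identified with the weight $(\lambda^+|\lambda^-)$. Put $\lambda^+_{m+1}=\lambda^-_{n+1}=0$. $H^0_{G_{ev}}(\lambda)$ is realized as the $K$-span of all products of determinants containing, for each $a=1,\ldots,m$, exactly $\lambda^+_a-\lambda^+_{a+1}$ factors $D^+(\ldots)$ of size $a$ and, for each $b=1,\ldots,n$, exactly $\lambda^-_b-\lambda^-_{b+1}$ factors $D^-(\ldots)$ of size $b$. Its highest weight vector is $v=\prod_{a=1}^m D^+(1,\ldots,a)^{\lambda^+_a-\lambda^+_{a+1}}\prod_{b=1}^n D^-(m+1,\ldots,m+b)^{\lambda^-_b-\lambda^-_{b+1}}$.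 For $1\le i\le m$, $1\le j\le n$ let $$\rho_{i|j}=\sum_{r=i}^m D^+(1,\ldots,i-1,r)\sum_{s=1}^j(-1)^{s+j}D^-(m+1,\ldots,\widehat{m+s},\ldots,m+j)\,y_{r,m+s}\in K(m|n)\otimes Y.$$ For a multiindex $(I|J)=(i_1\ldots i_k|j_1\ldots j_k)$ with $1\le i_s\le m$, $1\le j_s\le n$, $\rho_{I|J}=\rho_{i_1|j_1}\otimes\cdots\otimes\rho_{i_k|j_k}\in K(m|n)\otimes Y^{\otimes k}$ (the coefficients from $K(m|n)$ are multiplied together), and $$v_{I|J}=\frac{v}{\prod_{s=1}^k D^+(1,\ldots,i_s)\prod_{s=1}^k D^-(m+1,\ldots,m+j_s-1)}\in K(m|n).$$ The content $cont(I|J)=(\iota|\kappa)$ records the multiplicities $\iota_i$ of $i$ in $I$ and $\kappa_j$ of $j$ in $J$. $(I|J)$ is admissible if $i_1\le\cdots\le i_k$, $i_r=i_{r+1}$ implies $j_r<j_{r+1}$, and the weight $(\mu|\nu)=(\lambda^+-\iota|\lambda^-+\kappa)$ is dominant. Diagrams: $\mathcal D^+=\{[s,i]:1\le i\le m,\ \mu_i<s\le\lambda^+_i\}$ (row $s$, column $i$; the skew diagram $(\lambda^+)'/\mu'$) and $\mathcal D^-=\{[j,l]:1\le j\le n,\ \lambda^-_j<l\le\nu_j\}$ (row $j$, column $l$). A positioning map $P^+:\{1,\ldots,k\}\to\mathcal D^+$ is a bijection such that $P^+(l)$ lies in column $i_l$ for all $l$; a positioning map $P^-:\{1,\ldots,k\}\to\mathcal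 D^-$ is a bijection such that $P^-(l)$ lies in row $j_l$ for all $l$. $X^+$ is the group of permutations of $\mathcal D^+$ preserving each row, $X^-$ the group of permutations of $\mathcal D^-$ preserving each column. For $\alpha\in X^+$, $\beta\in X^-$ let $\alpha.I$ be the multiindex whose $l$-th entry is the column of $\alpha(P^+(l))$, and $\beta.J$ the multiindex whose $l$-th entry is the row of $\beta(P^-(l))$. Then $$\sigma.\rho_{I|J}=\sum_{\alpha\in X^+}\sum_{\beta\in X^-}(-1)^{\alpha}(-1)^{\beta}\rho_{\alpha.I|\beta.J},$$ where $(-1)^\alpha,(-1)^\beta$ are signs of permutations. *)

theory Defs
  imports
    Complex_Main
    "HOL-Library.Poly_Mapping"
    "HOL-Library.Nat_Bijection"
    "HOL-Computational_Algebra.Fraction_Field"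
    "HOL-Computational_Algebra.Polynomial"
    "HOL-Combinatorics.Permutations"
begin

section \<open>Exterior algebras over commutative rings\<close>

text \<open>
  An element of the exterior algebra on generators \<open>x\<^sub>i\<close> over \<open>'a\<close> is the family of its
  coefficients at the monomials \<open>x\<^sub>S\<close> (\<open>S\<close> a finite set of indices, factors in increasing order).
\<close>

typedef (overloaded) ('i, 'a) grassmann =
  "{f :: 'i set \<Rightarrow> 'a::zero. finite {S. f S \<noteq> 0} \<and> (\<forall>S. f S \<noteq> 0 \<longrightarrow> finite S)}"
  morphisms gcoeff Abs_grassmann
  by (rule exI[of _ "\<lambda>_. 0"]) simp

setup_lifting type_definition_grassmann

text \<open>\<open>x\<^sub>T x\<^sub>U = gsign T U x\<^bsub>T \<union> U\<^esub>\<close> for disjoint \<open>T\<close>, \<open>U\<close>.\<close>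

definition gsign :: "'i::linorder set \<Rightarrow> 'i set \<Rightarrow> 'a::comm_ring_1" where
  "gsign T U = (- 1) ^ card {(t, u). t \<in> T \<and> u \<in> U \<and> u < t}"

lemma gsign_empty [simp]: "gsign {} U = 1" "gsign T {} = 1"
  by (auto simp: gsign_def)

lemma gsign_Un_left:
  assumes "finite T" "finite U" "finite V" "T \<inter> U = {}"
  shows "gsign (T \<union> U) V = gsign T V * gsign U V"
proof -
  have "{(t, u). t \<in> T \<union> U \<and> u \<in> V \<and> u < t} =
      {(t, u). t \<in> T \<and> u \<in> V \<and> u < t} \<union> {(t, u). t \<in> U \<and> u \<in> V \<and> u < t}" by auto
  moreover have "finite {(t, u). t \<in> T \<and> u \<in> V \<and> u < t}" "finite {(t, u). t \<in> U \<and> u \<in> V \<and> u < t}"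
    by (rule finite_subset[of _ "T \<times> V"] finite_subset[of _ "U \<times> V"]; use assms in auto)+
  ultimately show ?thesis
    unfolding gsign_def using assms(4)
    by (subst power_add[symmetric], subst card_Un_disjoint[symmetric]) auto
qed

lemma gsign_Un_right:
  assumes "finite T" "finite U" "finite V" "U \<inter> V = {}"
  shows "gsign T (U \<union> V) = gsign T U * gsign T V"
proof -
  have "{(t, u). t \<in> T \<and> u \<in> U \<union> V \<and> u < t} =
      {(t, u). t \<in> T \<and> u \<in> U \<and> u < t} \<union> {(t, u). t \<in> T \<and> u \<in> V \<and> u < t}" by auto
  moreover have "finite {(t, u). t \<in> T \<and> u \<in> U \<and> u < t}" "finite {(t, u). t \<in> T \<and> u \<in> V \<and> u < t}"
    by (rule finite_subset[of _ "T \<times> U"] finite_subset[of _ "T \<times> V"]; use assms in auto)+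
  ultimately show ?thesis
    unfolding gsign_def using assms(4)
    by (subst power_add[symmetric], subst card_Un_disjoint[symmetric]) auto
qed

instantiation grassmann :: (type, ab_group_add) ab_group_add
begin

lift_definition zero_grassmann :: "('a, 'b) grassmann" is "\<lambda>_. 0"
  by simp

lift_definition plus_grassmann ::
    "('a, 'b) grassmann \<Rightarrow> ('a, 'b) grassmann \<Rightarrow> ('a, 'b) grassmann"
  is "\<lambda>f g S. f S + g S"
proof (intro conjI allI impI)
  fix f g :: "'a set \<Rightarrow> 'b"
  assume *: "finite {S. f S \<noteq> 0} \<and> (\<forall>S. f S \<noteq> 0 \<longrightarrow> finite S)"
    "finite {S. g S \<noteq> 0} \<and> (\<forall>S. g S \<noteq> 0 \<longrightarrow> finite S)"
  show "finite {S. f S + g S \<noteq> 0}"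
    by (rule finite_subset[of _ "{S. f S \<noteq> 0} \<union> {S. g S \<noteq> 0}"]) (use * in auto)
  show "finite S" if "f S + g S \<noteq> 0" for S
    using * that by (metis add_0)
qed

lift_definition uminus_grassmann :: "('a, 'b) grassmann \<Rightarrow> ('a, 'b) grassmann"
  is "\<lambda>f S. - f S" by simp

definition minus_grassmann ::
    "('a, 'b) grassmann \<Rightarrow> ('a, 'b) grassmann \<Rightarrow> ('a, 'b) grassmann" where
  "minus_grassmann x y = x + - y"

instance
  by standard (unfold minus_grassmann_def, (transfer, simp add: fun_eq_iff algebra_simps)+)

end

instantiation grassmann :: (linorder, comm_ring_1) ring_1
begin

lift_definition one_grassmann :: "('a, 'b) grassmann" is "\<lambda>S. if S = {} then 1 else 0"
  by (rule conjI, rule finite_subset[of _ "{{}}"]) auto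

lift_definition times_grassmann ::
    "('a, 'b) grassmann \<Rightarrow> ('a, 'b) grassmann \<Rightarrow> ('a, 'b) grassmann"
  is "\<lambda>f g S. \<Sum>T\<in>Pow S. gsign T (S - T) * f T * g (S - T)"
proof (intro conjI allI impI)
  fix f g :: "'a set \<Rightarrow> 'b"
  assume *: "finite {S. f S \<noteq> 0} \<and> (\<forall>S. f S \<noteq> 0 \<longrightarrow> finite S)"
    "finite {S. g S \<noteq> 0} \<and> (\<forall>S. g S \<noteq> 0 \<longrightarrow> finite S)"
  let ?h = "\<lambda>S. \<Sum>T\<in>Pow S. gsign T (S - T) * f T * g (S - T)"
  have "S \<in> (\<lambda>(T, U). T \<union> U) ` ({S. f S \<noteq> 0} \<times> {S. g S \<noteq> 0})" if "?h S \<noteq> 0" for S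
  proof -
    obtain T where "T \<in> Pow S" "gsign T (S - T) * f T * g (S - T) \<noteq> 0"
      using \<open>?h S \<noteq> 0\<close> by (meson sum.neutral)
    then have "T \<subseteq> S" "f T \<noteq> 0" "g (S - T) \<noteq> 0"
      by auto
    then show ?thesis by (intro image_eqI[of _ _ "(T, S - T)"]) auto
  qed
  then have "{S. ?h S \<noteq> 0} \<subseteq> (\<lambda>(T, U). T \<union> U) ` ({S. f S \<noteq> 0} \<times> {S. g S \<noteq> 0})"
    by blast
  moreover have "finite ((\<lambda>(T, U). T \<union> U) ` ({S. f S \<noteq> 0} \<times> {S. g S \<noteq> 0}))"
    using * by simp
  ultimately show "finite {S. ?h S \<noteq> 0}"
    by (rule finite_subset)
  show "finite S" if "?h S \<noteq> 0" for S
    using that by (cases "finite S") simp_all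
qed

instance
proof
  fix x y z :: "('a, 'b) grassmann"
  show "x * y * z = x * (y * z)"
  proof (transfer, rule ext)
    fix f g h :: "'a set \<Rightarrow> 'b" and S
    let ?l = "\<Sum>V\<in>Pow S. gsign V (S - V) * (\<Sum>T\<in>Pow V. gsign T (V - T) * f T * g (V - T)) * h (S - V)"
    let ?r = "\<Sum>T\<in>Pow S. gsign T (S - T) * f T *
      (\<Sum>U\<in>Pow (S - T). gsign U (S - T - U) * g U * h (S - T - U))"
    show "?l = ?r"
    proof (cases "finite S")
      case True
      have "?l = (\<Sum>(V, T)\<in>Sigma (Pow S) Pow.
          gsign V (S - V) * (gsign T (V - T) * f T * g (V - T)) * h (S - V))"
        using True by (subst sum.Sigma[symmetric])
          (auto simp: sum_distrib_left sum_distrib_right intro: finite_subset)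
      also have "\<dots> = (\<Sum>(T, U)\<in>Sigma (Pow S) (\<lambda>T. Pow (S - T)).
          gsign T (S - T) * f T * (gsign U (S - T - U) * g U * h (S - T - U)))"
      proof (rule sum.reindex_bij_witness[of _ "\<lambda>(T, U). (T \<union> U, T)" "\<lambda>(V, T). (T, V - T)"], goal_cases)
        case (5 p)
        obtain V T where p: "p = (V, T)" "T \<subseteq> V" "V \<subseteq> S" using 5 by auto
        define U W where "U = V - T" and "W = S - V"
        have fin: "finite T" "finite U" "finite W"
          using True p by (auto simp: U_def W_def intro: finite_subset)
        have dis: "T \<inter> U = {}" "U \<inter> W = {}" "T \<inter> W = {}" using p by (auto simp: U_def W_def)
        have eq: "V = T \<union> U" "S - T = U \<union> W" "U \<union> W - U = W" using p by (auto simp: U_def W_def)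
        have sgn: "gsign V W * gsign T U = (gsign T (U \<union> W) * gsign U W :: 'b)"
          using fin dis by (simp add: eq(1) gsign_Un_left gsign_Un_right ac_simps)
        have "gsign T (U \<union> W) * f T * (gsign U W * g U * h W) =
            gsign T (U \<union> W) * gsign U W * (f T * g U * h W)" by (simp only: ac_simps)
        also have "\<dots> = gsign V W * gsign T U * (f T * g U * h W)" by (simp only: sgn)
        also have "\<dots> = gsign V W * (gsign T U * f T * g U) * h W" by (simp only: ac_simps)
        finally show ?case
          unfolding p(1) prod.case U_def[symmetric] W_def[symmetric] eq(2,3) .
      qed auto
      also have "\<dots> = ?r"
        using True by (subst sum.Sigma[symmetric])
          (auto simp: sum_distrib_left sum_distrib_right intro: finite_subset)
      finally show ?thesis .
    qed simp
  qed
  show "1 * x = x"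
  proof (transfer, rule ext)
    fix f :: "'a set \<Rightarrow> 'b" and S
    assume "finite {S. f S \<noteq> 0} \<and> (\<forall>S. f S \<noteq> 0 \<longrightarrow> finite S)"
    then have inf: "infinite S \<Longrightarrow> f S = 0" by blast
    have "(\<Sum>T\<in>Pow S. gsign T (S - T) * (if T = {} then 1 else 0) * f (S - T)) =
        (\<Sum>T\<in>Pow S. if T = {} then f S else 0)"
      by (rule sum.cong) auto
    then show "(\<Sum>T\<in>Pow S. gsign T (S - T) * (if T = {} then 1 else 0) * f (S - T)) = f S"
      using inf by (cases "finite S") auto
  qed
  show "x * 1 = x"
  proof (transfer, rule ext)
    fix f :: "'a set \<Rightarrow> 'b" and S
    assume *: "finite {S. f S \<noteq> 0} \<and> (\<forall>S. f S \<noteq> 0 \<longrightarrow> finite S)"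
    have "(\<Sum>T\<in>Pow S. gsign T (S - T) * f T * (if S - T = {} then 1 else 0)) =
        (\<Sum>T\<in>Pow S. if T = S then f T else 0)"
      by (rule sum.cong) auto
    then show "(\<Sum>T\<in>Pow S. gsign T (S - T) * f T * (if S - T = {} then 1 else 0)) = f S"
      using * by (cases "finite S") auto
  qed
  show "(x + y) * z = x * z + y * z"
    by transfer (simp only: distrib_left distrib_right sum.distrib)
  show "x * (y + z) = x * y + x * z"
    by transfer (simp only: distrib_left distrib_right sum.distrib)
  have "gcoeff (0 :: ('a, 'b) grassmann) {} \<noteq> gcoeff (1 :: ('a, 'b) grassmann) {}"
    by (simp add: zero_grassmann.rep_eq one_grassmann.rep_eq)
  then show "(0 :: ('a, 'b) grassmann) \<noteq> 1"
    by metis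
qed

end

definition gconst :: "'a::comm_ring_1 \<Rightarrow> ('i, 'a) grassmann" where
  "gconst a = Abs_grassmann (\<lambda>S. if S = {} then a else 0)"

definition ggen :: "'i \<Rightarrow> ('i, 'a::comm_ring_1) grassmann" where
  "ggen i = Abs_grassmann (\<lambda>S. if S = {i} then 1 else 0)"

lemma gcoeff_single:
  assumes "finite V"
  shows "gcoeff (Abs_grassmann (\<lambda>S. if S = V then a else 0)) S = (if S = V then a else 0)"
proof -
  have "{S. (if S = V then a else 0) \<noteq> 0} \<subseteq> {V}" by auto
  then have "finite {S. (if S = V then a else 0) \<noteq> 0}" by (rule finite_subset) simp
  then show ?thesis
    using assms by (subst Abs_grassmann_inverse) auto
qed

lemma gcoeff_gconst: "gcoeff (gconst a) S = (if S = {} then a else 0)"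
  unfolding gconst_def by (rule gcoeff_single) simp

lemma gcoeff_ggen: "gcoeff (ggen i) S = (if S = {i} then 1 else 0)"
  unfolding ggen_def by (rule gcoeff_single) simp

lemma gcoeff_infinite: "infinite S \<Longrightarrow> gcoeff x S = 0"
  using gcoeff[of x] by blast

lemma gcoeff_gconst_mult:
  "gcoeff (gconst a * x) S = a * gcoeff (x :: ('i::linorder, 'a::comm_ring_1) grassmann) S"
proof -
  have "(\<Sum>T\<in>Pow S. gsign T (S - T) * gcoeff (gconst a) T * gcoeff x (S - T)) =
      (\<Sum>T\<in>Pow S. if T = {} then a * gcoeff x S else 0)"
    by (rule sum.cong) (auto simp: gcoeff_gconst)
  then show ?thesis
    by (cases "finite S") (auto simp: times_grassmann.rep_eq gcoeff_infinite)
qed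

lemma gcoeff_mult_gconst:
  "gcoeff (x * gconst a) S = a * gcoeff (x :: ('i::linorder, 'a::comm_ring_1) grassmann) S"
proof -
  have "(\<Sum>T\<in>Pow S. gsign T (S - T) * gcoeff x T * gcoeff (gconst a) (S - T)) =
      (\<Sum>T\<in>Pow S. if T = S then a * gcoeff x T else 0)"
    by (rule sum.cong) (auto simp: gcoeff_gconst)
  then show ?thesis
    by (cases "finite S") (auto simp: times_grassmann.rep_eq gcoeff_infinite)
qed

lemma grassmann_eqI: "(\<And>S. gcoeff x S = gcoeff y S) \<Longrightarrow> x = y"
  by (metis ext gcoeff_inject)

lemma gconst_commute: "gconst a * x = x * (gconst a :: ('i::linorder, 'a::comm_ring_1) grassmann)"
  by (rule grassmann_eqI) (simp only: gcoeff_gconst_mult gcoeff_mult_gconst)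

lemma gconst_0: "gconst 0 = 0"
  by (rule grassmann_eqI) (simp add: gcoeff_gconst zero_grassmann.rep_eq)

lemma gconst_1: "gconst 1 = (1 :: ('i::linorder, 'a::comm_ring_1) grassmann)"
  by (rule grassmann_eqI) (simp add: gcoeff_gconst one_grassmann.rep_eq)

lemma gconst_add: "gconst (a + b) = gconst a + gconst b"
  by (rule grassmann_eqI) (simp add: gcoeff_gconst plus_grassmann.rep_eq)

lemma gconst_mult:
  "gconst (a * b) = gconst a * (gconst b :: ('i::linorder, 'a::comm_ring_1) grassmann)"
  by (rule grassmann_eqI) (simp add: gcoeff_gconst_mult, simp add: gcoeff_gconst)


section \<open>The superalgebra \<open>K(m|n)\<close> and its even superderivations\<close>

text \<open>
  The type \<open>'k salg\<close> is the exterior algebra over the field of rational functions in commuting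
  variables \<open>X\<^bsub>ij\<^esub>\<close>, on odd generators \<open>\<xi>\<^bsub>ij\<^esub>\<close>, where \<open>(i, j)\<close> ranges over all pairs of natural numbers
  (encoded as one natural number). For fixed \<open>m\<close>, \<open>n\<close> one generator is chosen for each \<open>c\<^bsub>ij\<^esub>\<close>, according to its
  parity. As these are distinct free generators, the subalgebra \<open>A(m|n)\<close> they generate is the
  free supercommutative superalgebra on them, all nonzero elements of \<open>A\<^bsub>ev\<^esub>(m|n)\<close> are
  invertible in \<open>'k salg\<close>, and \<open>K(m|n)\<close> is the set of all fractions.
\<close>

type_synonym 'k cpoly = "(nat \<Rightarrow>\<^sub>0 nat) \<Rightarrow>\<^sub>0 'k"
type_synonym 'k salg = "(nat, 'k cpoly fract) grassmann"

definition kconst :: "'k::field \<Rightarrow> 'k salg" where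
  "kconst a = gconst (Fraction_Field.Fract (Poly_Mapping.single 0 a) 1)"

definition kscale :: "'k::field \<Rightarrow> 'k salg \<Rightarrow> 'k salg" where
  "kscale a x = kconst a * x"

definition evvar :: "nat \<Rightarrow> nat \<Rightarrow> 'k::field salg" where
  "evvar i j = gconst (Fraction_Field.Fract (Poly_Mapping.single (Poly_Mapping.single (prod_encode (i, j)) 1) 1) 1)"

definition oddvar :: "nat \<Rightarrow> nat \<Rightarrow> 'k::field salg" where
  "oddvar i j = ggen (prod_encode (i, j))"

definition cgen :: "nat \<Rightarrow> nat \<Rightarrow> nat \<Rightarrow> 'k::field salg" where
  "cgen m i j = (if (i \<le> m) = (j \<le> m) then evvar i j else oddvar i j)"

inductive_set Amn :: "nat \<Rightarrow> nat \<Rightarrow> 'k::field salg set" for m n where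
  const: "kconst a \<in> Amn m n"
| gen: "i \<in> {1..m + n} \<Longrightarrow> j \<in> {1..m + n} \<Longrightarrow> cgen m i j \<in> Amn m n"
| add: "x \<in> Amn m n \<Longrightarrow> y \<in> Amn m n \<Longrightarrow> x + y \<in> Amn m n"
| mult: "x \<in> Amn m n \<Longrightarrow> y \<in> Amn m n \<Longrightarrow> x * y \<in> Amn m n"

inductive_set Aev :: "nat \<Rightarrow> nat \<Rightarrow> 'k::field salg set" for m n where
  const: "kconst a \<in> Aev m n"
| gen: "i \<in> {1..m + n} \<Longrightarrow> j \<in> {1..m + n} \<Longrightarrow> (i \<le> m) = (j \<le> m) \<Longrightarrow> cgen m i j \<in> Aev m n"
| add: "x \<in> Aev m n \<Longrightarrow> y \<in> Aev m n \<Longrightarrow> x + y \<in> Aev m n"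
| mult: "x \<in> Aev m n \<Longrightarrow> y \<in> Aev m n \<Longrightarrow> x * y \<in> Aev m n"

text \<open>The two-sided inverse of a unit.\<close>

definition rinv :: "'a::ring_1 \<Rightarrow> 'a" where
  "rinv x = (THE y. x * y = 1 \<and> y * x = 1)"

definition Kmn :: "nat \<Rightarrow> nat \<Rightarrow> 'k::field salg set" where
  "Kmn m n = {a * rinv f | a f. a \<in> Amn m n \<and> f \<in> Aev m n \<and> f \<noteq> 0}"

text \<open>
  \<open>D\<close> is the derivation \<open>\<^sub>i\<^sub>jD\<close> of \<open>K(m|n)\<close> (for \<open>|i| = |j|\<close>), written as a left operator; being even, it
  obeys the Leibniz rule without signs. It is a total function on the type, but only its
  restriction to \<open>K(m|n)\<close> matters, and that restriction is determined by the conditions; outside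
  \<open>K(m|n)\<close> it is an arbitrary linear extension. Existence is lemma \<open>is_evder_evder\<close> below.
\<close>

definition is_evder :: "nat \<Rightarrow> nat \<Rightarrow> nat \<Rightarrow> nat \<Rightarrow> ('k::field salg \<Rightarrow> 'k salg) \<Rightarrow> bool" where
  "is_evder m n i j D \<longleftrightarrow>
    Vector_Spaces.linear kscale kscale D \<and>
    D ` Kmn m n \<subseteq> Kmn m n \<and>
    (\<forall>x\<in>Kmn m n. \<forall>y\<in>Kmn m n. D (x * y) = D x * y + x * D y) \<and>
    (\<forall>k\<in>{1..m + n}. \<forall>l\<in>{1..m + n}. D (cgen m k l) = (if l = i then cgen m k j else 0))"


lemma kconst_commute: "kconst c * x = x * kconst c"
  unfolding kconst_def by (rule gconst_commute)

lemma kconst_simps: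
  "kconst 1 = 1" "kconst (a + b) = kconst a + kconst b" "kconst (a * b) = kconst a * kconst b"
  by (simp_all add: kconst_def gconst_1 gconst_add[symmetric] gconst_mult[symmetric] mult_single
      single_add One_fract_def[symmetric])

lemma vector_space_kscale: "vector_space (kscale :: 'k::field \<Rightarrow> _)"
  by unfold_locales (simp_all add: kscale_def kconst_simps distrib_left distrib_right mult.assoc)

subsection \<open>Existence of the derivations\<close>

lemma poly_mapping_ind [case_names single add]:
  assumes "\<And>t a. P (Poly_Mapping.single t a)" "\<And>x y. P x \<Longrightarrow> P y \<Longrightarrow> P (x + y)"
  shows "P (p :: 'a \<Rightarrow>\<^sub>0 'b::comm_monoid_add)"
proof -
  have "P (\<Sum>t\<in>A. Poly_Mapping.single t (Poly_Mapping.lookup p t))" if "finite A" for A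
    using that
  proof induction
    case empty
    show ?case using assms(1)[of undefined 0] by simp
  next
    case (insert t A)
    then show ?case using assms by simp
  qed
  moreover have "(\<Sum>t\<in>Poly_Mapping.keys p. Poly_Mapping.single t (Poly_Mapping.lookup p t)) = p"
    by (rule poly_mapping_eqI)
      (auto simp: lookup_sum lookup_single when_def in_keys_iff)
  ultimately show ?thesis by (metis finite_keys)
qed

definition is_deriv :: "('a::comm_ring_1 \<Rightarrow> 'a) \<Rightarrow> bool" where
  "is_deriv d \<longleftrightarrow> (\<forall>x y. d (x + y) = d x + d y) \<and> (\<forall>x y. d (x * y) = d x * y + x * d y)"

lemma is_derivD:
  assumes "is_deriv d"
  shows "d (x + y) = d x + d y" "d (x * y) = d x * y + x * d y" "d 0 = 0" "d 1 = 0" "d (- x) = - d x"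
proof -
  show *: "d (x + y) = d x + d y" "d (x * y) = d x * y + x * d y" for x y
    using assms by (auto simp: is_deriv_def)
  show 0: "d 0 = 0" using *(1)[of 0 0] by simp
  show "d 1 = 0" using *(2)[of 1 1] by simp
  show "d (- x) = - d x" using *(1)[of x "- x"] 0 by (simp add: add_eq_0_iff)
qed

definition pdv :: "nat \<Rightarrow> 'k::field cpoly \<Rightarrow> 'k cpoly" where
  "pdv v p = (\<Sum>t\<in>Poly_Mapping.keys p. Poly_Mapping.single (t - Poly_Mapping.single v 1) (of_nat (Poly_Mapping.lookup t v) * Poly_Mapping.lookup p t))"

lemma pdv_superset:
  assumes "finite A" "Poly_Mapping.keys p \<subseteq> A"
  shows "pdv v p = (\<Sum>t\<in>A. Poly_Mapping.single (t - Poly_Mapping.single v 1) (of_nat (Poly_Mapping.lookup t v) * Poly_Mapping.lookup p t))"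
  unfolding pdv_def using assms by (intro sum.mono_neutral_left) (auto simp: in_keys_iff)

lemma pdv_add: "pdv v (p + q) = pdv v p + pdv v q"
proof -
  let ?A = "Poly_Mapping.keys p \<union> Poly_Mapping.keys q"
  have "Poly_Mapping.keys (p + q) \<subseteq> ?A" by (rule keys_add)
  then show ?thesis
    by (subst (1 2 3) pdv_superset[of ?A])
      (auto simp: lookup_add distrib_left single_add sum.distrib)
qed

lemma pdv_single: "pdv v (Poly_Mapping.single t a) =
    Poly_Mapping.single (t - Poly_Mapping.single v 1) (of_nat (Poly_Mapping.lookup t v) * a)"
  by (subst pdv_superset[of "{t}"]) auto

lemma pm_minus_add:
  fixes s t :: "nat \<Rightarrow>\<^sub>0 nat"
  assumes "Poly_Mapping.lookup s v \<noteq> 0"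
  shows "s + t - Poly_Mapping.single v 1 = (s - Poly_Mapping.single v 1) + t"
  using assms by (intro poly_mapping_eqI) (auto simp: lookup_add lookup_minus lookup_single when_def)

lemma pdv_single_mult:
  "pdv v (Poly_Mapping.single s a * Poly_Mapping.single t b) =
    pdv v (Poly_Mapping.single s a) * Poly_Mapping.single t b + Poly_Mapping.single s a * pdv v (Poly_Mapping.single t b)"
proof -
  let ?e = "Poly_Mapping.single v 1"
  have 1: "Poly_Mapping.single (s - ?e + t) (of_nat (Poly_Mapping.lookup s v) * a * b) =
      Poly_Mapping.single (s + t - ?e) (of_nat (Poly_Mapping.lookup s v) * a * b)"
    using pm_minus_add[of s v t] by (cases "Poly_Mapping.lookup s v = 0") auto
  have 2: "Poly_Mapping.single (s + (t - ?e)) (a * (of_nat (Poly_Mapping.lookup t v) * b)) =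
      Poly_Mapping.single (s + t - ?e) (a * (of_nat (Poly_Mapping.lookup t v) * b))"
    using pm_minus_add[of t v s] by (cases "Poly_Mapping.lookup t v = 0") (auto simp: add.commute)
  show ?thesis
    unfolding pdv_single mult_single 1 2 single_add[symmetric]
    by (simp add: lookup_add algebra_simps)
qed

lemma pdv_mult: "pdv v (p * q) = pdv v p * q + p * pdv v q"
proof (induction p rule: poly_mapping_ind)
  case (single s a)
  show ?case
    by (induction q rule: poly_mapping_ind)
      (simp_all add: pdv_single_mult pdv_add distrib_left distrib_right algebra_simps)
qed (simp add: pdv_add distrib_right algebra_simps)

lemma is_deriv_pdv: "is_deriv (pdv v)"
  by (simp add: is_deriv_def pdv_add pdv_mult)

lemma is_deriv_sum:
  assumes "\<And>i. i \<in> A \<Longrightarrow> is_deriv (d i)"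
  shows "is_deriv (\<lambda>x. \<Sum>i\<in>A. c i * d i x)"
  using assms unfolding is_deriv_def
  by (auto simp: distrib_left sum.distrib sum_distrib_left sum_distrib_right intro!: sum.cong)
    (simp add: algebra_simps sum.distrib sum_distrib_left)

definition dfract :: "('a::idom \<Rightarrow> 'a) \<Rightarrow> 'a fract \<Rightarrow> 'a fract" where
  "dfract d q = (SOME r. \<exists>a b. b \<noteq> 0 \<and> q = Fraction_Field.Fract a b \<and>
     r = Fraction_Field.Fract (d a * b - a * d b) (b * b))"

lemma dfract_Fract:
  assumes d: "is_deriv d" and b: "b \<noteq> 0"
  shows "dfract d (Fraction_Field.Fract a b) = Fraction_Field.Fract (d a * b - a * d b) (b * b)"
  unfolding dfract_def
proof (rule some_equality)
  fix r
  assume "\<exists>a' b'. b' \<noteq> 0 \<and> Fraction_Field.Fract a b = Fraction_Field.Fract a' b' \<and>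
     r = Fraction_Field.Fract (d a' * b' - a' * d b') (b' * b')"
  then obtain a' b' where *: "b' \<noteq> 0" "Fraction_Field.Fract a b = Fraction_Field.Fract a' b'"
     "r = Fraction_Field.Fract (d a' * b' - a' * d b') (b' * b')" by blast
  have e: "a * b' = a' * b" using * b by (simp add: eq_fract)
  then have e': "d a * b' + a * d b' = d a' * b + a' * d b"
    using is_derivD(2)[OF d, of a b'] is_derivD(2)[OF d, of a' b] by simp
  have "(d a' * b' - a' * d b') * (b * b) = (d a * b - a * d b) * (b' * b')"
    using e e' by algebra
  then show "r = Fraction_Field.Fract (d a * b - a * d b) (b * b)"
    using * b by (simp add: eq_fract)
qed (use b in blast)

lemma is_deriv_dfract:
  assumes d: "is_deriv d"
  shows "is_deriv (dfract d)"
  unfolding is_deriv_def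
proof (intro conjI allI)
  fix x y :: "'a fract"
  obtain a b where x: "x = Fraction_Field.Fract a b" "b \<noteq> 0" by (cases x)
  obtain a' b' where y: "y = Fraction_Field.Fract a' b'" "b' \<noteq> 0" by (cases y)
  show "dfract d (x + y) = dfract d x + dfract d y"
    using x y by (simp add: dfract_Fract[OF d] eq_fract is_derivD[OF d]) (simp add: algebra_simps)
  show "dfract d (x * y) = dfract d x * y + x * dfract d y"
    using x y by (simp add: dfract_Fract[OF d] eq_fract is_derivD[OF d]) (simp add: algebra_simps)
qed

lemma finite_gcoeff: "finite {S. gcoeff x S \<noteq> 0}"
  using gcoeff[of x] by blast

lemma gcoeff_Abs:
  assumes "\<And>S. f S \<noteq> 0 \<Longrightarrow> S \<in> g ` {S. gcoeff x S \<noteq> 0} \<and> finite S"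
  shows "gcoeff (Abs_grassmann f) = f"
proof -
  have "finite {S. f S \<noteq> 0}"
    using assms by (intro finite_subset[OF _ finite_imageI[OF finite_gcoeff[of x], of g]]) blast
  then show ?thesis
    using assms by (subst Abs_grassmann_inverse) auto
qed

definition gmap :: "('a::comm_ring_1 \<Rightarrow> 'a) \<Rightarrow> ('i, 'a) grassmann \<Rightarrow> ('i, 'a) grassmann" where
  "gmap d x = Abs_grassmann (\<lambda>S. d (gcoeff x S))"

lemma gcoeff_gmap:
  assumes "d 0 = 0"
  shows "gcoeff (gmap d x) S = d (gcoeff x S)"
proof -
  have "gcoeff (Abs_grassmann (\<lambda>S. d (gcoeff x S))) = (\<lambda>S. d (gcoeff x S))"
    using assms by (intro gcoeff_Abs[of _ id x]) (auto, metis gcoeff_infinite)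
  then show ?thesis by (simp add: gmap_def)
qed

lemma gsign_cases: "gsign T U = (1::'a::comm_ring_1) \<or> gsign T U = - (1::'a::comm_ring_1)"
  unfolding gsign_def by (cases "even (card {(t, u). t \<in> T \<and> u \<in> U \<and> u < t})") simp_all

lemma gsign_square [simp]: "gsign T U * gsign T U = (1::'a::comm_ring_1)"
  using gsign_cases[where 'a='a, of T U] by auto

lemma gmap_mult:
  fixes x y :: "('i::linorder, 'a::comm_ring_1) grassmann"
  assumes d: "is_deriv d"
  shows "gmap d (x * y) = gmap d x * y + x * gmap d y"
proof (rule grassmann_eqI)
  fix S
  note g = gcoeff_gmap[of d, OF is_derivD(3)[OF d]]
  have "d (sum f A) = (\<Sum>i\<in>A. d (f i))" for f :: "'i set \<Rightarrow> 'a" and A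
    by (induction A rule: infinite_finite_induct) (simp_all add: is_derivD[OF d])
  moreover have "d (gsign T U * a * b) = gsign T U * d a * b + gsign T U * a * d b" for T U :: "'i set" and a b
    using gsign_cases[where 'a='a, of T U] by (auto simp: is_derivD[OF d] algebra_simps)
  ultimately show "gcoeff (gmap d (x * y)) S = gcoeff (gmap d x * y + x * gmap d y) S"
    by (simp add: g times_grassmann.rep_eq plus_grassmann.rep_eq sum.distrib)
qed

definition gder :: "'i::linorder \<Rightarrow> ('i, 'a::comm_ring_1) grassmann \<Rightarrow> ('i, 'a) grassmann" where
  "gder v x = Abs_grassmann (\<lambda>S. if v \<in> S then 0 else gsign {v} S * gcoeff x (insert v S))"

definition ginv :: "('i::linorder, 'a::comm_ring_1) grassmann \<Rightarrow> ('i, 'a) grassmann" where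
  "ginv x = Abs_grassmann (\<lambda>S. (- 1) ^ card S * gcoeff x S)"

lemma gcoeff_gder: "gcoeff (gder v x) S = (if v \<in> S then 0 else gsign {v} S * gcoeff x (insert v S))"
proof -
  let ?f = "\<lambda>S. if v \<in> S then 0 else gsign {v} S * gcoeff x (insert v S)"
  have "gcoeff (Abs_grassmann ?f) = ?f"
  proof (rule gcoeff_Abs[of _ "\<lambda>T. T - {v}" x])
    fix S
    assume *: "?f S \<noteq> 0"
    then have "v \<notin> S" "gcoeff x (insert v S) \<noteq> 0"
      by (auto split: if_splits)
    then show "S \<in> (\<lambda>T. T - {v}) ` {S. gcoeff x S \<noteq> 0} \<and> finite S"
      using gcoeff_infinite[of "insert v S" x] by (auto intro!: image_eqI[of _ _ "insert v S"])
  qed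
  then show ?thesis by (simp add: gder_def)
qed

lemma gcoeff_ginv: "gcoeff (ginv x) S = (- 1) ^ card S * gcoeff x S"
proof -
  have "gcoeff (Abs_grassmann (\<lambda>S. (- 1) ^ card S * gcoeff x S)) = (\<lambda>S. (- 1) ^ card S * gcoeff x S)"
    by (intro gcoeff_Abs[of _ id x]) (auto, metis gcoeff_infinite mult_zero_right)
  then show ?thesis by (simp add: ginv_def)
qed

lemma gsign_swap:
  assumes "finite T" "v \<notin> T"
  shows "gsign T {v} = (- 1) ^ card T * (gsign {v} T :: 'a::comm_ring_1)"
proof -
  have 1: "{(t, u). t \<in> T \<and> u \<in> {v} \<and> u < t} = (\<lambda>t. (t, v)) ` {t\<in>T. v < t}"
    and 2: "{(t, u). t \<in> {v} \<and> u \<in> T \<and> u < t} = (\<lambda>u. (v, u)) ` {t\<in>T. t < v}" by auto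
  have "T = {t\<in>T. v < t} \<union> {t\<in>T. t < v}"
    using assms(2) by (auto simp: not_less_iff_gr_or_eq)
  then have "card T = card ({t\<in>T. v < t} \<union> {t\<in>T. t < v})"
    by (rule arg_cong)
  also have "\<dots> = card {t\<in>T. v < t} + card {t\<in>T. t < v}"
    using assms by (intro card_Un_disjoint) auto
  finally show ?thesis
    unfolding gsign_def 1 2
    by (simp add: card_image inj_on_def power_add) (simp add: mult.assoc power_mult_distrib[symmetric])
qed

lemma gder_mult:
  fixes x y :: "('i::linorder, 'a::comm_ring_1) grassmann"
  shows "gder v (x * y) = gder v x * y + ginv x * gder v y"
proof (rule grassmann_eqI)
  fix S
  let ?g = gcoeff
  show "?g (gder v (x * y)) S = ?g (gder v x * y + ginv x * gder v y) S"
  proof (cases "finite S")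
    case fin: True
    have Pow_insert': "(\<Sum>T\<in>Pow (insert v S). h T) = (\<Sum>T\<in>Pow S. h T) + (\<Sum>T\<in>Pow S. h (insert v T))"
      if "v \<notin> S" "finite S" for h :: "'i set \<Rightarrow> 'a" and S
    proof -
      have "inj_on (insert v) (Pow S)" using that by (auto simp: inj_on_def)
      moreover have "Pow S \<inter> insert v ` Pow S = {}" using that by auto
      ultimately show ?thesis
        using that by (simp add: Pow_insert sum.union_disjoint sum.reindex)
    qed
    show ?thesis
    proof (cases "v \<in> S")
      case False
      have "?g (gder v (x * y)) S = gsign {v} S *
          ((\<Sum>T\<in>Pow S. gsign T (insert v S - T) * ?g x T * ?g y (insert v S - T)) +
           (\<Sum>T\<in>Pow S. gsign (insert v T) (insert v S - insert v T) * ?g x (insert v T) * ?g y (insert v S - insert v T)))"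
        using False fin by (simp add: gcoeff_gder times_grassmann.rep_eq Pow_insert')
      also have "\<dots> =
          (\<Sum>T\<in>Pow S. gsign {v} S * (gsign (insert v T) (insert v S - insert v T) * ?g x (insert v T) * ?g y (insert v S - insert v T))) +
          (\<Sum>T\<in>Pow S. gsign {v} S * (gsign T (insert v S - T) * ?g x T * ?g y (insert v S - T)))"
        unfolding distrib_left sum_distrib_left by (rule add.commute)
      also have "\<dots> = (\<Sum>T\<in>Pow S. gsign T (S - T) * (gsign {v} T * ?g x (insert v T)) * ?g y (S - T)) +
           (\<Sum>T\<in>Pow S. gsign T (S - T) * ((- 1) ^ card T * ?g x T) * (gsign {v} (S - T) * ?g y (insert v (S - T))))"
      proof (intro arg_cong2[of _ _ _ _ "(+)"] sum.cong refl)
        fix T assume T: "T \<in> Pow S"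
        define U where "U = S - T"
        have S: "S = T \<union> U" and f: "finite T" "finite U" "T \<inter> U = {}" "v \<notin> T" "v \<notin> U"
          using T fin False by (auto simp: U_def intro: finite_subset)
        have ins: "insert v T = {v} \<union> T" "insert v U = {v} \<union> U" by auto
        have sS: "gsign {v} S = gsign {v} T * (gsign {v} U :: 'a)"
          unfolding S using f by (intro gsign_Un_right) auto
        have e1: "insert v S - insert v T = U" "insert v S - T = insert v U" using f S by auto
        have s1: "gsign (insert v T) U = gsign {v} U * (gsign T U :: 'a)"
          unfolding ins using f by (intro gsign_Un_left) auto
        have s2: "gsign T (insert v U) = (- 1) ^ card T * gsign {v} T * (gsign T U :: 'a)"
          unfolding ins gsign_swap[OF f(1,4), symmetric] using f by (intro gsign_Un_right) auto
        have q: "gsign {v} T * (gsign {v} T * z) = z" "gsign {v} U * (gsign {v} U * z) = z" for z :: 'a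
          by (simp_all add: mult.assoc[symmetric])
        show "gsign {v} S * (gsign (insert v T) (insert v S - insert v T) * ?g x (insert v T) *
            ?g y (insert v S - insert v T)) = gsign T (S - T) * (gsign {v} T * ?g x (insert v T)) * ?g y (S - T)"
          unfolding e1 s1 sS U_def[symmetric] by (simp add: q ac_simps)
        show "gsign {v} S * (gsign T (insert v S - T) * ?g x T * ?g y (insert v S - T)) =
            gsign T (S - T) * ((- 1) ^ card T * ?g x T) * (gsign {v} (S - T) * ?g y (insert v (S - T)))"
          unfolding e1 s2 sS U_def[symmetric] by (simp add: q ac_simps)
      qed
      also have "\<dots> = ?g (gder v x * y + ginv x * gder v y) S"
        unfolding plus_grassmann.rep_eq times_grassmann.rep_eq
        by (intro arg_cong2[of _ _ _ _ "(+)"] sum.cong refl) (use False in \<open>auto simp: gcoeff_gder gcoeff_ginv\<close>)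
      finally show ?thesis .
    next
      case True
      define R where "R = S - {v}"
      have R: "S = insert v R" "v \<notin> R" "finite R" using True fin by (auto simp: R_def)
      have "?g (gder v x * y + ginv x * gder v y) S =
          (\<Sum>T\<in>Pow R. gsign T (S - T) * ?g (gder v x) T * ?g y (S - T)) +
          (\<Sum>T\<in>Pow R. gsign (insert v T) (S - insert v T) * ?g (ginv x) (insert v T) * ?g (gder v y) (S - insert v T))"
      proof -
        have 1: "(\<Sum>T\<in>Pow R. gsign (insert v T) (S - insert v T) * ?g (gder v x) (insert v T) * ?g y (S - insert v T)) = 0"
          by (rule sum.neutral) (simp add: gcoeff_gder)
        have 2: "(\<Sum>T\<in>Pow R. gsign T (S - T) * ?g (ginv x) T * ?g (gder v y) (S - T)) = 0"
          by (rule sum.neutral) (use R in \<open>auto simp: gcoeff_gder\<close>)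
        show ?thesis
          unfolding plus_grassmann.rep_eq times_grassmann.rep_eq
          unfolding R(1) Pow_insert'[OF R(2,3)]
          unfolding R(1)[symmetric] 1 2 by simp
      qed
      also have "\<dots> = (\<Sum>T\<in>Pow R. 0)"
        unfolding sum.distrib[symmetric]
      proof (intro sum.cong refl)
        fix T assume T: "T \<in> Pow R"
        define U where "U = R - T"
        have f: "finite T" "finite U" "T \<inter> U = {}" "v \<notin> T" "v \<notin> U"
          using T R by (auto simp: U_def intro: finite_subset)
        have e: "S - T = insert v U" "S - insert v T = U" using R f by (auto simp: U_def)
        have ins: "insert v T = {v} \<union> T" "insert v U = {v} \<union> U" by auto
        have s1: "gsign (insert v T) U = gsign {v} U * (gsign T U :: 'a)"
          unfolding ins using f by (intro gsign_Un_left) auto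
        have s2: "gsign T (insert v U) = (- 1) ^ card T * gsign {v} T * (gsign T U :: 'a)"
          unfolding ins gsign_swap[OF f(1,4), symmetric] using f by (intro gsign_Un_right) auto
        have q: "gsign {v} T * (gsign {v} T * z) = z" "gsign {v} U * (gsign {v} U * z) = z" for z :: 'a
          by (simp_all add: mult.assoc[symmetric])
        have c: "card (insert v T) = Suc (card T)" using f by simp
        show "gsign T (S - T) * ?g (gder v x) T * ?g y (S - T) +
            gsign (insert v T) (S - insert v T) * ?g (ginv x) (insert v T) * ?g (gder v y) (S - insert v T) = 0"
          unfolding e s1 s2 gcoeff_gder gcoeff_ginv c using f
          by (simp add: q ac_simps)
      qed
      finally show ?thesis using True by (simp add: gcoeff_gder)
    qed
  qed (simp add: gcoeff_infinite)
qed

lemma gcoeff_mult_ggen: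
  fixes x :: "('i::linorder, 'a::comm_ring_1) grassmann"
  assumes "finite S"
  shows "gcoeff (x * ggen u) S = (if u \<in> S then gsign (S - {u}) {u} * gcoeff x (S - {u}) else 0)"
    "gcoeff (ggen u * x) S = (if u \<in> S then gsign {u} (S - {u}) * gcoeff x (S - {u}) else 0)"
proof -
  have "(\<Sum>T\<in>Pow S. gsign T (S - T) * gcoeff x T * gcoeff (ggen u) (S - T)) =
      (\<Sum>T\<in>Pow S. if T = S - {u} then (if u \<in> S then gsign (S - {u}) {u} * gcoeff x (S - {u}) else 0) else 0)"
  proof (rule sum.cong)
    fix T assume "T \<in> Pow S"
    then have "S - T = {u} \<longleftrightarrow> T = S - {u} \<and> u \<in> S" by auto
    then show "gsign T (S - T) * gcoeff x T * gcoeff (ggen u) (S - T) =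
        (if T = S - {u} then (if u \<in> S then gsign (S - {u}) {u} * gcoeff x (S - {u}) else 0) else 0)"
      by (auto simp: gcoeff_ggen)
  qed simp
  then show "gcoeff (x * ggen u) S = (if u \<in> S then gsign (S - {u}) {u} * gcoeff x (S - {u}) else 0)"
    using assms by (simp add: times_grassmann.rep_eq)
  have "(\<Sum>T\<in>Pow S. gsign T (S - T) * gcoeff (ggen u) T * gcoeff x (S - T)) =
      (\<Sum>T\<in>Pow S. if T = {u} then gsign {u} (S - {u}) * gcoeff x (S - {u}) else 0)"
    by (rule sum.cong) (auto simp: gcoeff_ggen)
  then show "gcoeff (ggen u * x) S = (if u \<in> S then gsign {u} (S - {u}) * gcoeff x (S - {u}) else 0)"
    using assms by (simp add: times_grassmann.rep_eq)
qed

lemma ggen_ginv: "ggen u * ginv x = x * ggen u"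
proof (rule grassmann_eqI)
  fix S
  show "gcoeff (ggen u * ginv x) S = gcoeff (x * ggen u) S"
    by (cases "finite S")
      (auto simp: gcoeff_mult_ggen gcoeff_ginv gcoeff_infinite gsign_swap mult.assoc)
qed

lemma gder_add: "gder v (x + y) = gder v x + gder v y"
  by (rule grassmann_eqI) (simp add: gcoeff_gder plus_grassmann.rep_eq distrib_left)

lemma gder_gconst: "gder v (gconst a) = 0"
  by (rule grassmann_eqI) (simp add: gcoeff_gder gcoeff_gconst zero_grassmann.rep_eq)

lemma gder_ggen: "gder v (ggen u) = (if u = v then 1 else 0)"
  by (rule grassmann_eqI)
    (auto simp: gcoeff_gder gcoeff_ggen zero_grassmann.rep_eq one_grassmann.rep_eq)

lemma gder_even_mult:
  "ggen u * gder v (x * y) = ggen u * gder v x * y + x * (ggen u * gder v y)"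
proof -
  have "ggen u * (ginv x * gder v y) = x * (ggen u * gder v y)"
    by (simp add: mult.assoc[symmetric] ggen_ginv)
  then show ?thesis by (simp add: gder_mult distrib_left mult.assoc)
qed

definition evder_poly :: "nat \<Rightarrow> nat \<Rightarrow> nat \<Rightarrow> 'k::field cpoly \<Rightarrow> 'k cpoly" where
  "evder_poly N i j p = (\<Sum>k=1..N.
     Poly_Mapping.single (Poly_Mapping.single (prod_encode (k, j)) 1) 1 * pdv (prod_encode (k, i)) p)"

definition evder :: "nat \<Rightarrow> nat \<Rightarrow> nat \<Rightarrow> 'k::field salg \<Rightarrow> 'k salg" where
  "evder N i j x = gmap (dfract (evder_poly N i j)) x +
     (\<Sum>k=1..N. ggen (prod_encode (k, j)) * gder (prod_encode (k, i)) x)"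

lemma is_deriv_evder_poly: "is_deriv (evder_poly N i j)"
  unfolding evder_poly_def by (rule is_deriv_sum) (rule is_deriv_pdv)

lemma is_deriv_evder_fract: "is_deriv (dfract (evder_poly N i j))"
  by (rule is_deriv_dfract[OF is_deriv_evder_poly])

lemma evder_add: "evder N i j (x + y) = evder N i j x + evder N i j y"
proof -
  have "gmap d (x + y) = gmap d x + gmap d y" if "is_deriv d" for d
    by (rule grassmann_eqI) (simp add: gcoeff_gmap is_derivD[OF that] plus_grassmann.rep_eq)
  then show ?thesis
    by (simp add: evder_def is_deriv_evder_fract gder_add distrib_left sum.distrib algebra_simps)
qed

lemma evder_mult: "evder N i j (x * y) = evder N i j x * y + x * evder N i j y"
  unfolding evder_def gmap_mult[OF is_deriv_evder_fract] gder_even_mult sum.distrib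
  by (simp add: distrib_left distrib_right sum_distrib_left sum_distrib_right algebra_simps)

lemma gmap_gconst: "d 0 = 0 \<Longrightarrow> gmap d (gconst a) = gconst (d a)"
  by (rule grassmann_eqI) (simp add: gcoeff_gmap gcoeff_gconst)

lemma gmap_ggen: "d 0 = 0 \<Longrightarrow> d 1 = 0 \<Longrightarrow> gmap d (ggen u) = 0"
  by (rule grassmann_eqI) (simp add: gcoeff_gmap gcoeff_ggen zero_grassmann.rep_eq)

lemma evder_gconst: "evder N i j (gconst a) = gconst (dfract (evder_poly N i j) a)"
  by (simp add: evder_def gder_gconst gmap_gconst is_derivD[OF is_deriv_evder_fract])

lemma evder_poly_const: "evder_poly N i j (Poly_Mapping.single 0 a) = 0"
  by (simp add: evder_poly_def pdv_single)

lemma evder_kconst: "evder N i j (kconst a) = 0"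
  by (simp add: kconst_def evder_gconst dfract_Fract[OF is_deriv_evder_poly] evder_poly_const
      is_derivD[OF is_deriv_evder_poly] Zero_fract_def[symmetric] gconst_0)

lemma evder_evvar:
  assumes "k \<in> {1..N}"
  shows "evder N i j (evvar k l) = (if l = i then evvar k j else 0)"
proof -
  let ?X = "\<lambda>k l. Poly_Mapping.single (Poly_Mapping.single (prod_encode (k, l)) 1) 1 :: 'a cpoly"
  have "pdv (prod_encode (k', i)) (?X k l) = (if k' = k \<and> l = i then 1 else 0)" for k'
    by (auto simp: pdv_single lookup_single when_def)
  then have "evder_poly N i j (?X k l) = (\<Sum>k'=1..N. if k' = k then (if l = i then ?X k' j else 0) else 0)"
    unfolding evder_poly_def by (intro sum.cong) auto
  also have "\<dots> = (if l = i then ?X k j else 0)" using assms by simp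
  finally show ?thesis
    by (simp add: evvar_def evder_gconst dfract_Fract[OF is_deriv_evder_poly]
        is_derivD[OF is_deriv_evder_poly] Zero_fract_def[symmetric] gconst_0)
qed

lemma evder_oddvar:
  assumes "k \<in> {1..N}"
  shows "evder N i j (oddvar k l) = (if l = i then oddvar k j else 0 :: 'k::field salg)"
proof -
  have "evder N i j (oddvar k l :: 'k salg) =
      (\<Sum>k'=1..N. ggen (prod_encode (k', j)) * gder (prod_encode (k', i)) (ggen (prod_encode (k, l))))"
    by (simp add: evder_def oddvar_def gmap_ggen is_derivD[OF is_deriv_evder_fract])
  also have "\<dots> = (\<Sum>k'=1..N. if k' = k then (if l = i then ggen (prod_encode (k', j)) else 0) else 0)"
    by (intro sum.cong) (auto simp: gder_ggen)
  finally show ?thesis using assms by (simp add: oddvar_def)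
qed

lemma Aev_subset: "Aev m n \<subseteq> Amn m n"
proof
  fix x assume "x \<in> Aev m n"
  then show "x \<in> Amn m n"
    by induction (auto intro: Amn.intros)
qed

lemma Aev_gconst: "x \<in> Aev m n \<Longrightarrow> \<exists>q. x = gconst q"
  by (induction rule: Aev.induct)
    (auto simp: kconst_def cgen_def evvar_def gconst_add[symmetric] gconst_mult[symmetric])

lemma rinv_unique:
  assumes "x * y = 1" "y * x = (1 :: 'a::ring_1)"
  shows "rinv x = y"
  unfolding rinv_def
proof (rule the_equality)
  fix z assume "x * z = 1 \<and> z * x = 1"
  then show "z = y" using assms by (metis mult.assoc mult_1_left mult_1_right)
qed (use assms in auto)

lemma rinv_gconst:
  assumes "gconst q \<noteq> (0 :: 'k::field salg)"
  shows "rinv (gconst q :: 'k salg) = gconst (inverse q)" "q \<noteq> 0"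
proof -
  show q: "q \<noteq> 0" using assms gconst_0 by metis
  show "rinv (gconst q :: 'k salg) = gconst (inverse q)"
    using q by (intro rinv_unique) (simp_all add: gconst_mult[symmetric] gconst_1)
qed

lemma is_evder_evder:
  assumes i: "i \<in> {1..m + n}" and j: "j \<in> {1..m + n}" and par: "(i \<le> m) = (j \<le> m)"
  shows "is_evder m n i j (evder (m + n) i j :: 'k::field salg \<Rightarrow> 'k salg)"
proof -
  let ?D = "evder (m + n) i j :: 'k salg \<Rightarrow> 'k salg"
  have Dgen: "?D (cgen m k l) = (if l = i then cgen m k j else 0)" if "k \<in> {1..m + n}" for k l
    using that par by (auto simp: cgen_def evder_evvar evder_oddvar)
  have A0: "(0 :: 'k salg) \<in> Amn m n"
    using Amn.const[of 0] by (simp_all add: kconst_def gconst_0 Zero_fract_def[symmetric])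
  have A: "?D x \<in> Amn m n" if "x \<in> Amn m n" for x :: "'k salg"
    using that
  proof induction
    case (gen k l)
    then show ?case using j A0 Dgen by (auto intro: Amn.gen)
  qed (auto simp: evder_kconst evder_add evder_mult A0 intro: Amn.intros)
  have Dlin: "Vector_Spaces.linear kscale kscale ?D"
    unfolding Vector_Spaces.linear_iff
    using vector_space_kscale by (auto simp: evder_add evder_mult kscale_def evder_kconst)
  have "?D x \<in> Kmn m n" if xK: "x \<in> Kmn m n" for x :: "'k salg"
  proof -
    obtain a f where x: "x = a * rinv f" "a \<in> Amn m n" "f \<in> Aev m n" "f \<noteq> 0"
      using xK by (auto simp: Kmn_def)
    obtain q where q: "f = gconst q" using Aev_gconst[OF x(3)] by blast
    have q0: "q \<noteq> 0" and r: "rinv f = gconst (inverse q)" using rinv_gconst x(4) q by auto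
    define d :: "'k cpoly fract \<Rightarrow> 'k cpoly fract" where "d = dfract (evder_poly (m + n) i j)"
    have Df: "?D f = gconst (d q)" unfolding q d_def by (rule evder_gconst)
    have d: "is_deriv d" unfolding d_def by (rule is_deriv_evder_fract)
    have "d (q * inverse q) = 0" using q0 is_derivD[OF d] by simp
    then have "q * d (inverse q) = - (d q * inverse q)"
      unfolding is_derivD(2)[OF d] by (simp add: add_eq_0_iff)
    then have "d (inverse q) = - d q * inverse (q * q)"
      using q0 by (simp add: field_simps)
    note Dinv = this
    have qq: "q * inverse (q * q) = inverse q" using q0 by (simp add: field_simps)
    have "?D x = ?D a * gconst (q * inverse (q * q)) + a * gconst (- d q * inverse (q * q))"
      unfolding x(1) r evder_mult evder_gconst d_def[symmetric] qq Dinv ..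
    also have "\<dots> = (?D a * f + a * gconst (- d q)) * gconst (inverse (q * q))"
      by (simp only: q gconst_mult distrib_right mult.assoc)
    also have "gconst (inverse (q * q)) = rinv (f * f)"
      unfolding q gconst_mult[symmetric]
      using q0 by (intro rinv_unique[symmetric])
        (simp_all only: gconst_mult[symmetric] gconst_1[symmetric] right_inverse left_inverse
          mult_eq_0_iff de_Morgan_disj simp_thms)
    finally have Dx: "?D x = (?D a * f + a * gconst (- d q)) * rinv (f * f)" .
    have "gconst (- d q) = kconst (- 1) * ?D f"
      unfolding Df kconst_def gconst_mult[symmetric]
      by (simp add: single_uminus minus_fract[symmetric] One_fract_def[symmetric])
    then have "?D a * f + a * gconst (- d q) \<in> Amn m n"
      using A x Aev_subset by (auto intro!: Amn.intros)
    moreover have "f * f \<in> Aev m n" using x by (auto intro: Aev.mult)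
    moreover have "f * f \<noteq> 0"
    proof
      assume "f * f = 0"
      then have "gcoeff (gconst (q * q) :: 'k salg) {} = 0"
        unfolding q gconst_mult[symmetric] by (simp add: zero_grassmann.rep_eq)
      then show False using q0 by (simp add: gcoeff_gconst)
    qed
    ultimately show ?thesis unfolding Dx Kmn_def by blast
  qed
  then show ?thesis
    using Dlin Dgen by (auto simp: is_evder_def evder_mult)
qed


section \<open>Tensor products\<close>

text \<open>
  \<open>'k tens\<close> is the direct sum over \<open>k\<close> of the tensor products over \<open>'k\<close> of one plus \<open>k\<close> copies of \<open>'k salg\<close>:
  the free abelian group on tuples \<open>(a, [y\<^sub>1, \<dots>, y\<^sub>k])\<close>, standing for \<open>a \<otimes> y\<^sub>1 \<otimes> \<cdots> \<otimes> y\<^sub>k\<close>,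
  modulo additivity in each slot and the balancing relations for scalars. Since \<open>'k\<close> is a
  field, the tensor product of subspaces of \<open>'k salg\<close> embeds into it.
\<close>

inductive_set tnull :: "('k::field salg \<times> 'k salg list \<Rightarrow>\<^sub>0 int) set" where
  zero: "0 \<in> tnull"
| diff: "x \<in> tnull \<Longrightarrow> y \<in> tnull \<Longrightarrow> x - y \<in> tnull"
| head: "frag_of (a + b, ys) - frag_of (a, ys) - frag_of (b, ys) \<in> tnull"
| slot: "frag_of (a, us @ (x + y) # vs) - frag_of (a, us @ x # vs) - frag_of (a, us @ y # vs) \<in> tnull"
| balance: "frag_of (a, us @ kscale c x # vs) - frag_of (kscale c a, us @ x # vs) \<in> tnull"

definition trel where
  "trel x y \<longleftrightarrow> x - y \<in> tnull"

lemma tnull_uminus: "x \<in> tnull \<Longrightarrow> - x \<in> tnull"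
  using tnull.diff[OF tnull.zero, of x] by simp

lemma tnull_add: "x \<in> tnull \<Longrightarrow> y \<in> tnull \<Longrightarrow> x + y \<in> tnull"
  using tnull.diff[OF _ tnull_uminus, of x y] by simp

lifting_forget grassmann.lifting
lifting_forget fract.lifting
lifting_forget poly_mapping.lifting

quotient_type (overloaded) 'k tens = "'k::field salg \<times> 'k salg list \<Rightarrow>\<^sub>0 int" / trel
proof (rule equivpI)
  show "reflp trel" by (auto simp: reflp_def trel_def intro: tnull.zero)
  show "symp trel" unfolding symp_def trel_def using tnull_uminus minus_diff_eq by metis
  show "transp trel"
    unfolding transp_def trel_def
  proof (intro allI impI)
    fix x y z :: "'a salg \<times> 'a salg list \<Rightarrow>\<^sub>0 int"
    assume "x - y \<in> tnull" "y - z \<in> tnull"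
    then show "x - z \<in> tnull" using tnull_add[of "x - y" "y - z"] by simp
  qed
qed

lift_definition tpure :: "'k::field salg \<Rightarrow> 'k salg list \<Rightarrow> 'k tens" is
  "\<lambda>a ys. frag_of (a, ys)" .

instantiation tens :: (field) ab_group_add
begin

lift_definition zero_tens :: "'a tens" is 0 .

lift_definition plus_tens :: "'a tens \<Rightarrow> 'a tens \<Rightarrow> 'a tens" is "(+)"
proof -
  fix x x' y y' :: "'a salg \<times> 'a salg list \<Rightarrow>\<^sub>0 int"
  assume "trel x x'" "trel y y'"
  then show "trel (x + y) (x' + y')"
    using tnull_add[of "x - x'" "y - y'"] by (simp add: trel_def algebra_simps)
qed

lift_definition uminus_tens :: "'a tens \<Rightarrow> 'a tens" is uminus
proof -
  fix x x' :: "'a salg \<times> 'a salg list \<Rightarrow>\<^sub>0 int"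
  assume "trel x x'"
  then show "trel (- x) (- x')"
    using tnull_uminus[of "x - x'"] by (simp add: trel_def)
qed

lift_definition minus_tens :: "'a tens \<Rightarrow> 'a tens \<Rightarrow> 'a tens" is "(-)"
proof -
  fix x x' y y' :: "'a salg \<times> 'a salg list \<Rightarrow>\<^sub>0 int"
  assume "trel x x'" "trel y y'"
  then show "trel (x - y) (x' - y')"
    using tnull.diff[of "x - x'" "y - y'"] by (simp add: trel_def algebra_simps)
qed

instance
  by standard (transfer; simp add: trel_def tnull.zero algebra_simps)+

end

lemma kscale_mult_left: "kscale c a * b = kscale c (a * b)"
  by (simp add: kscale_def mult.assoc)

lemma kscale_mult_right: "a * kscale c b = kscale c (a * b)"
  unfolding kscale_def mult.assoc[symmetric] kconst_commute[of c a] ..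

lemma frag_ind [case_names zero one diff]:
  fixes c :: "'a \<Rightarrow>\<^sub>0 int"
  assumes "P 0" "\<And>x. P (frag_of x)" "\<And>a b. P a \<Longrightarrow> P b \<Longrightarrow> P (a - b)"
  shows "P c"
  by (rule frag_induction[OF subset_UNIV]) (use assms in auto)

lemma frag_extend_tnull:
  assumes "\<And>q. h q \<in> tnull"
  shows "frag_extend h x \<in> tnull"
  by (induction x rule: frag_ind) (auto simp: frag_extend_diff intro: tnull.zero tnull.diff assms)

definition tmul_raw where
  "tmul_raw x y = frag_extend (\<lambda>p. frag_extend (\<lambda>q. frag_of (fst p * fst q, snd p @ snd q)) y) x"

lemma tmul_raw_diff_left: "tmul_raw (x - x') y = tmul_raw x y - tmul_raw x' y"
  by (simp add: tmul_raw_def frag_extend_diff)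

lemma tmul_raw_diff_right: "tmul_raw x (y - y') = tmul_raw x y - tmul_raw x y'"
  by (induction x rule: frag_ind)
    (auto simp: tmul_raw_diff_left, auto simp: tmul_raw_def frag_extend_diff)

lemma tmul_raw_of: "tmul_raw (frag_of (a, us)) (frag_of (b, vs)) = frag_of (a * b, us @ vs)"
  by (simp add: tmul_raw_def)

lemma tmul_raw_0 [simp]: "tmul_raw 0 y = 0" "tmul_raw x 0 = 0"
  using tmul_raw_diff_left[of 0 0 y] tmul_raw_diff_right[of x 0 0] by simp_all

lemma tmul_raw_null_left:
  assumes "x \<in> tnull"
  shows "tmul_raw x y \<in> tnull"
proof -
  have of: "tmul_raw x (frag_of (b, ws)) \<in> tnull" for b ws
    using assms
  proof induction
    case (slot a us x y vs)
    show ?case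
      using tnull.slot[of "a * b" us x y "vs @ ws"] by (simp add: tmul_raw_diff_left tmul_raw_of)
  next
    case (balance a us c x vs)
    show ?case
      using tnull.balance[of "a * b" us c x "vs @ ws"]
      by (simp add: tmul_raw_diff_left tmul_raw_of kscale_mult_left)
  qed (auto simp: tmul_raw_diff_left tmul_raw_of distrib_right intro: tnull.intros)
  show ?thesis
    by (induction y rule: frag_ind)
      (auto simp: tmul_raw_diff_right of intro: tnull.intros)
qed

lemma tmul_raw_null_right:
  assumes "y \<in> tnull"
  shows "tmul_raw x y \<in> tnull"
proof -
  have of: "tmul_raw (frag_of (b, ws)) y \<in> tnull" for b ws
    using assms
  proof induction
    case (slot a us x y vs)
    show ?case
      using tnull.slot[of "b * a" "ws @ us" x y vs] by (simp add: tmul_raw_diff_right tmul_raw_of)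
  next
    case (balance a us c x vs)
    show ?case
      using tnull.balance[of "b * a" "ws @ us" c x vs]
      by (simp add: tmul_raw_diff_right tmul_raw_of kscale_mult_right)
  qed (auto simp: tmul_raw_diff_right tmul_raw_of distrib_left intro: tnull.intros)
  show ?thesis
    by (induction x rule: frag_ind)
      (auto simp: tmul_raw_diff_left of intro: tnull.intros)
qed

text \<open>
  \<open>(a \<otimes> y\<^sub>1 \<otimes> \<cdots> \<otimes> y\<^sub>k) (b \<otimes> z\<^sub>1 \<otimes> \<cdots> \<otimes> z\<^sub>l) = ab \<otimes> y\<^sub>1 \<otimes> \<cdots> \<otimes> y\<^sub>k \<otimes> z\<^sub>1 \<otimes> \<cdots> \<otimes> z\<^sub>l\<close>. No sign occurs; this is the
  intended product because the left coefficients used below are even.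
\<close>

instantiation tens :: (field) "{ring, monoid_mult}"
begin

lift_definition one_tens :: "'a tens" is "frag_of (1, [])" .

lift_definition times_tens :: "'a tens \<Rightarrow> 'a tens \<Rightarrow> 'a tens" is tmul_raw
proof -
  fix x x' y y' :: "'a salg \<times> 'a salg list \<Rightarrow>\<^sub>0 int"
  assume "trel x x'" "trel y y'"
  then show "trel (tmul_raw x y) (tmul_raw x' y')"
    using tnull_add[OF tmul_raw_null_left[of "x - x'" y] tmul_raw_null_right[of "y - y'" x']]
    by (simp add: trel_def tmul_raw_diff_left tmul_raw_diff_right)
qed

instance
proof
  fix x y z :: "'a tens"
  show "x * y * z = x * (y * z)"
  proof transfer
    fix x y z :: "'a salg \<times> 'a salg list \<Rightarrow>\<^sub>0 int"
    have 1: "tmul_raw (tmul_raw (frag_of p) (frag_of q)) z = tmul_raw (frag_of p) (tmul_raw (frag_of q) z)" for p q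
      by (cases p, cases q, induction z rule: frag_ind)
        (auto simp: tmul_raw_diff_right tmul_raw_of mult.assoc)
    have 2: "tmul_raw (tmul_raw (frag_of p) y) z = tmul_raw (frag_of p) (tmul_raw y z)" for p
      by (induction y rule: frag_ind)
        (auto simp: tmul_raw_diff_right tmul_raw_diff_left 1)
    have "tmul_raw (tmul_raw x y) z = tmul_raw x (tmul_raw y z)"
      by (induction x rule: frag_ind) (auto simp: tmul_raw_diff_left 2)
    then show "trel (tmul_raw (tmul_raw x y) z) (tmul_raw x (tmul_raw y z))"
      by (simp add: trel_def tnull.zero)
  qed
  show "1 * x = x"
  proof transfer
    fix x :: "'a salg \<times> 'a salg list \<Rightarrow>\<^sub>0 int"
    have "tmul_raw (frag_of (1, [])) x = x"
      by (induction x rule: frag_ind) (auto simp: tmul_raw_diff_right tmul_raw_of)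
    then show "trel (tmul_raw (frag_of (1, [])) x) x"
      by (simp add: trel_def tnull.zero)
  qed
  show "x * 1 = x"
  proof transfer
    fix x :: "'a salg \<times> 'a salg list \<Rightarrow>\<^sub>0 int"
    have "tmul_raw x (frag_of (1, [])) = x"
      by (induction x rule: frag_ind) (auto simp: tmul_raw_diff_left tmul_raw_of)
    then show "trel (tmul_raw x (frag_of (1, []))) x"
      by (simp add: trel_def tnull.zero)
  qed
  show "(x + y) * z = x * z + y * z"
    by transfer (simp add: tmul_raw_def frag_extend_add trel_def tnull.zero)
  show "x * (y + z) = x * y + x * z"
  proof transfer
    fix x y z :: "'a salg \<times> 'a salg list \<Rightarrow>\<^sub>0 int"
    have "tmul_raw x (y - (0 - z)) = tmul_raw x y + tmul_raw x z"
      by (simp only: tmul_raw_diff_right) simp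
    then show "trel (tmul_raw x (y + z)) (tmul_raw x y + tmul_raw x z)"
      by (simp add: trel_def tnull.zero)
  qed
qed

end

lemma tpure_mult: "tpure a us * tpure b vs = tpure (a * b) (us @ vs)"
  by transfer (simp add: tmul_raw_of trel_def tnull.zero)

abbreviation tcoeff :: "'k::field salg \<Rightarrow> 'k tens" where
  "tcoeff a \<equiv> tpure a []"

definition tscale :: "'k::field \<Rightarrow> 'k tens \<Rightarrow> 'k tens" where
  "tscale c w = tcoeff (kconst c) * w"

lemma tpure_add_head: "tpure (a + b) ys = tpure a ys + tpure b ys"
  by transfer (use tnull.head in \<open>simp add: trel_def algebra_simps\<close>)

lemma tcoeff_1: "tcoeff 1 = 1"
  by transfer (simp add: trel_def tnull.zero)

lemma vector_space_tscale: "vector_space (tscale :: 'k::field \<Rightarrow> _)"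
proof
  fix a b :: 'k and x y :: "'k tens"
  show "tscale 1 x = x"
    by (simp add: tscale_def kconst_simps tcoeff_1)
  show "tscale a (tscale b x) = tscale (a * b) x"
    by (simp add: tscale_def kconst_simps mult.assoc[symmetric] tpure_mult)
qed (simp_all add: tscale_def distrib_left distrib_right kconst_simps tpure_add_head)

text \<open>The Leibniz action of a linear operator on tensor products (junk value for nonlinear operators).\<close>

definition tact_raw where
  "tact_raw D = frag_extend (\<lambda>(a, ys). frag_of (D a, ys) +
     (\<Sum>l<length ys. frag_of (a, ys[l := D (ys ! l)])))"

lemma tnull_sum: "(\<And>i. i \<in> A \<Longrightarrow> f i \<in> tnull) \<Longrightarrow> sum f A \<in> tnull"
  by (induction A rule: infinite_finite_induct) (auto intro: tnull.zero tnull_add)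

lemma tact_raw_diff: "tact_raw D (x - y) = tact_raw D x - tact_raw D y"
  by (simp add: tact_raw_def frag_extend_diff)

lemma tact_raw_add: "tact_raw D (x + y) = tact_raw D x + tact_raw D y"
  by (simp add: tact_raw_def frag_extend_add)

lemma tact_raw_of: "tact_raw D (frag_of (a, ys)) =
    frag_of (D a, ys) + (\<Sum>l<length ys. frag_of (a, ys[l := D (ys ! l)]))"
  by (simp add: tact_raw_def)

lemma list_update_slot:
  assumes "l < length (us @ z # vs)"
  obtains us' vs' where "\<And>x. (us @ x # vs)[l := f ((us @ x # vs) ! l)] = us' @ x # vs'"
  | "\<And>x. (us @ x # vs)[l := f ((us @ x # vs) ! l)] = us @ f x # vs"
proof -
  consider "l < length us" | "l = length us" | k where "l = length us + Suc k"
    by (metis less_imp_Suc_add linorder_neqE_nat add_Suc_right)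
  then show ?thesis
  proof cases
    case 1
    then show ?thesis using that(1)[of "us[l := f (us ! l)]" vs] by (simp add: list_update_append nth_append)
  next
    case 2
    then show ?thesis using that(2) by simp
  next
    case 3
    then show ?thesis using that(1)[of us "vs[k := f (vs ! k)]"] by (simp add: list_update_append nth_append)
  qed
qed

lemma tact_raw_null:
  assumes lin: "Vector_Spaces.linear kscale kscale D" and "x \<in> tnull"
  shows "tact_raw D x \<in> tnull"
proof -
  interpret D: Vector_Spaces.linear kscale kscale D by fact
  show ?thesis
    using assms(2)
  proof induction
    case zero
    show ?case by (simp add: tact_raw_def tnull.zero)
  next
    case (diff x y)
    then show ?case by (simp add: tact_raw_diff tnull.diff)
  next
    case (head a b ys)
    have "(frag_of (D (a + b), ys) - frag_of (D a, ys) - frag_of (D b, ys)) +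
        (\<Sum>l<length ys. frag_of (a + b, ys[l := D (ys ! l)]) - frag_of (a, ys[l := D (ys ! l)])
          - frag_of (b, ys[l := D (ys ! l)])) \<in> tnull"
      unfolding D.add by (intro tnull_add tnull_sum tnull.head)
    then show ?case
      by (simp add: tact_raw_diff tact_raw_add tact_raw_of sum_subtractf sum.distrib algebra_simps)
  next
    case (slot a us x y vs)
    let ?u = "\<lambda>z l. (us @ z # vs)[l := D ((us @ z # vs) ! l)]"
    have "frag_of (a, ?u (x + y) l) - frag_of (a, ?u x l) - frag_of (a, ?u y l) \<in> tnull"
      if "l < length (us @ x # vs)" for l
      using that by (rule list_update_slot[of l us x vs D]) (simp_all only: D.add tnull.slot)
    then have "(frag_of (D a, us @ (x + y) # vs) - frag_of (D a, us @ x # vs) - frag_of (D a, us @ y # vs)) +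
        (\<Sum>l<length (us @ x # vs). frag_of (a, ?u (x + y) l) - frag_of (a, ?u x l) - frag_of (a, ?u y l))
        \<in> tnull"
      by (intro tnull_add tnull_sum tnull.slot) simp
    then show ?case
      by (simp add: tact_raw_diff tact_raw_add tact_raw_of sum_subtractf sum.distrib algebra_simps)
  next
    case (balance a us c x vs)
    let ?u = "\<lambda>z l. (us @ z # vs)[l := D ((us @ z # vs) ! l)]"
    have "frag_of (a, ?u (kscale c x) l) - frag_of (kscale c a, ?u x l) \<in> tnull"
      if "l < length (us @ x # vs)" for l
      using that by (rule list_update_slot[of l us x vs D]) (simp_all only: D.scale tnull.balance)
    then have "(frag_of (D a, us @ kscale c x # vs) - frag_of (kscale c (D a), us @ x # vs)) +
        (\<Sum>l<length (us @ x # vs). frag_of (a, ?u (kscale c x) l) - frag_of (kscale c a, ?u x l))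
        \<in> tnull"
      by (intro tnull_add tnull_sum tnull.balance) simp
    then show ?case
      by (simp add: tact_raw_diff tact_raw_add tact_raw_of sum_subtractf sum.distrib D.scale algebra_simps)
  qed
qed

lemma tact_raw_cong:
  assumes "trel x y"
  shows "trel (if Vector_Spaces.linear kscale kscale D then tact_raw D x else 0)
    (if Vector_Spaces.linear kscale kscale D then tact_raw D y else 0)"
  using assms tact_raw_null[of D "x - y"] by (simp add: trel_def tnull.zero tact_raw_diff)

lift_definition tact :: "('k::field salg \<Rightarrow> 'k salg) \<Rightarrow> 'k tens \<Rightarrow> 'k tens" is
  "\<lambda>D x. if Vector_Spaces.linear kscale kscale D then tact_raw D x else 0"
  by (rule tact_raw_cong)

lemma tact_zero: "tact D 0 = 0"
  by transfer (simp add: tact_raw_def trel_def tnull.zero)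

lemma tact_add: "tact D (x + y) = tact D x + tact D y"
  by transfer (simp add: tact_raw_def frag_extend_add trel_def tnull.zero)

lemma abs_tens_add: "abs_tens (x + y) = abs_tens x + abs_tens y"
  by (rule plus_tens.abs_eq[symmetric]; simp add: trel_def tnull.zero)

lemma abs_tens_sum: "abs_tens (sum f A) = (\<Sum>i\<in>A. abs_tens (f i))"
  by (induction A rule: infinite_finite_induct) (simp_all add: zero_tens_def[symmetric] abs_tens_add)

lemma tact_tpure:
  assumes "Vector_Spaces.linear kscale kscale D"
  shows "tact D (tpure a ys) = tpure (D a) ys + (\<Sum>l<length ys. tpure a (ys[l := D (ys ! l)]))"
  using assms
  by (simp add: tpure.abs_eq tact.abs_eq tact_raw_of abs_tens_add abs_tens_sum trel_def tnull.zero)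


section \<open>Determinants\<close>

text \<open>All entries occurring below are even and hence commute, so the order of the factors is immaterial.\<close>

definition ldet :: "nat \<Rightarrow> (nat \<Rightarrow> nat \<Rightarrow> 'a::ring_1) \<Rightarrow> 'a" where
  "ldet s M = (\<Sum>p | p permutes {1..s}. of_int (sign p) * prod_list (map (\<lambda>a. M a (p a)) [1..<Suc s]))"

text \<open>The inverse of the matrix with entries \<open>M a b\<close> for \<open>1 \<le> a, b \<le> s\<close>.\<close>

definition matinv :: "nat \<Rightarrow> (nat \<Rightarrow> nat \<Rightarrow> 'a::ring_1) \<Rightarrow> nat \<Rightarrow> nat \<Rightarrow> 'a" where
  "matinv s M = (THE N. (\<forall>a b. \<not> (a \<in> {1..s} \<and> b \<in> {1..s}) \<longrightarrow> N a b = 0) \<and>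
     (\<forall>a\<in>{1..s}. \<forall>b\<in>{1..s}. (\<Sum>r=1..s. M a r * N r b) = (if a = b then 1 else 0)) \<and>
     (\<forall>a\<in>{1..s}. \<forall>b\<in>{1..s}. (\<Sum>r=1..s. N a r * M r b) = (if a = b then 1 else 0)))"

definition yel :: "nat \<Rightarrow> nat \<Rightarrow> nat \<Rightarrow> 'k::field salg" where
  "yel m k l = (\<Sum>p=1..m. matinv m (cgen m) k p * cgen m p l)"

definition phic :: "nat \<Rightarrow> nat \<Rightarrow> nat \<Rightarrow> 'k::field salg" where
  "phic m i j = cgen m i j - (\<Sum>p=1..m. \<Sum>q=1..m. cgen m i p * matinv m (cgen m) p q * cgen m q j)"

definition Dplus :: "nat \<Rightarrow> nat list \<Rightarrow> 'k::field salg" where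
  "Dplus m is = ldet (length is) (\<lambda>a b. cgen m a (is ! (b - 1)))"

definition Dminus :: "nat \<Rightarrow> nat list \<Rightarrow> 'k::field salg" where
  "Dminus m js = ldet (length js) (\<lambda>a b. phic m (m + a) (js ! (b - 1)))"

definition Yset :: "nat \<Rightarrow> nat \<Rightarrow> 'k::field salg set" where
  "Yset m n = module.span kscale {yel m k l | k l. k \<in> {1..m} \<and> l \<in> {m + 1..m + n}}"


section \<open>Hook partitions and induced modules\<close>

text \<open>Partitions are functions on \<open>{1, 2, \<dots>}\<close>; the value at \<open>0\<close> is irrelevant.\<close>

definition is_partition :: "(nat \<Rightarrow> nat) \<Rightarrow> bool" where
  "is_partition lam \<longleftrightarrow> (\<forall>i\<ge>1. lam (Suc i) \<le> lam i) \<and> (\<exists>N. \<forall>i>N. lam i = 0)"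

definition hook_partition :: "nat \<Rightarrow> nat \<Rightarrow> (nat \<Rightarrow> nat) \<Rightarrow> bool" where
  "hook_partition m n lam \<longleftrightarrow> is_partition lam \<and> lam (m + 1) \<le> n"

definition lamplus :: "nat \<Rightarrow> (nat \<Rightarrow> nat) \<Rightarrow> nat \<Rightarrow> nat" where
  "lamplus m lam i = (if i \<le> m then lam i else 0)"

definition lamminus :: "nat \<Rightarrow> nat \<Rightarrow> (nat \<Rightarrow> nat) \<Rightarrow> nat \<Rightarrow> nat" where
  "lamminus m n lam j = (if j \<le> n then card {i. i > m \<and> j \<le> lam i} else 0)"

text \<open>\<open>ps\<close> and \<open>qs\<close> list the column indices of the factors \<open>D\<^sup>+\<close> and \<open>D\<^sup>-\<close>.\<close>

definition bideterminants :: "nat \<Rightarrow> nat \<Rightarrow> (nat \<Rightarrow> nat) \<Rightarrow> 'k::field salg set" where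
  "bideterminants m n lam =
    {prod_list (map (Dplus m) ps) * prod_list (map (Dminus m) qs) | ps qs.
      (\<forall>is\<in>set ps. length is \<in> {1..m} \<and> set is \<subseteq> {1..m}) \<and>
      (\<forall>js\<in>set qs. length js \<in> {1..n} \<and> set js \<subseteq> {m + 1..m + n}) \<and>
      (\<forall>a\<in>{1..m}. length (filter (\<lambda>is. length is = a) ps) = lamplus m lam a - lamplus m lam (a + 1)) \<and>
      (\<forall>b\<in>{1..n}. length (filter (\<lambda>js. length js = b) qs) = lamminus m n lam b - lamminus m n lam (b + 1))}"

definition H0ev :: "nat \<Rightarrow> nat \<Rightarrow> (nat \<Rightarrow> nat) \<Rightarrow> 'k::field salg set" where
  "H0ev m n lam = module.span kscale (bideterminants m n lam)"

definition H0ev_tensor :: "nat \<Rightarrow> nat \<Rightarrow> (nat \<Rightarrow> nat) \<Rightarrow> nat \<Rightarrow> 'k::field tens set" where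
  "H0ev_tensor m n lam k =
    module.span tscale {tpure h ys | h ys. h \<in> H0ev m n lam \<and> length ys = k \<and> set ys \<subseteq> Yset m n}"

definition hwvec :: "nat \<Rightarrow> nat \<Rightarrow> (nat \<Rightarrow> nat) \<Rightarrow> 'k::field salg" where
  "hwvec m n lam =
    prod_list (map (\<lambda>a. Dplus m [1..<a + 1] ^ (lamplus m lam a - lamplus m lam (a + 1))) [1..<m + 1]) *
    prod_list (map (\<lambda>b. Dminus m [m + 1..<m + b + 1] ^ (lamminus m n lam b - lamminus m n lam (b + 1))) [1..<n + 1])"


section \<open>Even-primitive vectors\<close>

text \<open>
  Weight vectors are the simultaneous eigenvectors, with integral eigenvalues \<open>\<chi>\<^sub>i\<close>, of the
  derivations \<open>\<^sub>i\<^sub>iD\<close>, which span the Lie algebra of the diagonal torus. All operators \<open>D\<close> quantified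
  over below agree on \<open>K(m|n)\<close>, hence on all tensors with components in \<open>K(m|n)\<close>.
\<close>

definition weight_vector :: "nat \<Rightarrow> nat \<Rightarrow> 'k::field tens \<Rightarrow> bool" where
  "weight_vector m n w \<longleftrightarrow> (\<exists>\<chi> :: nat \<Rightarrow> int. \<forall>i\<in>{1..m + n}. \<forall>D. is_evder m n i i D \<longrightarrow>
     tact D w = tscale (of_int (\<chi> i)) w)"

text \<open>The zero vector is allowed.\<close>

definition even_primitive :: "nat \<Rightarrow> nat \<Rightarrow> 'k::field tens \<Rightarrow> bool" where
  "even_primitive m n w \<longleftrightarrow> weight_vector m n w \<and>
    (\<forall>i j D. j < i \<and> (i \<in> {1..m} \<and> j \<in> {1..m} \<or> i \<in> {m + 1..m + n} \<and> j \<in> {m + 1..m + n}) \<longrightarrow>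
      is_evder m n i j D \<longrightarrow> tact D w = 0)"


section \<open>The vectors \<open>\<rho>\<close>, \<open>\<pi>\<close> and their symmetrizations\<close>

definition rho :: "nat \<Rightarrow> nat \<Rightarrow> nat \<Rightarrow> 'k::field tens" where
  "rho m i j = (\<Sum>r=i..m. \<Sum>s=1..j. tpure
     (Dplus m ([1..<i] @ [r]) * ((- 1) ^ (s + j) * Dminus m (filter (\<lambda>x. x \<noteq> m + s) [m + 1..<m + j + 1])))
     [yel m r (m + s)])"

definition rho_multi :: "nat \<Rightarrow> nat list \<Rightarrow> nat list \<Rightarrow> 'k::field tens" where
  "rho_multi m I J = prod_list (map2 (rho m) I J)"

definition vfrac :: "nat \<Rightarrow> nat \<Rightarrow> (nat \<Rightarrow> nat) \<Rightarrow> nat list \<Rightarrow> nat list \<Rightarrow> 'k::field salg" where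
  "vfrac m n lam I J = hwvec m n lam *
    rinv (prod_list (map (\<lambda>i. Dplus m [1..<i + 1]) I) * prod_list (map (\<lambda>j. Dminus m [m + 1..<m + j]) J))"

definition pi_vec :: "nat \<Rightarrow> nat \<Rightarrow> (nat \<Rightarrow> nat) \<Rightarrow> nat list \<Rightarrow> nat list \<Rightarrow> 'k::field tens" where
  "pi_vec m n lam I J = tcoeff (vfrac m n lam I J) * rho_multi m I J"

text \<open>Multiindices \<open>(I|J)\<close> are pairs of lists, whose positions are counted from \<open>0\<close>.\<close>

definition multiindex :: "nat \<Rightarrow> nat \<Rightarrow> nat list \<Rightarrow> nat list \<Rightarrow> bool" where
  "multiindex m n I J \<longleftrightarrow> length I = length J \<and> set I \<subseteq> {1..m} \<and> set J \<subseteq> {1..n}"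

definition cont :: "nat list \<Rightarrow> nat list \<Rightarrow> (nat \<Rightarrow> nat) \<times> (nat \<Rightarrow> nat)" where
  "cont I J = (count_list I, count_list J)"

definition mu :: "nat \<Rightarrow> (nat \<Rightarrow> nat) \<Rightarrow> nat list \<Rightarrow> nat \<Rightarrow> int" where
  "mu m lam I i = int (lamplus m lam i) - int (count_list I i)"

definition nu :: "nat \<Rightarrow> nat \<Rightarrow> (nat \<Rightarrow> nat) \<Rightarrow> nat list \<Rightarrow> nat \<Rightarrow> int" where
  "nu m n lam J j = int (lamminus m n lam j) + int (count_list J j)"

definition admissible :: "nat \<Rightarrow> nat \<Rightarrow> (nat \<Rightarrow> nat) \<Rightarrow> nat list \<Rightarrow> nat list \<Rightarrow> bool" where
  "admissible m n lam I J \<longleftrightarrow> multiindex m n I J \<and> sorted I \<and>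
    (\<forall>r. r + 1 < length I \<and> I ! r = I ! (r + 1) \<longrightarrow> J ! r < J ! (r + 1)) \<and>
    (\<forall>i. 1 \<le> i \<and> i < m \<longrightarrow> mu m lam I (i + 1) \<le> mu m lam I i) \<and>
    (\<forall>j. 1 \<le> j \<and> j < n \<longrightarrow> nu m n lam J (j + 1) \<le> nu m n lam J j)"

text \<open>Cells are pairs (row, column); when \<open>\<mu>\<close> is nonnegative all row numbers are at least \<open>1\<close>.\<close>

definition diagplus :: "nat \<Rightarrow> (nat \<Rightarrow> nat) \<Rightarrow> nat list \<Rightarrow> (nat \<times> nat) set" where
  "diagplus m lam I = {(s, i). i \<in> {1..m} \<and> mu m lam I i < int s \<and> s \<le> lamplus m lam i}"

definition diagminus :: "nat \<Rightarrow> nat \<Rightarrow> (nat \<Rightarrow> nat) \<Rightarrow> nat list \<Rightarrow> (nat \<times> nat) set" where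
  "diagminus m n lam J = {(j, l). j \<in> {1..n} \<and> lamminus m n lam j < l \<and> int l \<le> nu m n lam J j}"

definition positioning_plus :: "nat \<Rightarrow> (nat \<Rightarrow> nat) \<Rightarrow> nat list \<Rightarrow> (nat \<Rightarrow> nat \<times> nat) \<Rightarrow> bool" where
  "positioning_plus m lam I P \<longleftrightarrow> bij_betw P {..<length I} (diagplus m lam I) \<and>
    (\<forall>l<length I. snd (P l) = I ! l)"

definition positioning_minus :: "nat \<Rightarrow> nat \<Rightarrow> (nat \<Rightarrow> nat) \<Rightarrow> nat list \<Rightarrow> (nat \<Rightarrow> nat \<times> nat) \<Rightarrow> bool" where
  "positioning_minus m n lam J P \<longleftrightarrow> bij_betw P {..<length J} (diagminus m n lam J) \<and>
    (\<forall>l<length J. fst (P l) = J ! l)"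

definition Xplus :: "nat \<Rightarrow> (nat \<Rightarrow> nat) \<Rightarrow> nat list \<Rightarrow> (nat \<times> nat \<Rightarrow> nat \<times> nat) set" where
  "Xplus m lam I = {\<alpha>. \<alpha> permutes diagplus m lam I \<and> (\<forall>c\<in>diagplus m lam I. fst (\<alpha> c) = fst c)}"

definition Xminus :: "nat \<Rightarrow> nat \<Rightarrow> (nat \<Rightarrow> nat) \<Rightarrow> nat list \<Rightarrow> (nat \<times> nat \<Rightarrow> nat \<times> nat) set" where
  "Xminus m n lam J = {\<beta>. \<beta> permutes diagminus m n lam J \<and> (\<forall>c\<in>diagminus m n lam J. snd (\<beta> c) = snd c)}"

definition sigma_rho :: "nat \<Rightarrow> nat \<Rightarrow> (nat \<Rightarrow> nat) \<Rightarrow> (nat \<Rightarrow> nat \<times> nat) \<Rightarrow> (nat \<Rightarrow> nat \<times> nat) \<Rightarrow>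
    nat list \<Rightarrow> nat list \<Rightarrow> 'k::field tens" where
  "sigma_rho m n lam Pp Pm I J = (\<Sum>\<alpha>\<in>Xplus m lam I. \<Sum>\<beta>\<in>Xminus m n lam J.
     tscale (of_int (sign \<alpha> * sign \<beta>))
       (rho_multi m (map (\<lambda>l. snd (\<alpha> (Pp l))) [0..<length I]) (map (\<lambda>l. fst (\<beta> (Pm l))) [0..<length J])))"

end

theory Submission
  imports Defs "Jordan_Normal_Form.Determinant"
begin

text \<open>
  Two things have to be proved about \<open>w = v\<^bsub>I|J\<^esub> \<sigma>.\<rho>\<^bsub>I|J\<^esub>\<close>: that it is even-primitive, and that it lies in
  \<open>H\<^sup>0(\<lambda>) \<otimes> Y\<^bsup>\<otimes>k\<^esup>\<close> although \<open>v\<^bsub>I|J\<^esub>\<close> has denominators.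

  Primitivity holds factor by factor. The derivation \<open>\<^sub>i\<^sub>jD\<close> replaces column \<open>i\<close> of \<open>C\<close> by column \<open>j\<close>. For \<open>j < i\<close>
  this repeats a column in each leading minor, so the minors that make up \<open>v\<^bsub>I|J\<^esub>\<close> are annihilated. In \<open>\<rho>\<^bsub>i|j\<^esub>\<close>,
  the elements \<open>y\<^bsub>r,m+s\<^esub>\<close> and their coefficients transform dually to each other, so that their contraction
  is annihilated too (lemma \<open>tensor_eigen_rho\<close>). For \<open>i = j\<close> the same computation gives weights that depend only on
  the content of the multiindex. Hence every \<open>v\<^bsub>I|J\<^esub> \<rho>\<^bsub>K|L\<^esub>\<close> with \<open>cont(K|L) = cont(I|J)\<close> is primitive of the same
  weight, and \<open>w\<close> is an integral combination of such vectors.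

  Membership uses the alternating sums. The coefficient of a tensor of elements \<open>y\<^bsub>r,m+s\<^esub>\<close> in \<open>\<sigma>.\<rho>\<^bsub>I|J\<^esub>\<close> is an
  alternating sum over \<open>X\<^sup>+\<close> times one over \<open>X\<^sup>-\<close>. The first is a product over the rows of \<open>\<D>\<^sup>+\<close> of
  determinants with entries \<open>D\<^sup>+(1, \<dots>, i - 1, r)\<close>, where \<open>i\<close> runs through the interval \<open>q + 1, \<dots>, p\<close> occupied by the
  row. The matrix of these entries is the product of a lower triangular matrix of cofactors with \<open>C\<^sub>1\<^sub>1\<close>, so
  its minor is a product of leading minors times one determinant \<open>D\<^sup>+(1, \<dots>, q, r\<^bsub>q+1\<^esub>, \<dots>, r\<^sub>p)\<close> (lemma \<open>row_minor\<close>).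
  Multiplying by \<open>D\<^sup>+(1, \<dots>, p)\<close>, the factor of \<open>v\<close> that belongs to the row, and dividing by
  the row's share of the denominator replaces this factor by a determinant of the same size. The second
  sum is treated in the same way by columns of \<open>\<D>\<^sup>-\<close>; there the cofactors themselves are the entries, and the
  result is an integral combination of determinants \<open>D\<^sup>-\<close> of the right size (lemmas \<open>column_minor\<close> and
  \<open>ldet_unit_rows\<close>).

  The determinants live in the even part of an exterior algebra, which is a commutative ring, and
  their leading minors are units because their constant terms are generic determinants.
\<close>

section \<open>Determinants over commutative rings\<close>

text \<open>
  The diagrams of the theorem are sets of cells without a natural order, so determinants are also
  needed for square arrays indexed by an arbitrary set.
\<close>

definition det_on :: "'b set \<Rightarrow> ('b \<Rightarrow> 'b \<Rightarrow> 'a::comm_ring_1) \<Rightarrow> 'a" where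
  "det_on E G = (\<Sum>\<pi> | \<pi> permutes E. of_int (sign \<pi>) * (\<Prod>c\<in>E. G (\<pi> c) c))"

lemma det_on_cong:
  assumes "\<And>x y. x \<in> E \<Longrightarrow> y \<in> E \<Longrightarrow> G x y = H x y"
  shows "det_on E G = det_on E H"
  unfolding det_on_def using assms
  by (intro sum.cong refl arg_cong2[of _ _ _ _ "(*)"] prod.cong) (auto simp: permutes_in_image)

lemma det_on_reindex:
  assumes h: "bij_betw h A B" and fin: "finite A"
  shows "det_on B G = det_on A (\<lambda>x y. G (h x) (h y))"
proof -
  have inj: "inj_on h A" and B: "B = h ` A" using h by (auto simp: bij_betw_def)
  have h': "bij_betw (inv_into A h) B A" by (rule bij_betw_inv_into[OF h])
  show ?thesis
    unfolding det_on_def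
  proof (rule sum.reindex_bij_witness[of _ "map_permutation A h" "map_permutation B (inv_into A h)"])
    fix \<pi> assume "\<pi> \<in> {\<pi>. \<pi> permutes B}"
    then have p: "\<pi> permutes B" by simp
    show q: "map_permutation B (inv_into A h) \<pi> \<in> {\<pi>. \<pi> permutes A}"
      using map_permutation_permutes[OF h' p] by simp
    show eq: "map_permutation A h (map_permutation B (inv_into A h) \<pi>) = \<pi>"
      by (rule map_permutation_compose_inv[OF h' p]) (auto simp: B inj)
    define \<tau> where "\<tau> = map_permutation B (inv_into A h) \<pi>"
    have \<tau>: "\<tau> permutes A" "\<pi> = map_permutation A h \<tau>" using q eq by (auto simp: \<tau>_def)
    have "sign \<tau> = sign \<pi>" unfolding \<tau>(2) by (rule sign_map_permutation[symmetric, OF inj \<tau>(1) fin])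
    moreover have "(\<Prod>x\<in>A. G (h (\<tau> x)) (h x)) = (\<Prod>c\<in>B. G (\<pi> c) c)"
      unfolding B prod.reindex[OF inj] o_def \<tau>(2)
      by (intro prod.cong refl) (simp add: map_permutation_apply[OF inj])
    ultimately show "of_int (sign (map_permutation B (inv_into A h) \<pi>)) *
        (\<Prod>c\<in>A. G (h (map_permutation B (inv_into A h) \<pi> c)) (h c)) =
        of_int (sign \<pi>) * (\<Prod>c\<in>B. G (\<pi> c) c)"
      by (simp add: \<tau>_def)
  next
    fix \<pi> assume "\<pi> \<in> {\<pi>. \<pi> permutes A}"
    then have p: "\<pi> permutes A" by simp
    show "map_permutation B (inv_into A h) (map_permutation A h \<pi>) = \<pi>"
      by (rule map_permutation_compose_inv[OF h p]) (auto simp: B inj)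
    show "map_permutation A h \<pi> \<in> {\<pi>. \<pi> permutes B}"
      using map_permutation_permutes[OF h p] by simp
  qed
qed

lemma prod_list_upt: "prod_list (map f [a..<b]) = (\<Prod>i\<in>{a..<b}. f i :: 'a::comm_monoid_mult)"
  by (subst prod.distinct_set_conv_list[symmetric]) auto

lemma ldet_prod:
  "ldet s M = (\<Sum>p | p permutes {1..s}. of_int (sign p) * (\<Prod>a\<in>{1..s}. M a (p a) :: 'a::comm_ring_1))"
  unfolding ldet_def prod_list_upt atLeastLessThanSuc_atLeastAtMost ..

lemma ldet_det_on: "ldet s M = det_on {1..s} M"
proof -
  have "ldet s M = (\<Sum>p | p permutes {1..s}. of_int (sign (inv_into UNIV p)) * (\<Prod>a\<in>{1..s}. M a (inv_into UNIV p a)))"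
    unfolding ldet_prod by (rule sum_permutations_inverse)
  also have "\<dots> = det_on {1..s} M"
    unfolding det_on_def
  proof (intro sum.cong refl arg_cong2[of _ _ _ _ "(*)"])
    fix p assume "p \<in> {p. p permutes {1..s}}"
    then have p: "p permutes {1..s}" by simp
    show "of_int (sign (inv_into UNIV p)) = (of_int (sign p) :: 'a)"
      by (simp add: sign_inverse permutes_imp_permutation[OF finite_atLeastAtMost p])
    show "(\<Prod>a\<in>{1..s}. M a (inv_into UNIV p a)) = (\<Prod>c\<in>{1..s}. M (p c) c)"
      unfolding prod.permute[OF p, of "\<lambda>a. M a (inv_into UNIV p a)"] o_def
      using permutes_inverses[OF p] by simp
  qed
  finally show ?thesis .
qed

lemma ldet_cong:
  fixes M N :: "nat \<Rightarrow> nat \<Rightarrow> 'a::ring_1"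
  assumes "\<And>a b. a \<in> {1..s} \<Longrightarrow> b \<in> {1..s} \<Longrightarrow> M a b = N a b"
  shows "ldet s M = ldet s N"
  unfolding ldet_def
proof (intro sum.cong refl arg_cong2[of _ _ _ _ "(*)"] arg_cong[of _ _ prod_list] map_cong)
  fix p x assume "p \<in> {p. p permutes {1..s}}" "x \<in> set [1..<Suc s]"
  then have p: "p permutes {1..s}" and x: "x \<in> {1..s}" by auto
  then show "M x (p x) = N x (p x)" by (intro assms x) (simp_all only: permutes_in_image[OF p])
qed

lemma ldet_transpose: "ldet s (\<lambda>a b. M b a) = (ldet s M :: 'a::comm_ring_1)"
  unfolding ldet_prod[of s "\<lambda>a b. M b a"] ldet_det_on[of s M] det_on_def ..

lemma ldet_0 [simp]: "ldet 0 M = (1 :: 'a::comm_ring_1)"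
  unfolding ldet_prod by simp

text \<open>
  The bridge to the theory of matrices over commutative rings, from which multiplicativity, Laplace
  expansion and adjugates are taken.
\<close>

lemma ldet_eq_det: "ldet s M = det (mat s s (\<lambda>(i, j). M (Suc i) (Suc j) :: 'a::comm_ring_1))"
proof -
  have "ldet s M = det_on {0..<s} (\<lambda>i j. M (Suc i) (Suc j))"
    unfolding ldet_det_on by (intro det_on_reindex bij_betwI[of _ _ _ "\<lambda>x. x - 1"]) auto
  also have "\<dots> = det (mat s s (\<lambda>(i, j). M (Suc i) (Suc j)))"
    unfolding det_on_def by (subst det_col[of _ s])
      (auto intro!: sum.cong arg_cong2[of _ _ _ _ "(*)"] prod.cong dest: permutes_in_image simp: lessThan_atLeast0)
  finally show ?thesis .
qed

lemma ldet_mult: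
  "ldet s (\<lambda>a b. \<Sum>r = 1..s. A a r * B r b) = ldet s A * (ldet s B :: 'a::comm_ring_1)"
proof -
  have "mat s s (\<lambda>(i, j). \<Sum>r = 1..s. A (Suc i) r * B r (Suc j)) =
      mat s s (\<lambda>(i, j). A (Suc i) (Suc j)) * mat s s (\<lambda>(i, j). B (Suc i) (Suc j))"
    by (rule eq_matI) (simp_all add: scalar_prod_def sum.atLeast1_atMost_eq lessThan_atLeast0)
  then show ?thesis
    unfolding ldet_eq_det by (simp add: det_mult[of _ s])
qed

lemma ldet_lower_triangular:
  assumes "\<And>a b. 1 \<le> a \<Longrightarrow> a < b \<Longrightarrow> b \<le> s \<Longrightarrow> A a b = 0"
  shows "ldet s A = (\<Prod>a = 1..s. A a a :: 'a::comm_ring_1)"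
  unfolding ldet_eq_det
  by (subst det_lower_triangular[of s])
    (use assms in \<open>auto simp: prod_list_diag_prod prod.atLeast1_atMost_eq lessThan_atLeast0\<close>)

lemma ldet_equal_columns:
  assumes "b \<in> {1..s}" "c \<in> {1..s}" "b \<noteq> c" "\<And>a. a \<in> {1..s} \<Longrightarrow> A a b = A a c"
  shows "ldet s A = (0 :: 'a::comm_ring_1)"
  unfolding ldet_eq_det
  by (rule det_identical_columns[of _ s "b - 1" "c - 1"])
    (use assms in \<open>auto intro!: eq_vecI\<close>)

lemma ldet_equal_rows:
  assumes "b \<in> {1..s}" "c \<in> {1..s}" "b \<noteq> c" "\<And>a. a \<in> {1..s} \<Longrightarrow> A b a = A c a"
  shows "ldet s A = (0 :: 'a::comm_ring_1)"
  by (subst ldet_transpose[symmetric], rule ldet_equal_columns[OF assms(1,2,3)]) (rule assms)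

lemma ldet_laplace_last_row:
  "ldet (Suc s) A = (\<Sum>c = 1..Suc s. A (Suc s) c *
     ((- 1) ^ (Suc s + c) * ldet s (\<lambda>a b. A a (if b < c then b else Suc b))) :: 'a::comm_ring_1)"
proof -
  let ?A = "mat (Suc s) (Suc s) (\<lambda>(i, j). A (Suc i) (Suc j))"
  have "mat_delete ?A s j = mat s s (\<lambda>(i, j'). A (Suc i) (if Suc j' < Suc j then Suc j' else Suc (Suc j')))"
    for j
    by (rule eq_matI) (auto simp: mat_delete_def)
  then have "cofactor ?A s j = (- 1) ^ (s + j) * ldet s (\<lambda>a b. A a (if b < Suc j then b else Suc b))" for j
    by (simp add: cofactor_def ldet_eq_det)
  then have "ldet (Suc s) A = (\<Sum>j<Suc s. A (Suc s) (Suc j) *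
      ((- 1) ^ (s + j) * ldet s (\<lambda>a b. A a (if b < Suc j then b else Suc b))))"
    unfolding ldet_eq_det[of "Suc s"]
    by (subst laplace_expansion_row[of _ "Suc s" s]) (auto intro!: sum.cong)
  also have "\<dots> = (\<Sum>c = 1..Suc s. A (Suc s) c *
     ((- 1) ^ (Suc s + c) * ldet s (\<lambda>a b. A a (if b < c then b else Suc b))))"
    unfolding One_nat_def sum.atLeast1_atMost_eq by simp
  finally show ?thesis .
qed

lemma ldet_first_column:
  assumes "\<And>a. 1 < a \<Longrightarrow> a \<le> Suc s \<Longrightarrow> A a 1 = 0"
  shows "ldet (Suc s) A = A 1 1 * (ldet s (\<lambda>a b. A (Suc a) (Suc b)) :: 'a::comm_ring_1)"
proof -
  let ?A = "mat (Suc s) (Suc s) (\<lambda>(i, j). A (Suc i) (Suc j))"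
  have "mat_delete ?A 0 0 = mat s s (\<lambda>(i, j). A (Suc (Suc i)) (Suc (Suc j)))"
    by (rule eq_matI) (auto simp: mat_delete_def)
  then have c: "cofactor ?A 0 0 = ldet s (\<lambda>a b. A (Suc a) (Suc b))"
    by (simp add: cofactor_def ldet_eq_det)
  have "ldet (Suc s) A = (\<Sum>i<Suc s. ?A $$ (i, 0) * cofactor ?A i 0)"
    unfolding ldet_eq_det by (rule laplace_expansion_column) auto
  also have "\<dots> = ?A $$ (0, 0) * cofactor ?A 0 0 + (\<Sum>i<s. ?A $$ (Suc i, 0) * cofactor ?A (Suc i) 0)"
    by (rule sum.lessThan_Suc_shift)
  also have "(\<Sum>i<s. ?A $$ (Suc i, 0) * cofactor ?A (Suc i) 0) = 0"
    by (rule sum.neutral) (use assms in auto)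
  finally show ?thesis by (simp add: c)
qed

lemma ldet_block_triangular:
  assumes "q \<le> s" "\<And>a c. c \<in> {1..q} \<Longrightarrow> c < a \<Longrightarrow> a \<le> s \<Longrightarrow> A a c = 0"
  shows "ldet s A = (\<Prod>c = 1..q. A c c) * (ldet (s - q) (\<lambda>a b. A (a + q) (b + q)) :: 'a::comm_ring_1)"
  using assms
proof (induction q arbitrary: s A)
  case 0
  then show ?case by simp
next
  case (Suc q)
  obtain s' where s: "s = Suc s'" using Suc.prems(1) by (cases s) auto
  have "ldet s A = A 1 1 * ldet s' (\<lambda>a b. A (Suc a) (Suc b))"
    unfolding s by (rule ldet_first_column) (use Suc.prems(2) s in auto)
  also have "ldet s' (\<lambda>a b. A (Suc a) (Suc b)) =
      (\<Prod>c = 1..q. A (Suc c) (Suc c)) * ldet (s' - q) (\<lambda>a b. A (Suc (a + q)) (Suc (b + q)))"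
    by (rule Suc.IH) (use Suc.prems s in auto)
  also have "A 1 1 * ((\<Prod>c = 1..q. A (Suc c) (Suc c)) * ldet (s' - q) (\<lambda>a b. A (Suc (a + q)) (Suc (b + q)))) =
      (\<Prod>c = 1..Suc q. A c c) * ldet (s - Suc q) (\<lambda>a b. A (a + Suc q) (b + Suc q))"
    unfolding s by (simp add: prod.atLeast1_atMost_eq prod.lessThan_Suc_shift mult.assoc del: prod.lessThan_Suc prod.cl_ivl_Suc)
  finally show ?case .
qed

section \<open>Two identities for minors\<close>

text \<open>
  The identity behind both cancellations of denominators. Let \<open>Z = T X\<close>, where \<open>T\<close> is lower triangular
  with diagonal \<open>d\<^sub>0, \<dots>, d\<^bsub>s-1\<^esub>\<close> and the first \<open>q\<close> columns of \<open>Z\<close> are upper triangular with diagonal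
  \<open>d\<^sub>1, \<dots>, d\<^sub>q\<close>. Computing \<open>det Z\<close> as \<open>det T \<cdot> det X\<close> and by blocks shows that the lower right block of \<open>Z\<close> has
  determinant \<open>d\<^bsub>q+1\<^esub> \<cdots> d\<^bsub>s-1\<^esub> \<cdot> det X\<close> when \<open>q < s\<close>, and \<open>1\<close> when \<open>q = s\<close>. The extra factor \<open>d\<^sub>s\<close> or \<open>d\<^sub>q\<close> on
  the left makes one formula cover both cases: an empty row or column of a diagram needs no separate
  treatment. The first form serves \<open>D\<^sup>+\<close>, the second \<open>D\<^sup>-\<close>.
\<close>

lemma triangular_minor:
  fixes T X :: "nat \<Rightarrow> nat \<Rightarrow> 'a::comm_ring_1" and d :: "nat \<Rightarrow> 'a"
  assumes qs: "q \<le> s"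
    and T0: "\<And>a b. 1 \<le> a \<Longrightarrow> a < b \<Longrightarrow> b \<le> s \<Longrightarrow> T a b = 0"
    and Td: "\<And>a. a \<in> {1..s} \<Longrightarrow> T a a = d (a - 1)"
    and Z: "\<And>a c. a \<in> {1..s} \<Longrightarrow> c \<in> {1..s} \<Longrightarrow> (\<Sum>t = 1..s. T a t * X t c) = Z a c"
    and Z0: "\<And>a c. c \<in> {1..q} \<Longrightarrow> c < a \<Longrightarrow> a \<le> s \<Longrightarrow> Z a c = 0"
    and Zd: "\<And>c. c \<in> {1..q} \<Longrightarrow> Z c c = d c"
    and d0: "d 0 = 1"
    and units: "\<And>i. i \<in> {1..q} \<Longrightarrow> \<exists>e. d i * e = 1"
  shows "ldet (s - q) (\<lambda>a b. Z (a + q) (b + q)) * d s = (\<Prod>i = q + 1..s. d i) * ldet s X" (is ?A)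
    and "ldet (s - q) (\<lambda>a b. Z (a + q) (b + q)) * d q = (\<Prod>i = q + 1..s. d (i - 1)) * ldet s X" (is ?B)
proof -
  let ?L = "ldet (s - q) (\<lambda>a b. Z (a + q) (b + q))"
  let ?P = "\<Prod>i = 1..q. d i"
  have "ldet s Z = ldet s (\<lambda>a c. \<Sum>t = 1..s. T a t * X t c)"
    by (rule ldet_cong) (simp add: Z[symmetric])
  also have "\<dots> = ldet s T * ldet s X" by (rule ldet_mult)
  also have "ldet s T = (\<Prod>a = 1..s. T a a)" by (rule ldet_lower_triangular) (rule T0)
  also have "\<dots> = (\<Prod>i<s. d i)" using Td by (simp add: prod.atLeast1_atMost_eq)
  finally have "ldet s Z = (\<Prod>i<s. d i) * ldet s X" .
  moreover have "ldet s Z = (\<Prod>c = 1..q. Z c c) * ?L"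
    by (rule ldet_block_triangular) (use qs Z0 in auto)
  moreover have "(\<Prod>c = 1..q. Z c c) = ?P" by (rule prod.cong) (simp_all add: Zd)
  ultimately have main: "?P * ?L = (\<Prod>i<s. d i) * ldet s X" by simp
  obtain e where e: "\<And>i. i \<in> {1..q} \<Longrightarrow> d i * e i = 1" using units by metis
  have inv_P: "?P * (\<Prod>i = 1..q. e i) = 1"
    unfolding prod.distrib[symmetric] by (rule prod.neutral) (use e in auto)
  \<comment> \<open>Only \<open>d\<^sub>1, \<dots>, d\<^sub>q\<close> have to be cancelled, so it does not matter that the ring has zero divisors.\<close>
  have cancel: "x = y" if "?P * x = ?P * y" for x y
    proof -
    have "x = ?P * (\<Prod>i = 1..q. e i) * x" by (simp only: inv_P mult_1_left)
    also have "\<dots> = (\<Prod>i = 1..q. e i) * (?P * x)" by (simp only: ac_simps)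
    also have "\<dots> = ?P * (\<Prod>i = 1..q. e i) * y" unfolding that by (simp only: ac_simps)
    finally show "x = y" by (simp only: inv_P mult_1_left)
  qed
  have split: "(\<Prod>i<k. d i) * d k = (\<Prod>i = 1..k. d i)" for k
    by (induction k) (simp_all add: d0 mult.assoc)
  have upper: "(\<Prod>i = 1..s. d i) = ?P * (\<Prod>i = q + 1..s. d i)"
    using qs prod.ub_add_nat[of 1 q d "s - q"] by simp
  have "?P * (?L * d s) = (?P * ?L) * d s" by (simp only: mult.assoc)
  also have "\<dots> = ((\<Prod>i<s. d i) * d s) * ldet s X" unfolding main by (simp only: ac_simps)
  also have "\<dots> = ?P * ((\<Prod>i = q + 1..s. d i) * ldet s X)" unfolding split upper by (simp only: ac_simps)
  finally show ?A by (rule cancel)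
  have lower: "(\<Prod>i<s. d i) = (\<Prod>i<q. d i) * (\<Prod>i = q..<s. d i)"
    using qs by (simp add: lessThan_atLeast0 prod.atLeastLessThan_concat)
  have shift: "(\<Prod>i = q..<s. d i) = (\<Prod>i = q + 1..s. d (i - 1))"
    by (rule prod.reindex_bij_witness[of _ "\<lambda>i. i - 1" Suc]) auto
  have "?P * (?L * d q) = (?P * ?L) * d q" by (simp only: mult.assoc)
  also have "\<dots> = ((\<Prod>i<q. d i) * d q) * ((\<Prod>i = q..<s. d i) * ldet s X)"
    unfolding main lower by (simp only: ac_simps)
  also have "\<dots> = ?P * ((\<Prod>i = q + 1..s. d (i - 1)) * ldet s X)" unfolding split shift ..
  finally show ?B by (rule cancel)
qed

text \<open>
  This is \<open>D\<^sup>+\<close> for the matrix \<open>C\<^sub>1\<^sub>1\<close>, and \<open>D\<^sup>-\<close> for \<open>\<phi>(C\<^sub>2\<^sub>2)\<close> with its columns numbered from \<open>1\<close>.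
\<close>

definition top_minor :: "(nat \<Rightarrow> nat \<Rightarrow> 'a::ring_1) \<Rightarrow> nat list \<Rightarrow> 'a" where
  "top_minor F is = ldet (length is) (\<lambda>a b. F a (is ! (b - 1)))"

lemma top_minor_Nil [simp]: "top_minor F [] = (1 :: 'a::comm_ring_1)"
  by (simp add: top_minor_def)

lemma top_minor_upt: "top_minor F [1..<s + 1] = ldet s F"
  unfolding top_minor_def by (simp del: upt_Suc) (rule ldet_cong, auto simp del: upt_Suc)

lemma top_minor_not_distinct:
  assumes "\<not> distinct is"
  shows "top_minor F is = (0 :: 'a::comm_ring_1)"
proof -
  obtain b c where "b < length is" "c < length is" "b \<noteq> c" "is ! b = is ! c"
    using assms by (auto simp: distinct_conv_nth)
  then show ?thesis
    unfolding top_minor_def by (intro ldet_equal_columns[of "Suc b" _ "Suc c"]) auto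
qed

text \<open>
  The signed minor of the first \<open>j - 1\<close> rows and the columns \<open>1, \<dots>, c - 1, c + 1, \<dots>, j\<close>: the cofactor of
  the entry \<open>(j, c)\<close> of the leading \<open>j \<times> j\<close> block, independent of row \<open>j\<close>. With the value \<open>0\<close> for \<open>c > j\<close> these
  cofactors form a lower triangular matrix. For \<open>\<phi>(C\<^sub>2\<^sub>2)\<close> the coefficient of \<open>y\<^bsub>r,m+c\<^esub>\<close> in \<open>\<rho>\<^bsub>i|j\<^esub>\<close> is such a
  cofactor times \<open>D\<^sup>+(1, \<dots>, i - 1, r)\<close>.
\<close>

definition row_cofactor :: "(nat \<Rightarrow> nat \<Rightarrow> 'a::ring_1) \<Rightarrow> nat \<Rightarrow> nat \<Rightarrow> 'a" where
  "row_cofactor F j c = (if c \<le> j then (- 1) ^ (j + c) * ldet (j - 1) (\<lambda>a b. F a (if b < c then b else Suc b)) else 0)"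

lemma row_cofactor_expansion:
  assumes "1 \<le> j" "j \<le> s"
  shows "(\<Sum>c = 1..s. row_cofactor F j c * z c) = (ldet j (\<lambda>a b. if a < j then F a b else z b) :: 'a::comm_ring_1)"
proof -
  obtain j' where j: "j = Suc j'" using assms(1) by (cases j) auto
  have "(\<Sum>c = 1..s. row_cofactor F j c * z c) = (\<Sum>c = 1..j. row_cofactor F j c * z c)"
    using assms by (intro sum.mono_neutral_right) (auto simp: row_cofactor_def)
  also have "\<dots> = ldet j (\<lambda>a b. if a < j then F a b else z b)"
    unfolding j ldet_laplace_last_row
  proof (intro sum.cong refl)
    fix c assume "c \<in> {1..Suc j'}"
    moreover have "ldet j' (\<lambda>a b. if a < Suc j' then F a (if b < c then b else Suc b)
        else z (if b < c then b else Suc b)) = ldet j' (\<lambda>a b. F a (if b < c then b else Suc b))"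
      by (rule ldet_cong) auto
    ultimately show "row_cofactor F (Suc j') c * z c = (if Suc j' < Suc j' then F (Suc j') c else z c) *
        ((- 1) ^ (Suc j' + c) * ldet j' (\<lambda>a b. if a < Suc j' then F a (if b < c then b else Suc b)
          else z (if b < c then b else Suc b)))"
      by (simp add: row_cofactor_def algebra_simps)
  qed
  finally show ?thesis .
qed

lemma row_cofactor_diag: "1 \<le> j \<Longrightarrow> row_cofactor F j j = (ldet (j - 1) F :: 'a::comm_ring_1)"
  unfolding row_cofactor_def by (simp add: mult_2[symmetric] del: mult_2) (rule ldet_cong, auto)

lemma filter_neq_upt:
  assumes "1 \<le> c" "c \<le> j"
  shows "filter (\<lambda>x. x \<noteq> c) [1..<j + 1] = [1..<c] @ [Suc c..<j + 1]"
proof -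
  have "[1..<j + 1] = [1..<c] @ c # [Suc c..<j + 1]"
    using assms upt_add_eq_append[of 1 c "j + 1 - c"] by (simp add: upt_conv_Cons del: upt_Suc)
  then show ?thesis by (simp del: upt_Suc)
qed

lemma row_cofactor_top_minor:
  assumes "1 \<le> c" "c \<le> j"
  shows "row_cofactor F j c = (- 1) ^ (c + j) * (top_minor F (filter (\<lambda>x. x \<noteq> c) [1..<j + 1]) :: 'a::ring_1)"
proof -
  have "ldet (j - 1) (\<lambda>a b. F a (if b < c then b else Suc b)) =
      ldet (j - 1) (\<lambda>a b. F a (([1..<c] @ [Suc c..<j + 1]) ! (b - 1)))"
    by (rule ldet_cong) (use assms in \<open>auto simp: nth_append simp del: upt_Suc\<close>)
  moreover have "length ([1..<c] @ [Suc c..<j + 1]) = j - 1" using assms by (simp del: upt_Suc)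
  ultimately show ?thesis
    unfolding row_cofactor_def top_minor_def filter_neq_upt[OF assms] using assms(2)
    by (simp only: add.commute if_True)
qed

text \<open>
  For \<open>C\<^sub>1\<^sub>1\<close> these are the coefficients \<open>D\<^sup>+(1, \<dots>, i - 1, r)\<close> of \<open>\<rho>\<^bsub>i|j\<^esub>\<close>.
\<close>

definition next_minor :: "(nat \<Rightarrow> nat \<Rightarrow> 'a::ring_1) \<Rightarrow> nat \<Rightarrow> nat \<Rightarrow> 'a" where
  "next_minor F i r = top_minor F ([1..<i] @ [r])"

text \<open>
  Expansion along the last column writes the matrix of these minors as (lower triangular cofactor
  matrix) times \<open>F\<close>. The cofactors are those of the transpose, which avoids a second version of
  Laplace expansion.
\<close>

lemma next_minor_expansion:
  assumes "1 \<le> i" "i \<le> s"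
  shows "(\<Sum>t = 1..s. row_cofactor (\<lambda>a b. F b a) i t * F t r) = (next_minor F i r :: 'a::comm_ring_1)"
proof -
  have "(\<Sum>t = 1..s. row_cofactor (\<lambda>a b. F b a) i t * F t r) =
      ldet i (\<lambda>a b. if a < i then F b a else F b r)"
    by (rule row_cofactor_expansion[OF assms])
  also have "\<dots> = ldet i (\<lambda>a b. if b < i then F a b else F a r)"
    by (subst ldet_transpose[symmetric]) (rule ldet_cong, auto)
  also have "\<dots> = next_minor F i r"
    unfolding next_minor_def top_minor_def using assms(1)
    by (simp del: upt_Suc) (rule ldet_cong, auto simp: nth_append simp del: upt_Suc)
  finally show ?thesis .
qed

lemma next_minor_diag: "1 \<le> i \<Longrightarrow> next_minor F i i = (ldet i F :: 'a::comm_ring_1)"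
  unfolding next_minor_def top_minor_upt[symmetric] by simp

lemma next_minor_less: "1 \<le> r \<Longrightarrow> r < i \<Longrightarrow> next_minor F i r = (0 :: 'a::comm_ring_1)"
  unfolding next_minor_def by (rule top_minor_not_distinct) auto

text \<open>
  One row of the diagram \<open>\<D>\<^sup>+\<close>, occupying the columns \<open>q + 1, \<dots>, p\<close>. Take for \<open>X\<close> the columns
  \<open>1, \<dots>, q\<close> and \<open>r\<^bsub>q+1\<^esub>, \<dots>, r\<^sub>p\<close> of \<open>F\<close>. The product on the right is what this row contributes to the
  denominator of \<open>v\<^bsub>I|J\<^esub>\<close>, and \<open>ldet p F\<close> is a factor of \<open>v\<close>, which is thus replaced by a determinant of the
  same size.
\<close>

lemma row_minor:
  fixes F :: "nat \<Rightarrow> nat \<Rightarrow> 'a::comm_ring_1"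
  assumes qp: "q \<le> p" and units: "\<And>i. i \<in> {1..q} \<Longrightarrow> \<exists>e. ldet i F * e = 1"
  shows "det_on {q + 1..p} (\<lambda>i c. next_minor F i (r c)) * ldet p F =
    (\<Prod>i = q + 1..p. ldet i F) * top_minor F ([1..<q + 1] @ map r [q + 1..<p + 1])"
proof -
  let ?cols = "[1..<q + 1] @ map r [q + 1..<p + 1]"
  let ?col = "\<lambda>c. if c \<le> q then c else r c"
  have "ldet (p - q) (\<lambda>a b. next_minor F (a + q) (?col (b + q))) * ldet p F =
      (\<Prod>i = q + 1..p. ldet i F) * ldet p (\<lambda>a c. F a (?col c))"
  proof (rule triangular_minor(1)[where T = "row_cofactor (\<lambda>a b. F b a)" and Z = "\<lambda>a c. next_minor F a (?col c)"
        and X = "\<lambda>a c. F a (?col c)" and d = "\<lambda>i. ldet i F" and q = q and s = p])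
    show "row_cofactor (\<lambda>a b. F b a) a a = ldet (a - 1) F" if "a \<in> {1..p}" for a
      using that ldet_transpose[of "a - 1" F] by (simp add: row_cofactor_diag)
    show "(\<Sum>t = 1..p. row_cofactor (\<lambda>a b. F b a) a t * F t (?col c)) = next_minor F a (?col c)"
      if "a \<in> {1..p}" "c \<in> {1..p}" for a c
      using that by (intro next_minor_expansion) auto
  qed (use qp units in \<open>auto simp: row_cofactor_def next_minor_less next_minor_diag\<close>)
  also have "ldet p (\<lambda>a c. F a (?col c)) = top_minor F ?cols"
    unfolding top_minor_def using qp
    by (simp del: upt_Suc) (rule ldet_cong, auto simp: nth_append simp del: upt_Suc)
  also have "ldet (p - q) (\<lambda>a b. next_minor F (a + q) (?col (b + q))) =
      det_on {q + 1..p} (\<lambda>i c. next_minor F i (r c))"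
  proof -
    have "bij_betw (\<lambda>x. x + q) {1..p - q} {q + 1..p}"
      by (rule bij_betwI[of _ _ _ "\<lambda>x. x - q"]) auto
    then show ?thesis
      unfolding ldet_det_on by (subst det_on_reindex[of "\<lambda>x. x + q" "{1..p - q}"]) (auto intro: det_on_cong)
  qed
  finally show ?thesis .
qed

text \<open>
  One column of the diagram \<open>\<D>\<^sup>-\<close>, occupying the rows \<open>p + 1, \<dots>, q\<close>; a form of Jacobi's identity on
  complementary minors. Here \<open>X\<close> consists of the first \<open>p\<close> rows of \<open>F\<close>, written as columns, and of unit
  vectors, which pick out the chosen columns of the cofactor matrix. Expanding with row \<open>c < j\<close> of \<open>F\<close> in
  place of row \<open>j\<close> gives a determinant with two equal rows, whence the triangular shape.
\<close>

lemma column_minor: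
  fixes F :: "nat \<Rightarrow> nat \<Rightarrow> 'a::comm_ring_1"
  assumes pq: "p \<le> q" and units: "\<And>i. i \<in> {1..p} \<Longrightarrow> \<exists>e. ldet i F * e = 1"
    and s: "\<And>c. c \<in> {p + 1..q} \<Longrightarrow> 1 \<le> s c"
  shows "det_on {p + 1..q} (\<lambda>j c. row_cofactor F j (s c)) * ldet p F =
    (\<Prod>j = p + 1..q. ldet (j - 1) F) * ldet q (\<lambda>a b. if a \<le> p then F a b else if b = s a then 1 else 0)"
proof -
  let ?X = "\<lambda>t c. if c \<le> p then F c t else if t = s c then 1 else 0"
  let ?Z = "\<lambda>j c. if c \<le> p then ldet j (\<lambda>a b. if a < j then F a b else F c b) else row_cofactor F j (s c)"
  have "ldet (q - p) (\<lambda>a b. ?Z (a + p) (b + p)) * ldet p F =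
      (\<Prod>j = p + 1..q. ldet (j - 1) F) * ldet q ?X"
  proof (rule triangular_minor(2)[where T = "row_cofactor F" and Z = ?Z and X = ?X and d = "\<lambda>i. ldet i F" and q = p and s = q])
    show "(\<Sum>t = 1..q. row_cofactor F j t * ?X t c) = ?Z j c" if "j \<in> {1..q}" "c \<in> {1..q}" for j c
    proof (cases "c \<le> p")
      case True
      then show ?thesis using that row_cofactor_expansion[of j q F "\<lambda>t. F c t"] by simp
    next
      case False
      have "(\<Sum>t = 1..q. row_cofactor F j t * ?X t c) = (\<Sum>t = 1..q. if t = s c then row_cofactor F j t else 0)"
        using False by (intro sum.cong) auto
      also have "\<dots> = row_cofactor F j (s c)"
        using s[of c] that False by (auto simp: row_cofactor_def)
      finally show ?thesis using False by simp
    qed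
    show "?Z a c = 0" if "c \<in> {1..p}" "c < a" "a \<le> q" for a c
    proof -
      have "ldet a (\<lambda>a' b. if a' < a then F a' b else F c b) = 0"
        by (rule ldet_equal_rows[of c _ a]) (use that in auto)
      then show ?thesis using that by simp
    qed
    show "?Z c c = ldet c F" if "c \<in> {1..p}" for c
    proof -
      have "ldet c (\<lambda>a b. if a < c then F a b else F c b) = ldet c F"
        by (rule ldet_cong) (auto simp: not_less)
      then show ?thesis using that by simp
    qed
  qed (use pq units in \<open>auto simp: row_cofactor_diag, auto simp: row_cofactor_def\<close>)
  also have "ldet q ?X = ldet q (\<lambda>a b. if a \<le> p then F a b else if b = s a then 1 else 0)"
    by (rule ldet_transpose[symmetric])
  also have "ldet (q - p) (\<lambda>a b. ?Z (a + p) (b + p)) = det_on {p + 1..q} (\<lambda>j c. row_cofactor F j (s c))"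
  proof -
    have "bij_betw (\<lambda>x. x + p) {1..q - p} {p + 1..q}"
      by (rule bij_betwI[of _ _ _ "\<lambda>x. x - p"]) auto
    then show ?thesis
      unfolding ldet_det_on by (subst det_on_reindex[of "\<lambda>x. x + p" "{1..q - p}"]) (auto intro: det_on_cong)
  qed
  finally show ?thesis .
qed

inductive_set additive_hull :: "'a::ab_group_add set \<Rightarrow> 'a set" for S where
  zero: "0 \<in> additive_hull S"
| base: "x \<in> S \<Longrightarrow> x \<in> additive_hull S"
| add: "x \<in> additive_hull S \<Longrightarrow> y \<in> additive_hull S \<Longrightarrow> x + y \<in> additive_hull S"
| uminus: "x \<in> additive_hull S \<Longrightarrow> - x \<in> additive_hull S"

text \<open>
  Expanding along the unit rows, starting with the last, leaves signed minors of the first \<open>p\<close> rows.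
\<close>

lemma ldet_unit_rows:
  fixes F :: "nat \<Rightarrow> nat \<Rightarrow> 'a::comm_ring_1"
  assumes "length js = p + k" "set js \<subseteq> S" "\<And>a b. z a b \<in> {0, 1}"
  shows "ldet (p + k) (\<lambda>a b. if a \<le> p then F a (js ! (b - 1)) else z a b)
    \<in> additive_hull (top_minor F ` {js. length js = p \<and> set js \<subseteq> S})" (is "_ \<in> ?A")
  using assms
proof (induction k arbitrary: js z)
  case 0
  have "ldet p (\<lambda>a b. if a \<le> p then F a (js ! (b - 1)) else z a b) = top_minor F js"
    unfolding top_minor_def using 0 by (simp, intro ldet_cong) auto
  moreover have "top_minor F js \<in> ?A" by (intro additive_hull.base imageI) (use 0 in simp)
  ultimately show ?case by simp
next
  case (Suc k)
  have sum: "(\<Sum>c\<in>C. f c) \<in> ?A" if "\<And>c. c \<in> C \<Longrightarrow> f c \<in> ?A" for f and C :: "nat set"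
    using that by (induction C rule: infinite_finite_induct) (auto intro: additive_hull.intros)
  have "ldet (Suc (p + k)) (\<lambda>a b. if a \<le> p then F a (js ! (b - 1)) else z a b) \<in> ?A"
    unfolding ldet_laplace_last_row
  proof (rule sum)
    fix c assume c: "c \<in> {1..Suc (p + k)}"
    define js' where "js' = take (c - 1) js @ drop c js"
    let ?sk = "\<lambda>b. if b < c then b else Suc b"
    let ?M = "ldet (p + k) (\<lambda>a b. if a \<le> p then F a (js ! (?sk b - 1)) else z a (?sk b))"
    have len: "length js' = p + k" using Suc.prems(1) c by (auto simp: js'_def)
    have sub: "set js' \<subseteq> S"
      using Suc.prems(2) by (auto simp: js'_def dest: in_set_takeD in_set_dropD)
    have nth: "js ! (?sk b - 1) = js' ! (b - 1)" if "b \<in> {1..p + k}" for b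
      using that c Suc.prems(1) by (auto simp: js'_def nth_append)
    have "?M = ldet (p + k) (\<lambda>a b. if a \<le> p then F a (js' ! (b - 1)) else z a (?sk b))"
      by (rule ldet_cong) (simp add: nth del: One_nat_def)
    also have "\<dots> \<in> ?A"
      by (rule Suc.IH[OF len sub]) (use Suc.prems(3) in auto)
    finally have "?M \<in> ?A" .
    then have *: "(- 1) ^ e * ?M \<in> ?A" for e :: nat
      by (cases "even e") (auto intro: additive_hull.uminus)
    have "z (Suc (p + k)) c \<in> {0, 1}" by (rule Suc.prems(3))
    then show "(if Suc (p + k) \<le> p then F (Suc (p + k)) (js ! (c - 1)) else z (Suc (p + k)) c) *
       ((- 1) ^ (Suc (p + k) + c) * ?M) \<in> ?A"
      using additive_hull.zero *[of "Suc (p + k) + c"] by auto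
  qed
  then show ?case by simp
qed

text \<open>
  Once column \<open>a\<close> is replaced by column \<open>b\<close>, a determinant whose last row has equal entries in these two
  places vanishes; its expansion relates the new cofactors to the old ones. This yields the action of
  \<open>GL(n)\<close> on the coefficients of \<open>\<rho>\<^bsub>i|j\<^esub>\<close>.
\<close>

lemma row_cofactor_replace_column:
  fixes F :: "nat \<Rightarrow> nat \<Rightarrow> 'a::comm_ring_1"
  assumes "1 \<le> b" "b < a" "a \<le> j" "s \<in> {1..j}" "s \<noteq> a"
  shows "row_cofactor (\<lambda>x c. F x (if c = a then b else c)) j s = (if s = b then - row_cofactor F j a else 0)"
proof -
  let ?F = "\<lambda>x c. F x (if c = a then b else c)"
  \<comment> \<open>A last row with equal entries in the equal columns \<open>a\<close> and \<open>b\<close>, whose expansion contains the wanted cofactor.\<close>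
  let ?z = "\<lambda>c. if c = s then 1 else if c = a \<and> s = b then 1 else 0"
  have "ldet (j - 1) (\<lambda>x c. F x (if (if c < a then c else Suc c) = a then b else (if c < a then c else Suc c))) =
      ldet (j - 1) (\<lambda>x c. F x (if c < a then c else Suc c))"
    by (rule ldet_cong) auto
  then have same: "row_cofactor ?F j a = row_cofactor F j a" by (simp add: row_cofactor_def)
  have "(\<Sum>c = 1..j. row_cofactor ?F j c * ?z c) = ldet j (\<lambda>x c. if x < j then ?F x c else ?z c)"
    by (rule row_cofactor_expansion) (use assms in auto)
  also have "\<dots> = 0"
    by (rule ldet_equal_columns[of a _ b]) (use assms in auto)
  also have "(\<Sum>c = 1..j. row_cofactor ?F j c * ?z c) =
      (\<Sum>c = 1..j. (if c = s then row_cofactor ?F j c else 0) + (if c = a then (if s = b then row_cofactor ?F j c else 0) else 0))"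
    using assms(5) by (intro sum.cong) auto
  also have "\<dots> = row_cofactor ?F j s + (if s = b then row_cofactor ?F j a else 0)"
    using assms by (simp add: sum.distrib)
  finally show ?thesis by (auto simp: same add_eq_0_iff2)
qed

section \<open>The ring of even elements of an exterior algebra\<close>

text \<open>
  Applied to the inclusion of even elements, to the body map, and to the embedding of polynomials
  into rational functions.
\<close>

lemma ldet_hom:
  fixes f :: "'a::ring_1 \<Rightarrow> 'b::ring_1"
  assumes "\<And>x y. f (x + y) = f x + f y" "\<And>x y. f (x * y) = f x * f y" "f 1 = 1"
  shows "f (ldet s A) = ldet s (\<lambda>a b. f (A a b))"
proof -
  have f0: "f 0 = 0" using assms(1)[of 0 0] by simp
  have fm: "f (- x) = - f x" for x using assms(1)[of x "- x"] f0 by (simp add: add_eq_0_iff)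
  have fn: "f (of_nat k) = of_nat k" for k by (induction k) (simp_all add: f0 assms)
  have fi: "f (of_int k) = of_int k" for k by (cases k rule: int_cases2) (simp_all add: fn fm)
  have fs: "f (sum g P) = (\<Sum>p\<in>P. f (g p))" for g and P :: "(nat \<Rightarrow> nat) set"
    by (induction P rule: infinite_finite_induct) (simp_all add: f0 assms)
  have fp: "f (prod_list xs) = prod_list (map f xs)" for xs
    by (induction xs) (simp_all add: assms)
  show ?thesis unfolding ldet_def by (simp only: fs assms(2) fi fp map_map o_def)
qed

text \<open>
  The two signs differ by \<open>(- 1)\<close> to the number of all pairs, \<open>card T * card U\<close>.
\<close>

lemma gsign_commute:
  assumes "finite T" "finite U" "T \<inter> U = {}" "even (card T)"
  shows "gsign T U = (gsign U T :: 'a::comm_ring_1)"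
proof -
  let ?A = "{(t, u). t \<in> T \<and> u \<in> U \<and> u < t}" and ?B = "{(u, t). u \<in> U \<and> t \<in> T \<and> t < u}"
  have "T \<times> U = ?A \<union> prod.swap ` ?B"
    using assms(3) by (auto simp: image_iff not_less_iff_gr_or_eq)
  then have "card T * card U = card (?A \<union> prod.swap ` ?B)"
    using card_cartesian_product[of T U] by simp
  also have "\<dots> = card ?A + card (prod.swap ` ?B)"
  proof (rule card_Un_disjoint)
    show "finite ?A" "finite (prod.swap ` ?B)"
      by (rule finite_subset[of _ "T \<times> U"]; use assms in auto)+
  qed auto
  also have "card (prod.swap ` ?B) = card ?B" by (rule card_image) simp
  finally have "card T * card U = card ?A + card ?B" .
  then have "even (card ?A + card ?B)" using assms(4) by (metis even_mult_iff)
  then show ?thesis by (auto simp: gsign_def minus_one_power_iff)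
qed

text \<open>
  All entries of the determinants \<open>D\<^sup>+\<close> and \<open>D\<^sup>-\<close> are even. Even elements are central, so making them a
  type of their own gives a commutative ring to which the determinant identities apply.
\<close>

typedef (overloaded) ('i::linorder, 'a::comm_ring_1) even_grassmann =
    "{x :: ('i, 'a) grassmann. \<forall>S. odd (card S) \<longrightarrow> gcoeff x S = 0}"
  morphisms of_even to_even
  by (rule exI[of _ 0]) (simp add: zero_grassmann.rep_eq)

setup_lifting type_definition_even_grassmann

lemma even_grassmann_mult:
  assumes "\<And>S. odd (card S) \<Longrightarrow> gcoeff x S = 0" "\<And>S. odd (card S) \<Longrightarrow> gcoeff y S = 0"
    and S: "odd (card S)"
  shows "gcoeff (x * y :: ('i::linorder, 'a::comm_ring_1) grassmann) S = 0"
proof -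
  have fin: "finite S" using S by (metis card.infinite even_zero)
  show "gcoeff (x * y) S = 0"
    unfolding times_grassmann.rep_eq
  proof (rule sum.neutral, rule ballI)
    fix T assume "T \<in> Pow S"
    then have "card S = card T + card (S - T)" using fin
      by (metis PowD add_diff_inverse_nat card_Diff_subset card_mono finite_subset leD)
    then have "odd (card T) \<or> odd (card (S - T))" using S by presburger
    then show "gsign T (S - T) * gcoeff x T * gcoeff y (S - T) = 0" using assms by auto
  qed
qed

lemma even_grassmann_commute:
  assumes "\<forall>S. odd (card S) \<longrightarrow> gcoeff x S = 0"
  shows "x * y = y * (x :: ('i::linorder, 'a::comm_ring_1) grassmann)"
proof (rule grassmann_eqI)
  fix S
  show "gcoeff (x * y) S = gcoeff (y * x) S"
  proof (cases "finite S")
    case True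
    have "gcoeff (x * y) S = (\<Sum>T\<in>Pow S. gsign T (S - T) * gcoeff x T * gcoeff y (S - T))"
      by (simp add: times_grassmann.rep_eq)
    also have "\<dots> = (\<Sum>T\<in>Pow S. gsign T (S - T) * gcoeff y T * gcoeff x (S - T))"
    proof (rule sum.reindex_bij_witness[of _ "\<lambda>T. S - T" "\<lambda>T. S - T"])
      fix T assume T: "T \<in> Pow S"
      then have "S - (S - T) = T" by blast
      moreover have "gsign T (S - T) = (gsign (S - T) T :: 'a)" if "even (card T)"
        by (rule gsign_commute) (use that T True finite_subset in auto)
      ultimately show "gsign (S - T) (S - (S - T)) * gcoeff y (S - T) * gcoeff x (S - (S - T)) =
          gsign T (S - T) * gcoeff x T * gcoeff y (S - T)"
        using assms by (cases "even (card T)") (auto simp: mult.assoc mult.left_commute mult.commute)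
    qed auto
    also have "\<dots> = gcoeff (y * x) S"
      by (simp add: times_grassmann.rep_eq)
    finally show ?thesis .
  qed (simp add: gcoeff_infinite)
qed

instantiation even_grassmann :: (linorder, comm_ring_1) comm_ring_1
begin

lift_definition zero_even_grassmann :: "('a, 'b) even_grassmann" is 0
  by (simp add: zero_grassmann.rep_eq)

lift_definition one_even_grassmann :: "('a, 'b) even_grassmann" is 1
  by (auto simp: one_grassmann.rep_eq)

lift_definition plus_even_grassmann ::
  "('a, 'b) even_grassmann \<Rightarrow> ('a, 'b) even_grassmann \<Rightarrow> ('a, 'b) even_grassmann" is "(+)"
  by (simp add: plus_grassmann.rep_eq)

lift_definition uminus_even_grassmann ::
  "('a, 'b) even_grassmann \<Rightarrow> ('a, 'b) even_grassmann" is uminus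
  by (simp add: uminus_grassmann.rep_eq)

definition minus_even_grassmann ::
  "('a, 'b) even_grassmann \<Rightarrow> ('a, 'b) even_grassmann \<Rightarrow> ('a, 'b) even_grassmann" where
  "minus_even_grassmann x y = x + - y"

lift_definition times_even_grassmann ::
  "('a, 'b) even_grassmann \<Rightarrow> ('a, 'b) even_grassmann \<Rightarrow> ('a, 'b) even_grassmann" is "(*)"
  by (rule even_grassmann_mult)

instance
proof
  fix x y z :: "('a, 'b) even_grassmann"
  note rep = zero_even_grassmann.rep_eq one_even_grassmann.rep_eq plus_even_grassmann.rep_eq
      times_even_grassmann.rep_eq uminus_even_grassmann.rep_eq of_even_inject[symmetric]
  show "x * y * z = x * (y * z)" "x + y + z = x + (y + z)" "x + y = y + x" "0 + x = x" "1 * x = x"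
    "- x + x = 0" "(x + y) * z = x * z + y * z"
    by (simp_all only: rep mult.assoc add.assoc distrib_right add_0_left mult_1_left left_minus)
      (rule add.commute)
  show "x - y = x + - y" by (rule minus_even_grassmann_def)
  show "x * y = y * x"
    using even_grassmann_commute[of "of_even x" "of_even y"] of_even[of x] by (simp add: rep)
  show "(0 :: ('a, 'b) even_grassmann) \<noteq> 1"
    by (simp add: rep)
qed

end

lemma of_even_simps [simp]:
  "of_even 0 = 0" "of_even 1 = 1" "of_even (x + y) = of_even x + of_even y"
  "of_even (x * y) = of_even x * of_even y" "of_even (- x) = - of_even x"
  "of_even (x - y) = of_even x - of_even y"
  by (simp_all only: zero_even_grassmann.rep_eq one_even_grassmann.rep_eq plus_even_grassmann.rep_eq
      times_even_grassmann.rep_eq uminus_even_grassmann.rep_eq minus_even_grassmann_def diff_conv_add_uminus)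

lemma of_even_sum: "of_even (sum f A) = (\<Sum>i\<in>A. of_even (f i))"
  by (induction A rule: infinite_finite_induct) simp_all

lemma of_even_power: "of_even (x ^ k) = of_even x ^ k"
  by (induction k) simp_all

lemma of_even_prod_list: "of_even (prod_list xs) = prod_list (map of_even xs)"
  by (induction xs) simp_all

lemma of_even_of_int: "of_even (of_int k) = of_int k"
proof -
  have "of_even (of_nat k) = of_nat k" for k by (induction k) simp_all
  then show ?thesis by (cases k rule: int_cases2) simp_all
qed

lemma of_even_ldet: "of_even (ldet s A) = ldet s (\<lambda>a b. of_even (A a b))"
  by (rule ldet_hom) simp_all

lemma of_even_top_minor: "of_even (top_minor F is) = top_minor (\<lambda>a b. of_even (F a b)) is"
  unfolding top_minor_def by (rule of_even_ldet)

lemma of_even_row_cofactor: "of_even (row_cofactor F j c) = row_cofactor (\<lambda>a b. of_even (F a b)) j c"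
  by (cases "even (j + c)") (simp_all add: row_cofactor_def of_even_ldet)

text \<open>
  The constant term, modulo which the exterior generators vanish.
\<close>

definition body :: "('i::linorder, 'a::comm_ring_1) even_grassmann \<Rightarrow> 'a" where
  "body x = gcoeff (of_even x) {}"

lemma gcoeff_mult_empty:
  "gcoeff (x * y :: ('i::linorder, 'a::comm_ring_1) grassmann) {} = gcoeff x {} * gcoeff y {}"
  by (simp add: times_grassmann.rep_eq)

lemma body_simps [simp]:
  "body 1 = 1" "body (x + y) = body x + body y" "body (x * y) = body x * body y" "body (- x) = - body x"
  by (simp_all add: body_def one_grassmann.rep_eq plus_grassmann.rep_eq gcoeff_mult_empty uminus_grassmann.rep_eq)

lemma body_diff [simp]: "body (x - y) = body x - body y"
  by (simp only: diff_conv_add_uminus body_simps)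

lemma body_ldet: "body (ldet s A) = ldet s (\<lambda>a b. body (A a b))"
  by (rule ldet_hom) simp_all

text \<open>
  Only finitely many generators occur in an element, and without constant term each monomial of its
  \<open>k\<close>-th power involves at least \<open>k\<close> of them.
\<close>

lemma grassmann_nilpotent:
  fixes x :: "('i::linorder, 'a::comm_ring_1) grassmann"
  assumes "gcoeff x {} = 0"
  shows "\<exists>k. x ^ k = 0"
proof -
  define V where "V = \<Union>{S. gcoeff x S \<noteq> 0}"
  have "finite S" if "gcoeff x S \<noteq> 0" for S using that gcoeff_infinite by blast
  then have V: "finite V" unfolding V_def using finite_gcoeff[of x] by (intro finite_Union) auto
  have supp: "S \<subseteq> V \<and> k \<le> card S" if "gcoeff (x ^ k) S \<noteq> 0" for k S
    using that
  proof (induction k arbitrary: S)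
    case 0
    then show ?case by (auto simp: one_grassmann.rep_eq split: if_splits)
  next
    case (Suc k)
    then have "(\<Sum>T\<in>Pow S. gsign T (S - T) * gcoeff x T * gcoeff (x ^ k) (S - T)) \<noteq> 0"
      by (simp add: times_grassmann.rep_eq)
    then obtain T where "T \<in> Pow S" "gsign T (S - T) * gcoeff x T * gcoeff (x ^ k) (S - T) \<noteq> 0"
      by (meson sum.neutral)
    then have T: "T \<subseteq> S" "gcoeff x T \<noteq> 0" "gcoeff (x ^ k) (S - T) \<noteq> 0" by auto
    have "S - T \<subseteq> V" "k \<le> card (S - T)" using Suc.IH[OF T(3)] by auto
    moreover have "T \<subseteq> V" using T(2) by (auto simp: V_def)
    moreover have "T \<noteq> {}" using assms T(2) by auto
    moreover from calculation have S: "S \<subseteq> V" by blast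
    moreover from S V have "finite S" by (rule finite_subset)
    moreover have "card S = card T + card (S - T)"
      using \<open>finite S\<close> T(1) by (metis add_diff_inverse_nat card_Diff_subset card_mono finite_subset leD)
    moreover have "card T > 0" using \<open>T \<noteq> {}\<close> \<open>finite S\<close> T(1) by (auto simp: card_gt_0_iff intro: finite_subset)
    ultimately show ?case by auto
  qed
  have "gcoeff (x ^ Suc (card V)) S = 0" for S
    using supp[of "Suc (card V)" S] card_mono[OF V, of S] by force
  then have "x ^ Suc (card V) = 0"
    by (intro grassmann_eqI) (simp add: zero_grassmann.rep_eq del: power_Suc)
  then show ?thesis by blast
qed

text \<open>
  The inverse is a finite geometric series in the nilpotent element \<open>1 - x b\<close>. It is stated explicitly
  because it must be seen to lie in \<open>K(m|n)\<close>.
\<close>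

lemma unit_of_body:
  fixes x :: "('i::linorder, 'a::comm_ring_1) even_grassmann"
  assumes "body x * b = 1"
  shows "\<exists>k. x * (to_even (gconst b) * (\<Sum>i<k. (1 - x * to_even (gconst b)) ^ i)) = 1"
proof -
  let ?b = "to_even (gconst b) :: ('i, 'a) even_grassmann" and ?n = "1 - x * to_even (gconst b)"
  have b: "of_even ?b = gconst b" by (rule to_even_inverse) (auto simp: gcoeff_gconst)
  then have "body ?b = b" by (simp add: body_def gcoeff_gconst)
  then have "body ?n = 0" using assms by simp
  then obtain k where "of_even ?n ^ k = 0" using grassmann_nilpotent[of "of_even ?n"] by (auto simp: body_def)
  then have "of_even (?n ^ k) = of_even 0" unfolding of_even_power by simp
  then have n: "?n ^ k = 0" by (simp only: of_even_inject)
  have "x * (?b * (\<Sum>i<k. ?n ^ i)) = (1 - ?n) * (\<Sum>i<k. ?n ^ i)" by (simp add: mult.assoc)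
  also have "\<dots> = 1 - ?n ^ k" by (rule one_diff_power_eq[symmetric])
  finally show ?thesis using n by auto
qed

section \<open>The ring \<open>K(m|n)\<close> and its units\<close>

lemma kconst_0: "kconst 0 = 0"
  by (simp add: kconst_def gconst_0 Zero_fract_def[symmetric])

lemma kconst_uminus: "kconst (- a) = - kconst a"
  using kconst_simps(2)[of a "- a"] by (simp add: kconst_0 eq_neg_iff_add_eq_0 add.commute)

lemma Aev_fractions:
  assumes "f \<in> Aev m n" "f \<noteq> 0" "g \<in> Aev m n" "g \<noteq> (0 :: 'k::field salg)"
  shows "f * g \<in> Aev m n" "f * g \<noteq> 0" "rinv (f * g) = rinv f * rinv g"
    "rinv f * x = x * rinv f" "f * rinv f = 1" "rinv f * f = 1"
proof -
  obtain p q where f: "f = gconst p" and g: "g = gconst q" using Aev_gconst assms by metis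
  have p: "p \<noteq> 0" "rinv f = gconst (inverse p)" and q: "q \<noteq> 0" "rinv g = gconst (inverse q)"
    using rinv_gconst assms f g by auto
  show "f * g \<in> Aev m n" using assms by (simp add: Aev.mult)
  have fg: "f * g = gconst (p * q)" by (simp add: f g gconst_mult)
  show nz: "f * g \<noteq> 0"
  proof
    assume "f * g = 0"
    then have "gcoeff (gconst (p * q) :: 'k salg) {} = 0" unfolding fg by (simp add: zero_grassmann.rep_eq)
    then show False using p q by (simp add: gcoeff_gconst)
  qed
  show "rinv (f * g) = rinv f * rinv g"
    unfolding fg rinv_gconst(1)[OF nz[unfolded fg]] p(2) q(2) by (simp add: gconst_mult)
  show "rinv f * x = x * rinv f" unfolding p(2) by (rule gconst_commute)
  show "f * rinv f = 1" "rinv f * f = 1"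
    unfolding p(2) unfolding f using p(1) by (simp_all add: gconst_mult[symmetric] gconst_1)
qed

lemma Aev_one: "1 \<in> Aev m n"
  using Aev.const[of 1] by (simp add: kconst_simps)

lemma Amn_Kmn: "a \<in> Amn m n \<Longrightarrow> a \<in> Kmn m n"
  unfolding Kmn_def by (intro CollectI exI[of _ a] exI[of _ 1]) (auto simp: Aev_one rinv_unique[of 1 1])

lemma Kmn_rinv: "f \<in> Aev m n \<Longrightarrow> f \<noteq> 0 \<Longrightarrow> rinv f \<in> Kmn m n"
  unfolding Kmn_def
  by (intro CollectI exI[of _ 1] exI[of _ f]) (use Aev_one[of m n] Aev_subset[of m n] in auto)

lemma Kmn_mult: "x \<in> Kmn m n \<Longrightarrow> y \<in> Kmn m n \<Longrightarrow> x * y \<in> (Kmn m n :: 'k::field salg set)"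
proof -
  assume "x \<in> Kmn m n" "y \<in> Kmn m n"
  then obtain a f b g where x: "x = a * rinv f" "a \<in> Amn m n" "f \<in> Aev m n" "f \<noteq> 0"
    and y: "y = b * rinv g" "b \<in> Amn m n" "g \<in> Aev m n" "g \<noteq> 0" by (auto simp: Kmn_def)
  note * = Aev_fractions[OF x(3,4) y(3,4)]
  have "rinv f * (b * rinv g) = b * (rinv f * rinv g)"
    by (simp only: mult.assoc[symmetric] *(4)[of b])
  then have "x * y = (a * b) * rinv (f * g)"
    unfolding x(1) y(1) *(3) by (simp only: mult.assoc)
  then show ?thesis unfolding Kmn_def using * x y by (blast intro: Amn.mult)
qed

lemma Kmn_add: "x \<in> Kmn m n \<Longrightarrow> y \<in> Kmn m n \<Longrightarrow> x + y \<in> (Kmn m n :: 'k::field salg set)"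
proof -
  assume "x \<in> Kmn m n" "y \<in> Kmn m n"
  then obtain a f b g where x: "x = a * rinv f" "a \<in> Amn m n" "f \<in> Aev m n" "f \<noteq> 0"
    and y: "y = b * rinv g" "b \<in> Amn m n" "g \<in> Aev m n" "g \<noteq> 0" by (auto simp: Kmn_def)
  note * = Aev_fractions[OF x(3,4) y(3,4)] and ** = Aev_fractions[OF y(3,4) x(3,4)]
  have 1: "x = a * g * rinv (f * g)"
  proof -
    have "g * (rinv f * rinv g) = rinv f * (g * rinv g)"
      by (simp only: mult.assoc[symmetric] *(4)[of g])
    then show ?thesis unfolding x(1) *(3) by (simp only: mult.assoc **(5) mult_1_right)
  qed
  have 2: "y = b * f * rinv (f * g)"
  proof -
    have "f * (rinv f * rinv g) = rinv g" by (simp only: mult.assoc[symmetric] *(5) mult_1_left)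
    then show ?thesis unfolding y(1) *(3) by (simp only: mult.assoc)
  qed
  have "x + y = (a * g + b * f) * rinv (f * g)"
    unfolding distrib_right 1[symmetric] 2[symmetric] ..
  moreover have "a * g + b * f \<in> Amn m n" using x y Aev_subset by (blast intro: Amn.intros)
  ultimately show ?thesis unfolding Kmn_def using * by blast
qed

lemma Kmn_kconst: "kconst a \<in> Kmn m n" by (intro Amn_Kmn Amn.const)

lemma Kmn_0_1: "0 \<in> Kmn m n" "1 \<in> Kmn m n"
  using Kmn_kconst[of 0] Kmn_kconst[of 1] by (simp_all add: kconst_0 kconst_simps)

lemma Kmn_uminus: "x \<in> Kmn m n \<Longrightarrow> - x \<in> Kmn m n"
  using Kmn_mult[OF Kmn_kconst[of "- 1" m n], of x] by (simp add: kconst_uminus kconst_simps)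

lemma Kmn_diff: "x \<in> Kmn m n \<Longrightarrow> y \<in> Kmn m n \<Longrightarrow> x - y \<in> Kmn m n"
  unfolding diff_conv_add_uminus by (intro Kmn_add Kmn_uminus)

lemma Kmn_sum: "(\<And>i. i \<in> A \<Longrightarrow> f i \<in> Kmn m n) \<Longrightarrow> sum f A \<in> Kmn m n"
  by (induction A rule: infinite_finite_induct) (auto intro: Kmn_add Kmn_0_1)

lemma Kmn_prod_list: "(\<And>x. x \<in> set xs \<Longrightarrow> x \<in> Kmn m n) \<Longrightarrow> prod_list xs \<in> Kmn m n"
  by (induction xs) (auto intro: Kmn_mult Kmn_0_1)

lemma Kmn_power: "x \<in> Kmn m n \<Longrightarrow> x ^ k \<in> Kmn m n"
  by (induction k) (auto intro: Kmn_mult Kmn_0_1)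

lemma Kmn_of_int: "of_int k \<in> Kmn m n"
proof -
  have "of_nat k \<in> Kmn m n" for k by (induction k) (auto intro: Kmn_add Kmn_0_1)
  then show ?thesis by (cases k rule: int_cases2) (auto intro: Kmn_uminus)
qed

lemma Kmn_cgen: "i \<in> {1..m + n} \<Longrightarrow> j \<in> {1..m + n} \<Longrightarrow> cgen m i j \<in> Kmn m n"
  by (intro Amn_Kmn Amn.gen)

lemma Kmn_ldet:
  assumes "\<And>a b. a \<in> {1..s} \<Longrightarrow> b \<in> {1..s} \<Longrightarrow> A a b \<in> Kmn m n"
  shows "ldet s A \<in> Kmn m n"
  unfolding ldet_def
proof (intro Kmn_sum Kmn_mult Kmn_of_int Kmn_prod_list)
  fix p x assume p: "p \<in> {p. p permutes {1..s}}" and x: "x \<in> set (map (\<lambda>a. A a (p a)) [1..<Suc s])"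
  then obtain a where "a \<in> set [1..<Suc s]" and xa: "x = A a (p a)" unfolding set_map by blast
  then have "a \<in> {1..s}" by (auto simp del: upt_Suc)
  with xa show "x \<in> Kmn m n" using assms[of a "p a"] p permutes_in_image[of p "{1..s}" a] by simp
qed

text \<open>
  An odd generator has constant term \<open>0\<close>, an even one is its own constant term.
\<close>

lemma Amn_body: "x \<in> Amn m n \<Longrightarrow> gconst (gcoeff x {}) \<in> (Aev m n :: 'k::field salg set)"
proof (induction rule: Amn.induct)
  case (const a)
  then show ?case using Aev.const[of a] by (simp add: kconst_def gcoeff_gconst)
next
  case (gen i j)
  have "(0 :: 'k salg) \<in> Aev m n" using Aev.const[of 0] by (simp add: kconst_0)
  then show ?case
    using gen Aev.gen[of i m n j] by (auto simp: cgen_def evvar_def oddvar_def gcoeff_gconst gcoeff_ggen gconst_0)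
qed (auto simp: plus_grassmann.rep_eq gcoeff_mult_empty gconst_add gconst_mult intro: Aev.intros)

text \<open>
  The derivations are only known on \<open>K(m|n)\<close>, so inverses have to be found inside this ring. The
  constant term of a fraction \<open>a / f\<close> is a quotient of two elements of \<open>A\<^bsub>ev\<^esub>(m|n)\<close>; hence its inverse is again in
  \<open>K(m|n)\<close>, and the geometric series does the rest.
\<close>

lemma Kmn_unit:
  fixes x :: "(nat, 'k::field cpoly fract) even_grassmann"
  assumes x: "of_even x \<in> Kmn m n" and nz: "body x \<noteq> 0"
  shows "\<exists>y. x * y = 1 \<and> of_even y \<in> Kmn m n"
proof -
  obtain a f where af: "of_even x = a * rinv f" "a \<in> Amn m n" "f \<in> Aev m n" "f \<noteq> 0"
    using x by (auto simp: Kmn_def)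
  obtain q where q: "f = gconst q" using Aev_gconst[OF af(3)] by blast
  have q0: "q \<noteq> 0" "rinv f = gconst (inverse q)" using rinv_gconst af(4) q by auto
  let ?a = "gcoeff a {}"
  have bx: "body x = ?a * inverse q" by (simp add: body_def af(1) q0(2) gcoeff_mult_empty gcoeff_gconst)
  then have a0: "?a \<noteq> 0" using nz by auto
  have "gconst ?a \<noteq> (0 :: 'k salg)" using a0 gcoeff_gconst[of ?a "{} :: nat set"] by (auto simp: zero_grassmann.rep_eq)
  then have r: "rinv (gconst ?a :: 'k salg) = gconst (inverse ?a)" "rinv (gconst ?a :: 'k salg) \<in> Kmn m n"
    using rinv_gconst Kmn_rinv[OF Amn_body[OF af(2)]] by auto
  let ?b = "inverse (body x)"
  have "gconst ?b = f * rinv (gconst ?a)" unfolding r(1) q gconst_mult[symmetric] bx by (simp add: mult.commute)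
  then have b: "gconst ?b \<in> Kmn m n" using Kmn_mult[OF Amn_Kmn[OF subsetD[OF Aev_subset af(3)]] r(2)] by simp
  obtain k where k: "x * (to_even (gconst ?b) * (\<Sum>i<k. (1 - x * to_even (gconst ?b)) ^ i)) = 1"
    using unit_of_body[of x ?b] nz by auto
  have "of_even (to_even (gconst ?b)) = (gconst ?b :: 'k salg)"
    by (rule to_even_inverse) (auto simp: gcoeff_gconst)
  then have "of_even (to_even (gconst ?b) * (\<Sum>i<k. (1 - x * to_even (gconst ?b)) ^ i)) \<in> Kmn m n"
    using b x by (auto simp: of_even_sum of_even_power intro!: Kmn_mult Kmn_sum Kmn_power Kmn_diff Kmn_0_1)
  then show ?thesis using k by blast
qed

lemma rinv_of_even: "x * y = 1 \<Longrightarrow> rinv (of_even x) = of_even y"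
  by (rule rinv_unique) (simp_all flip: of_even_simps add: mult.commute)

section \<open>The generic matrix and its inverse\<close>

text \<open>
  Distinct permutations give distinct monomials, so the diagonal monomial has coefficient \<open>1\<close>.
\<close>

lemma generic_det_nonzero:
  assumes "inj (\<lambda>(a, b). e a b)"
  shows "ldet s (\<lambda>a b. Poly_Mapping.single (Poly_Mapping.single (e a b) 1) 1 :: 'k::field cpoly) \<noteq> 0"
proof -
  let ?S = "{1..s}"
  let ?t = "\<lambda>p. \<Sum>a\<in>?S. Poly_Mapping.single (e a (p a)) (1 :: nat)"
  have prod: "(\<Prod>a\<in>A. Poly_Mapping.single (Poly_Mapping.single (e a (p a)) 1) 1 :: 'k cpoly) =
      Poly_Mapping.single (\<Sum>a\<in>A. Poly_Mapping.single (e a (p a)) 1) 1" for p and A :: "nat set"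
    by (induction A rule: infinite_finite_induct) (simp_all add: mult_single)
  have sgn: "of_int (sign p) * (Poly_Mapping.single t 1 :: 'k cpoly) = Poly_Mapping.single t (of_int (sign p))" for p :: "nat \<Rightarrow> nat" and t
    by (cases "sign p = 1") (auto simp: sign_def single_uminus)
  have inj: "e a b = e c d \<longleftrightarrow> a = c \<and> b = d" for a b c d
    using injD[OF assms, of "(a, b)" "(c, d)"] by auto
  have diag: "p = id" if p: "p permutes ?S" and eq: "?t p = ?t id" for p
  proof
    fix a
    show "p a = id a"
    proof (cases "a \<in> ?S")
      case True
      have "Poly_Mapping.lookup (?t p) (e a (p a)) = (\<Sum>b\<in>?S. if b = a then 1 else 0)"
        unfolding lookup_sum lookup_single when_def inj by (rule sum.cong) auto
      also have "\<dots> = 1" using True by simp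
      finally have 1: "Poly_Mapping.lookup (?t id) (e a (p a)) = 1" by (simp only: eq)
      show ?thesis
      proof (rule ccontr)
        assume "p a \<noteq> id a"
        then have "Poly_Mapping.lookup (?t id) (e a (p a)) = 0"
          unfolding lookup_sum lookup_single when_def inj by (intro sum.neutral) auto
        then show False using 1 by simp
      qed
    qed (use p in \<open>simp add: permutes_not_in\<close>)
  qed
  have "Poly_Mapping.lookup (ldet s (\<lambda>a b. Poly_Mapping.single (Poly_Mapping.single (e a b) 1) 1 :: 'k cpoly)) (?t id) =
      (\<Sum>p | p permutes ?S. Poly_Mapping.lookup (Poly_Mapping.single (?t p) (of_int (sign p))) (?t id))"
    unfolding ldet_prod prod sgn lookup_sum ..
  also have "\<dots> = (\<Sum>p | p permutes ?S. if p = id then 1 else (0 :: 'k))"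
  proof (rule sum.cong[OF refl])
    fix p assume "p \<in> {p. p permutes ?S}"
    then show "Poly_Mapping.lookup (Poly_Mapping.single (?t p) (of_int (sign p))) (?t id) = (if p = id then 1 else (0 :: 'k))"
      using diag[of p] by (cases "p = id") (auto simp: lookup_single when_def)
  qed
  also have "\<dots> = 1" by (simp add: finite_permutations permutes_id)
  finally show ?thesis by auto
qed

definition adjugate :: "nat \<Rightarrow> (nat \<Rightarrow> nat \<Rightarrow> 'a::ring_1) \<Rightarrow> nat \<Rightarrow> nat \<Rightarrow> 'a" where
  "adjugate s A a b = (- 1) ^ (a + b) *
    ldet (s - 1) (\<lambda>i j. A (if i < b then i else Suc i) (if j < a then j else Suc j))"

lemma ldet_adjugate:
  fixes A :: "nat \<Rightarrow> nat \<Rightarrow> 'a::comm_ring_1"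
  assumes ab: "a \<in> {1..s}" "b \<in> {1..s}"
  shows "(\<Sum>r = 1..s. A a r * adjugate s A r b) = (if a = b then ldet s A else 0)"
    and "(\<Sum>r = 1..s. adjugate s A a r * A r b) = (if a = b then ldet s A else 0)"
proof -
  let ?N = "adjugate s A"
  let ?A = "mat s s (\<lambda>(i, j). A (Suc i) (Suc j))"
  have A: "?A \<in> carrier_mat s s" by simp
  have N: "adj_mat ?A $$ (i, j) = ?N (Suc i) (Suc j)" if "i < s" "j < s" for i j
  proof -
    have "mat_delete ?A j i = mat (s - 1) (s - 1) (\<lambda>(i', j'). A (if Suc i' < Suc j then Suc i' else Suc (Suc i'))
        (if Suc j' < Suc i then Suc j' else Suc (Suc j')))"
      using that by (intro eq_matI) (auto simp: mat_delete_def)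
    then show ?thesis
      using that by (simp add: adj_mat_def cofactor_def adjugate_def ldet_eq_det add.commute)
  qed
  obtain a' where a: "a = Suc a'" "a' < s" using ab(1) by (cases a) auto
  obtain b' where b: "b = Suc b'" "b' < s" using ab(2) by (cases b) auto
  have "(?A * adj_mat ?A) $$ (a', b') = (\<Sum>r<s. A a (Suc r) * ?N (Suc r) b)"
    using a b adj_mat(1)[OF A] by (simp add: scalar_prod_def N lessThan_atLeast0)
  then show "(\<Sum>r = 1..s. A a r * adjugate s A r b) = (if a = b then ldet s A else 0)"
    unfolding adj_mat(2)[OF A] using a b by (auto simp: sum.atLeast1_atMost_eq ldet_eq_det)
  have "(adj_mat ?A * ?A) $$ (a', b') = (\<Sum>r<s. ?N a (Suc r) * A (Suc r) b)"
    using a b adj_mat(1)[OF A] by (simp add: scalar_prod_def N lessThan_atLeast0)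
  then show "(\<Sum>r = 1..s. adjugate s A a r * A r b) = (if a = b then ldet s A else 0)"
    unfolding adj_mat(3)[OF A] using a b by (auto simp: sum.atLeast1_atMost_eq ldet_eq_det)
qed

text \<open>
  A left inverse \<open>L\<close> of \<open>A\<close> solves the linear system \<open>A z = w\<close>; the unknowns need not commute with the
  coefficients, as is the case for the odd \<open>y\<^bsub>kl\<^esub>\<close>.
\<close>

lemma matrix_solve:
  fixes L A :: "nat \<Rightarrow> nat \<Rightarrow> 'a::ring_1"
  assumes "\<And>b. b \<in> {1..s} \<Longrightarrow> (\<Sum>r = 1..s. L k r * A r b) = (if k = b then 1 else 0)"
    and "\<And>a. a \<in> {1..s} \<Longrightarrow> (\<Sum>p = 1..s. A a p * z p) = w a" and k: "k \<in> {1..s}"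
  shows "z k = (\<Sum>a = 1..s. L k a * w a)"
proof -
  have "(\<Sum>a = 1..s. L k a * w a) = (\<Sum>a = 1..s. L k a * (\<Sum>p = 1..s. A a p * z p))"
    by (rule sum.cong) (simp_all only: assms(2))
  also have "\<dots> = (\<Sum>p = 1..s. (\<Sum>a = 1..s. L k a * A a p) * z p)"
    unfolding sum_distrib_left sum_distrib_right mult.assoc by (rule sum.swap)
  also have "\<dots> = (\<Sum>p = 1..s. if k = p then z p else 0)"
    by (rule sum.cong) (simp_all add: assms(1) del: One_nat_def)
  also have "\<dots> = z k" using k by simp
  finally show ?thesis ..
qed

type_synonym 'k even_alg = "(nat, 'k cpoly fract) even_grassmann"

text \<open>
  The entries of \<open>C\<^sub>1\<^sub>1\<close> and of \<open>\<phi>(C\<^sub>2\<^sub>2)\<close> as elements of the commutative ring of even elements. Outside the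
  index ranges where these entries are even the values are arbitrary.
\<close>

definition even_c :: "nat \<Rightarrow> nat \<Rightarrow> nat \<Rightarrow> 'k::field even_alg" where
  "even_c m a b = to_even (cgen m a b)"

definition even_phi :: "nat \<Rightarrow> nat \<Rightarrow> nat \<Rightarrow> 'k::field even_alg" where
  "even_phi m a b = to_even (phic m (m + a) (m + b))"

lemma range_of_evenI: "(\<And>S. odd (card S) \<Longrightarrow> gcoeff x S = 0) \<Longrightarrow> x \<in> range of_even"
  by (rule image_eqI[of _ _ "to_even x"]) (simp_all add: to_even_inverse)

lemma of_even_to_even: "x \<in> range of_even \<Longrightarrow> of_even (to_even x) = x"
  by (auto simp: of_even_inverse)

lemma range_of_even_add: "x \<in> range of_even \<Longrightarrow> y \<in> range of_even \<Longrightarrow> x + y \<in> range of_even"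
  by (auto simp flip: of_even_simps)

lemma range_of_even_diff: "x \<in> range of_even \<Longrightarrow> y \<in> range of_even \<Longrightarrow> x - y \<in> range of_even"
  by (auto simp flip: of_even_simps)

lemma range_of_even_sum: "(\<And>i. i \<in> A \<Longrightarrow> f i \<in> range of_even) \<Longrightarrow> sum f A \<in> range of_even"
proof (induction A rule: infinite_finite_induct)
  case (insert a A)
  then show ?case by (simp add: range_of_even_add)
qed (auto intro: image_eqI[of _ _ 0])

lemma cgen_even: "(i \<le> m) = (j \<le> m) \<Longrightarrow> cgen m i j \<in> range of_even"
  by (rule range_of_evenI) (auto simp: cgen_def evvar_def gcoeff_gconst)

lemma of_even_even_c: "a \<le> m \<Longrightarrow> b \<le> m \<Longrightarrow> of_even (even_c m a b) = cgen m a b"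
  unfolding even_c_def by (intro of_even_to_even cgen_even) auto

text \<open>
  For the summands of \<open>C\<^sub>2\<^sub>1 C\<^sub>1\<^sub>1\<^sup>-\<^sup>1 C\<^sub>1\<^sub>2\<close>.
\<close>

lemma odd_even_odd: "ggen u * of_even x * ggen v \<in> range of_even"
proof (rule range_of_evenI)
  fix S :: "'a set" assume S: "odd (card S)"
  then have fin: "finite S" by (metis card.infinite even_zero)
  show "gcoeff (ggen u * of_even x * ggen v) S = 0"
  proof (cases "v \<in> S \<and> u \<in> S - {v}")
    case True
    then have "card S = Suc (card (S - {v}))" "card (S - {v}) = Suc (card (S - {v} - {u}))"
      using fin by (simp_all add: card.remove del: card_Diff_insert)
    then have "odd (card (S - {v} - {u}))" using S by presburger
    then have "gcoeff (of_even x) (S - {v} - {u}) = 0" using of_even[of x] by blast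
    then show ?thesis using True fin by (simp add: gcoeff_mult_ggen)
  qed (use fin in \<open>auto simp: gcoeff_mult_ggen\<close>)
qed

lemma body_generic:
  assumes "(i \<le> m) = (j \<le> m)"
  shows "gcoeff (cgen m i j) {} =
    Fraction_Field.Fract (Poly_Mapping.single (Poly_Mapping.single (prod_encode (i, j)) 1) 1) 1"
  using assms by (simp add: cgen_def evvar_def gcoeff_gconst)

lemma generic_block_nonzero:
  "ldet s (\<lambda>a b. Fraction_Field.Fract
     (Poly_Mapping.single (Poly_Mapping.single (prod_encode (c + a, c + b)) 1) 1 :: 'k::field cpoly) 1) \<noteq> 0"
proof -
  let ?X = "\<lambda>a b. Poly_Mapping.single (Poly_Mapping.single (prod_encode (c + a, c + b)) 1) 1 :: 'k cpoly"
  have "Fraction_Field.Fract (ldet s ?X) 1 = ldet s (\<lambda>a b. Fraction_Field.Fract (?X a b) 1)"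
    by (rule ldet_hom) (simp_all add: One_fract_def)
  then have "ldet s (\<lambda>a b. Fraction_Field.Fract (?X a b) 1) = Fraction_Field.Fract (ldet s ?X) 1" ..
  moreover have "ldet s ?X \<noteq> 0"
    by (rule generic_det_nonzero) (auto simp: inj_def)
  ultimately show ?thesis by (simp add: Zero_fract_def eq_fract)
qed

lemma even_c_minor_unit:
  assumes "s \<le> m"
  shows "\<exists>y. ldet s (even_c m) * y = 1 \<and> of_even y \<in> (Kmn m n :: 'k::field salg set)"
proof (rule Kmn_unit)
  have "of_even (ldet s (even_c m)) = (ldet s (cgen m) :: 'k salg)"
    unfolding of_even_ldet using assms by (intro ldet_cong) (simp add: of_even_even_c)
  also have "\<dots> \<in> Kmn m n" using assms by (intro Kmn_ldet Kmn_cgen) auto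
  finally show "of_even (ldet s (even_c m)) \<in> (Kmn m n :: 'k salg set)" .
  have "body (ldet s (even_c m)) = (ldet s (\<lambda>a b. Fraction_Field.Fract
     (Poly_Mapping.single (Poly_Mapping.single (prod_encode (0 + a, 0 + b)) 1) 1 :: 'k cpoly) 1))"
    unfolding body_ldet using assms by (intro ldet_cong) (simp add: body_def of_even_even_c body_generic)
  then show "body (ldet s (even_c m) :: 'k even_alg) \<noteq> 0" using generic_block_nonzero[of s 0] by simp
qed

text \<open>
  \<open>C\<^sub>1\<^sub>1\<close> is invertible because its determinant is a nonzero polynomial; the inverse is the adjugate
  divided by the determinant, so its entries are even and lie in \<open>K(m|n)\<close>.
\<close>

lemma matinv_even:
  obtains N :: "nat \<Rightarrow> nat \<Rightarrow> 'k::field even_alg" where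
    "\<And>a b. a \<in> {1..m} \<Longrightarrow> b \<in> {1..m} \<Longrightarrow> matinv m (cgen m) a b = of_even (N a b)"
    "\<And>a b. a \<in> {1..m} \<Longrightarrow> b \<in> {1..m} \<Longrightarrow> of_even (N a b) \<in> Kmn m n"
    "\<And>a b. a \<in> {1..m} \<Longrightarrow> b \<in> {1..m} \<Longrightarrow>
      (\<Sum>r = 1..m. cgen m a r * of_even (N r b)) = (if a = b then 1 else 0)"
    "\<And>a b. a \<in> {1..m} \<Longrightarrow> b \<in> {1..m} \<Longrightarrow>
      (\<Sum>r = 1..m. of_even (N a r) * cgen m r b) = (if a = b then 1 else 0)"
proof -
  obtain e :: "'k even_alg" where e: "ldet m (even_c m) * e = 1" "of_even e \<in> Kmn m n"
    using even_c_minor_unit[of m m n] by blast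
  define A where "A = (even_c m :: nat \<Rightarrow> nat \<Rightarrow> 'k even_alg)"
  define N where "N = (\<lambda>a b. e * adjugate m A a b)"
  note adjugate = ldet_adjugate[of _ m _ A]
  have right: "(\<Sum>r = 1..m. cgen m a r * of_even (N r b)) = (if a = b then 1 else 0)"
    if "a \<in> {1..m}" "b \<in> {1..m}" for a b
  proof -
    have "(\<Sum>r = 1..m. cgen m a r * of_even (N r b)) = of_even (e * (\<Sum>r = 1..m. A a r * adjugate m A r b))"
      unfolding sum_distrib_left of_even_sum
    proof (intro sum.cong refl)
      fix r assume "r \<in> {1..m}"
      then have "cgen m a r = of_even (A a r)" using that by (simp add: A_def of_even_even_c)
      moreover have "A a r * N r b = e * (A a r * adjugate m A r b)" by (simp add: N_def mult.left_commute)
      ultimately show "cgen m a r * of_even (N r b) = of_even (e * (A a r * adjugate m A r b))"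
        by (metis of_even_simps(4))
    qed
    also have "\<dots> = of_even (if a = b then e * ldet m A else 0)"
      unfolding adjugate(1)[OF that] by simp
    finally show ?thesis using e(1) by (simp add: A_def mult.commute)
  qed
  have left: "(\<Sum>r = 1..m. of_even (N a r) * cgen m r b) = (if a = b then 1 else 0)"
    if "a \<in> {1..m}" "b \<in> {1..m}" for a b
  proof -
    have "(\<Sum>r = 1..m. of_even (N a r) * cgen m r b) = of_even (e * (\<Sum>r = 1..m. adjugate m A a r * A r b))"
      using that unfolding sum_distrib_left of_even_sum
      by (intro sum.cong refl) (simp add: N_def A_def of_even_even_c mult.assoc)
    also have "\<dots> = of_even (if a = b then e * ldet m A else 0)"
      unfolding adjugate(2)[OF that] by simp
    finally show ?thesis using e(1) by (simp add: A_def mult.commute)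
  qed
  let ?M = "\<lambda>a b. if a \<in> {1..m} \<and> b \<in> {1..m} then of_even (N a b) else (0 :: 'k salg)"
  have eq: "matinv m (cgen m) = ?M"
    unfolding matinv_def
  proof (rule the_equality)
    have "(\<Sum>r = 1..m. cgen m a r * ?M r b) = (\<Sum>r = 1..m. cgen m a r * of_even (N r b))"
      "(\<Sum>r = 1..m. ?M a r * cgen m r b) = (\<Sum>r = 1..m. of_even (N a r) * cgen m r b)"
      if "a \<in> {1..m}" "b \<in> {1..m}" for a b
      using that by (auto intro: sum.cong)
    then show "(\<forall>a b. \<not> (a \<in> {1..m} \<and> b \<in> {1..m}) \<longrightarrow> ?M a b = 0) \<and>
     (\<forall>a\<in>{1..m}. \<forall>b\<in>{1..m}. (\<Sum>r=1..m. cgen m a r * ?M r b) = (if a = b then 1 else 0)) \<and>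
     (\<forall>a\<in>{1..m}. \<forall>b\<in>{1..m}. (\<Sum>r=1..m. ?M a r * cgen m r b) = (if a = b then 1 else 0))"
      using left right by simp
  next
    fix M' assume M': "(\<forall>a b. \<not> (a \<in> {1..m} \<and> b \<in> {1..m}) \<longrightarrow> M' a b = (0 :: 'k salg)) \<and>
     (\<forall>a\<in>{1..m}. \<forall>b\<in>{1..m}. (\<Sum>r=1..m. cgen m a r * M' r b) = (if a = b then 1 else 0)) \<and>
     (\<forall>a\<in>{1..m}. \<forall>b\<in>{1..m}. (\<Sum>r=1..m. M' a r * cgen m r b) = (if a = b then 1 else 0))"
    show "M' = ?M"
    proof (intro ext)
      fix a b
      show "M' a b = ?M a b"
      proof (cases "a \<in> {1..m} \<and> b \<in> {1..m}")
        case True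
        have "M' a b = (\<Sum>r = 1..m. of_even (N a r) * (if r = b then 1 else 0))"
          by (rule matrix_solve[where A = "cgen m" and z = "\<lambda>x. M' x b"]) (use M' True left in auto)
        also have "\<dots> = of_even (N a b)" using True by (simp add: if_distrib cong: if_cong)
        finally show ?thesis using True by simp
      qed (use M' in auto)
    qed
  qed
  have "of_even (N a b) \<in> Kmn m n" if "a \<in> {1..m}" "b \<in> {1..m}" for a b
  proof -
    have "of_even (ldet (m - 1) (\<lambda>i j. A (if i < b then i else Suc i) (if j < a then j else Suc j))) \<in> Kmn m n"
      unfolding of_even_ldet by (rule Kmn_ldet) (use that in \<open>auto simp: A_def of_even_even_c intro!: Kmn_cgen\<close>)
    then show ?thesis unfolding N_def adjugate_def
      using e(2) by (auto simp: of_even_power intro!: Kmn_mult Kmn_power Kmn_uminus Kmn_0_1)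
  qed
  then show ?thesis using that[of N] eq left right by simp
qed

text \<open>
  \<open>Y\<close> is characterised by \<open>C\<^sub>1\<^sub>1 Y = C\<^sub>1\<^sub>2\<close>. All later computations use this linear system in place of the
  inverse matrix.
\<close>

lemma yel_equation:
  assumes "a \<in> {1..m}"
  shows "(\<Sum>p = 1..m. cgen m a p * yel m p l) = (cgen m a l :: 'k::field salg)"
proof -
  obtain N :: "nat \<Rightarrow> nat \<Rightarrow> 'k even_alg" where
    N: "\<And>a b. a \<in> {1..m} \<Longrightarrow> b \<in> {1..m} \<Longrightarrow> matinv m (cgen m) a b = of_even (N a b)"
    "\<And>a b. a \<in> {1..m} \<Longrightarrow> b \<in> {1..m} \<Longrightarrow>
      (\<Sum>r = 1..m. cgen m a r * of_even (N r b)) = (if a = b then 1 else 0)"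
    by (rule matinv_even[of m 0]) blast
  have "(\<Sum>p = 1..m. cgen m a p * yel m p l) =
      (\<Sum>p = 1..m. \<Sum>q = 1..m. cgen m a p * of_even (N p q) * cgen m q l)"
    unfolding yel_def sum_distrib_left by (intro sum.cong refl) (simp add: N(1) mult.assoc)
  also have "\<dots> = (\<Sum>q = 1..m. (\<Sum>p = 1..m. cgen m a p * of_even (N p q)) * cgen m q l)"
    unfolding sum_distrib_right by (rule sum.swap)
  also have "\<dots> = (\<Sum>q = 1..m. if a = q then cgen m q l else 0)"
    by (intro sum.cong refl) (simp add: N(2)[OF assms] del: One_nat_def)
  also have "\<dots> = cgen m a l" using assms by simp
  finally show ?thesis .
qed

lemma cgen_cancel:
  fixes z z' :: "nat \<Rightarrow> 'k::field salg"
  assumes "\<And>a. a \<in> {1..m} \<Longrightarrow> (\<Sum>p = 1..m. cgen m a p * z p) = (\<Sum>p = 1..m. cgen m a p * z' p)"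
    and "k \<in> {1..m}"
  shows "z k = z' k"
proof -
  obtain N :: "nat \<Rightarrow> nat \<Rightarrow> 'k even_alg" where
    N: "\<And>a b. a \<in> {1..m} \<Longrightarrow> b \<in> {1..m} \<Longrightarrow>
      (\<Sum>r = 1..m. of_even (N a r) * cgen m r b) = (if a = b then 1 else 0)"
    by (rule matinv_even[of m 0]) blast
  have "z k = (\<Sum>a = 1..m. of_even (N k a) * (\<Sum>p = 1..m. cgen m a p * z' p))"
    by (rule matrix_solve[where A = "cgen m"]) (use N assms in auto)
  also have "\<dots> = z' k"
    by (rule matrix_solve[where A = "cgen m", symmetric]) (use N assms in auto)
  finally show ?thesis .
qed

lemma Kmn_yel:
  assumes "k \<in> {1..m}" "l \<in> {1..m + n}"
  shows "yel m k l \<in> (Kmn m n :: 'k::field salg set)"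
proof -
  obtain N :: "nat \<Rightarrow> nat \<Rightarrow> 'k even_alg" where
    N: "\<And>a b. a \<in> {1..m} \<Longrightarrow> b \<in> {1..m} \<Longrightarrow> matinv m (cgen m) a b = of_even (N a b)"
    "\<And>a b. a \<in> {1..m} \<Longrightarrow> b \<in> {1..m} \<Longrightarrow> of_even (N a b) \<in> Kmn m n"
    by (rule matinv_even[of m n]) blast
  show ?thesis unfolding yel_def
    by (intro Kmn_sum Kmn_mult Kmn_cgen) (use N assms in auto)
qed

lemma phic_yel: "phic m i j = cgen m i j - (\<Sum>p = 1..m. cgen m i p * yel m p j)"
  by (simp add: phic_def yel_def sum_distrib_left mult.assoc)

lemma Kmn_phic:
  assumes "i \<in> {1..m + n}" "j \<in> {1..m + n}"
  shows "phic m i j \<in> Kmn m n"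
  unfolding phic_yel by (intro Kmn_diff Kmn_sum Kmn_mult Kmn_cgen Kmn_yel) (use assms in auto)

lemma phic_even:
  assumes "m < i" "m < j"
  shows "phic m i j \<in> (range of_even :: 'k::field salg set)"
proof -
  obtain N :: "nat \<Rightarrow> nat \<Rightarrow> 'k even_alg" where
    N: "\<And>a b. a \<in> {1..m} \<Longrightarrow> b \<in> {1..m} \<Longrightarrow> matinv m (cgen m) a b = of_even (N a b)"
    by (rule matinv_even[of m 0]) blast
  show ?thesis unfolding phic_def
  proof (intro range_of_even_diff range_of_even_sum cgen_even)
    fix p q assume "p \<in> {1..m}" "q \<in> {1..m}"
    then show "cgen m i p * matinv m (cgen m) p q * cgen m q j \<in> (range of_even :: 'k salg set)"
      using assms odd_even_odd[of "prod_encode (i, p)" "N p q" "prod_encode (q, j)"]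
      by (simp add: N cgen_def oddvar_def)
  qed (use assms in auto)
qed

text \<open>
  The correction term \<open>C\<^sub>2\<^sub>1 Y\<close> has no constant term, its first factors being odd.
\<close>

lemma phic_body:
  assumes "m < i" "m < j"
  shows "gcoeff (phic m i j) {} = gcoeff (cgen m i j :: 'k::field salg) {}"
proof -
  have minus: "gcoeff (x - y) {} = gcoeff x {} - gcoeff (y :: 'k salg) {}" for x y
    by (simp only: diff_conv_add_uminus plus_grassmann.rep_eq uminus_grassmann.rep_eq)
  have sum: "gcoeff (sum f A) {} = (\<Sum>p\<in>A. gcoeff (f p :: 'k salg) {})" for f and A :: "nat set"
    by (induction A rule: infinite_finite_induct) (simp_all add: zero_grassmann.rep_eq plus_grassmann.rep_eq)
  have "gcoeff (cgen m i p :: 'k salg) {} = 0" if "p \<in> {1..m}" for p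
    using that assms by (simp add: cgen_def oddvar_def gcoeff_ggen)
  then show ?thesis by (simp add: phic_yel minus sum gcoeff_mult_empty)
qed

lemma of_even_even_phi: "1 \<le> a \<Longrightarrow> 1 \<le> b \<Longrightarrow> of_even (even_phi m a b) = phic m (m + a) (m + b)"
  unfolding even_phi_def by (intro of_even_to_even phic_even) auto

text \<open>
  Up to nilpotents \<open>\<phi>(C\<^sub>2\<^sub>2)\<close> is the generic matrix \<open>C\<^sub>2\<^sub>2\<close>.
\<close>

lemma even_phi_minor_unit:
  assumes "s \<le> n"
  shows "\<exists>y. ldet s (even_phi m) * y = 1 \<and> of_even y \<in> (Kmn m n :: 'k::field salg set)"
proof (rule Kmn_unit)
  have "of_even (ldet s (even_phi m)) = (ldet s (\<lambda>a b. phic m (m + a) (m + b)) :: 'k salg)"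
    unfolding of_even_ldet using assms by (intro ldet_cong) (simp add: of_even_even_phi)
  also have "\<dots> \<in> Kmn m n" using assms by (intro Kmn_ldet Kmn_phic) auto
  finally show "of_even (ldet s (even_phi m)) \<in> (Kmn m n :: 'k salg set)" .
  have "body (ldet s (even_phi m)) = (ldet s (\<lambda>a b. Fraction_Field.Fract
     (Poly_Mapping.single (Poly_Mapping.single (prod_encode (m + a, m + b)) 1) 1 :: 'k cpoly) 1))"
    unfolding body_ldet using assms
    by (intro ldet_cong) (simp add: body_def of_even_even_phi phic_body body_generic)
  then show "body (ldet s (even_phi m) :: 'k even_alg) \<noteq> 0" using generic_block_nonzero[of s m] by simp
qed

lemma Dplus_of_even:
  assumes "length is \<le> m" "set is \<subseteq> {1..m}"
  shows "Dplus m is = of_even (top_minor (even_c m) is)"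
proof -
  have "is ! (b - 1) \<le> m" if "b \<in> {1..length is}" for b
    using that assms(2) nth_mem[of "b - 1" "is"] by (auto simp: subset_iff)
  then show ?thesis
    unfolding Dplus_def top_minor_def of_even_ldet using assms(1)
    by (intro ldet_cong) (simp add: of_even_even_c)
qed

lemma Dminus_of_even:
  assumes "0 \<notin> set js"
  shows "Dminus m (map ((+) m) js) = of_even (top_minor (even_phi m) js)"
proof -
  have *: "1 \<le> js ! (b - 1)" "map ((+) m) js ! (b - 1) = m + js ! (b - 1)" if "b \<in> {1..length js}" for b
  proof -
    have "js ! (b - 1) \<in> set js" using that by auto
    then have "js ! (b - 1) \<noteq> 0" using assms by metis
    then show "1 \<le> js ! (b - 1)" by simp
    show "map ((+) m) js ! (b - 1) = m + js ! (b - 1)" using that by auto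
  qed
  show ?thesis
    unfolding Dminus_def top_minor_def of_even_ldet length_map
    by (intro ldet_cong) (simp add: of_even_even_phi * del: One_nat_def)
qed

lemma map_plus_upt: "map ((+) m) [a..<b] = [m + a..<m + b]"
  by (rule nth_equalityI) auto

lemma Dplus_leading: "i \<le> m \<Longrightarrow> Dplus m [1..<i + 1] = of_even (ldet i (even_c m))"
  unfolding top_minor_upt[symmetric] by (rule Dplus_of_even) auto

lemma Dminus_leading: "Dminus m [m + 1..<m + j + 1] = of_even (ldet j (even_phi m))"
  unfolding top_minor_upt[symmetric] using Dminus_of_even[of "[1..<j + 1]" m]
  by (simp only: map_plus_upt add.assoc) auto

section \<open>The derivations on \<open>Y\<close>, on \<open>\<phi>(C\<^sub>2\<^sub>2)\<close> and on minors\<close>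

lemma evder_0: "evder N i j 0 = 0"
  using evder_add[of N i j 0 0] by simp

lemma evder_uminus: "evder N i j (- x) = - evder N i j x"
  using evder_add[of N i j x "- x"] by (simp add: evder_0 add_eq_0_iff)

lemma evder_diff: "evder N i j (x - y) = evder N i j x - evder N i j y"
  by (simp only: diff_conv_add_uminus evder_add evder_uminus)

lemma evder_sum: "evder N i j (sum f A) = (\<Sum>a\<in>A. evder N i j (f a))"
  by (induction A rule: infinite_finite_induct) (simp_all add: evder_0 evder_add)

lemma evder_1: "evder N i j 1 = 0"
  using evder_mult[of N i j 1 1] by simp

lemma evder_of_int: "evder N i j (of_int c) = 0"
proof -
  have "evder N i j (of_nat k) = 0" for k by (induction k) (simp_all add: evder_0 evder_1 evder_add)
  then show ?thesis by (cases c rule: int_cases2) (simp_all add: evder_uminus)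
qed

lemma evder_minus_one_power: "evder N i j ((- 1) ^ e * x) = (- 1) ^ e * evder N i j x"
  by (cases "even e") (simp_all add: evder_uminus)

lemma evder_prod_list:
  "evder N i j (prod_list (map f [a..<b])) =
    (\<Sum>c\<in>{a..<b}. prod_list (map (\<lambda>x. if x = c then evder N i j (f x) else f x) [a..<b]))"
proof (induction b)
  case 0
  then show ?case by (simp add: evder_1)
next
  case (Suc b)
  show ?case
  proof (cases "a \<le> b")
    case True
    have 1: "map (\<lambda>x. if x = c then evder N i j (f x) else f x) [a..<Suc b] =
        map (\<lambda>x. if x = c then evder N i j (f x) else f x) [a..<b] @ [f b]" if "c \<in> {a..<b}" for c
      using that True by simp
    have 2: "map (\<lambda>x. if x = b then evder N i j (f x) else f x) [a..<Suc b] =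
        map f [a..<b] @ [evder N i j (f b)]" using True by simp
    show ?thesis
      using True by (simp add: 1 2 evder_mult Suc.IH sum.atLeastLessThan_Suc sum_distrib_right
        del: upt_Suc cong: sum.cong) (simp add: evder_mult Suc.IH sum_distrib_right)
  qed (simp add: evder_1)
qed

lemma evder_ldet:
  "evder N i j (ldet s M) = (\<Sum>c = 1..s. ldet s (\<lambda>a b. if b = c then evder N i j (M a b) else M a b))"
proof -
  have "evder N i j (ldet s M) = (\<Sum>p | p permutes {1..s}. of_int (sign p) *
      (\<Sum>a\<in>{1..<Suc s}. prod_list (map (\<lambda>x. if x = a then evder N i j (M x (p x)) else M x (p x)) [1..<Suc s])))"
    unfolding ldet_def evder_sum evder_mult evder_of_int evder_prod_list by (simp del: upt_Suc)
  also have "\<dots> = (\<Sum>p | p permutes {1..s}. \<Sum>c\<in>{1..s}. of_int (sign p) *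
      prod_list (map (\<lambda>x. if p x = c then evder N i j (M x (p x)) else M x (p x)) [1..<Suc s]))"
  proof (rule sum.cong[OF refl])
    fix p assume "p \<in> {p. p permutes {1..s}}"
    then have p: "p permutes {1..s}" by simp
    have "(\<Sum>c\<in>{1..s}. prod_list (map (\<lambda>x. if p x = c then evder N i j (M x (p x)) else M x (p x)) [1..<Suc s])) =
        (\<Sum>a\<in>{1..s}. prod_list (map (\<lambda>x. if p x = p a then evder N i j (M x (p x)) else M x (p x)) [1..<Suc s]))"
      by (subst sum.permute[OF p]) (simp add: o_def)
    also have "\<dots> = (\<Sum>a\<in>{1..<Suc s}. prod_list (map (\<lambda>x. if x = a then evder N i j (M x (p x)) else M x (p x)) [1..<Suc s]))"
      using permutes_inj[OF p] by (simp add: inj_eq atLeastLessThanSuc_atLeastAtMost del: upt_Suc)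
    finally show "of_int (sign p) *
      (\<Sum>a\<in>{1..<Suc s}. prod_list (map (\<lambda>x. if x = a then evder N i j (M x (p x)) else M x (p x)) [1..<Suc s])) =
      (\<Sum>c\<in>{1..s}. of_int (sign p) *
      prod_list (map (\<lambda>x. if p x = c then evder N i j (M x (p x)) else M x (p x)) [1..<Suc s]))"
      unfolding sum_distrib_left[symmetric] by (simp only:)
  qed
  also have "\<dots> = (\<Sum>c = 1..s. ldet s (\<lambda>a b. if b = c then evder N i j (M a b) else M a b))"
    unfolding ldet_def by (rule sum.swap)
  finally show ?thesis .
qed

lemma ldet_zero_column:
  assumes "c \<in> {1..s}" "\<And>a. a \<in> {1..s} \<Longrightarrow> M a c = 0"
  shows "ldet s M = (0 :: 'a::ring_1)"
  unfolding ldet_def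
proof (rule sum.neutral, rule ballI)
  fix p assume "p \<in> {p. p permutes {1..s}}"
  then have p: "p permutes {1..s}" by simp
  obtain a where a: "a \<in> {1..s}" "p a = c" using permutes_image[OF p] assms(1) by (metis imageE)
  have zero: "prod_list xs = (0 :: 'a)" if "0 \<in> set xs" for xs
    using that by (induction xs) auto
  have "0 \<in> set (map (\<lambda>a. M a (p a)) [1..<Suc s])"
    using a assms(2)[of a] by (force simp: image_iff simp del: upt_Suc)
  then show "of_int (sign p) * prod_list (map (\<lambda>a. M a (p a)) [1..<Suc s]) = 0"
    using zero by simp
qed

text \<open>
  A derivation acts on a determinant column by column. When the derivation replaces the column with
  label \<open>i'\<close> by the column with label \<open>j'\<close> and kills all others, at most one summand survives.
\<close>

lemma evder_top_minor:
  assumes F: "\<And>a l. a \<in> {1..length is} \<Longrightarrow> l \<in> set is \<Longrightarrow>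
      evder N i j (F a l) = (if l = i' then F a j' else 0)"
    and "distinct is"
  shows "evder N i j (top_minor F is) =
    (if i' \<in> set is then top_minor (\<lambda>a l. F a (if l = i' then j' else l)) is else 0)"
proof -
  let ?s = "length is"
  define T where "T = (\<lambda>c. ldet ?s (\<lambda>a b. if b = c then evder N i j (F a (is ! (b - 1))) else F a (is ! (b - 1))))"
  have mem: "is ! (c - 1) \<in> set is" if "c \<in> {1..?s}" for c using that by auto
  have zero: "T c = 0" if c: "c \<in> {1..?s}" "is ! (c - 1) \<noteq> i'" for c
    unfolding T_def by (rule ldet_zero_column[OF c(1)]) (use c mem[OF c(1)] F in simp)
  have exp: "evder N i j (top_minor F is) = (\<Sum>c = 1..?s. T c)"
    unfolding top_minor_def T_def by (rule evder_ldet)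
  show ?thesis
  proof (cases "i' \<in> set is")
    case True
    then obtain k where k: "k < ?s" "is ! k = i'" unfolding in_set_conv_nth by blast
    have uniq: "is ! (c - 1) = i' \<longleftrightarrow> c = Suc k" if "c \<in> {1..?s}" for c
    proof -
      have "c - 1 < ?s" "c - 1 = k \<longleftrightarrow> c = Suc k" using that by auto
      then show ?thesis using nth_eq_iff_index_eq[OF assms(2) _ k(1), of "c - 1"] k(2) by metis
    qed
    have "(\<Sum>c = 1..?s. T c) = (\<Sum>c\<in>{Suc k}. T c)"
    proof (rule sum.mono_neutral_right)
      show "\<forall>c\<in>{1..?s} - {Suc k}. T c = 0"
      proof
        fix c assume c: "c \<in> {1..?s} - {Suc k}"
        then have "is ! (c - 1) \<noteq> i'" using uniq[of c] by simp
        with c show "T c = 0" by (intro zero) auto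
      qed
    qed (use k in auto)
    also have "\<dots> = T (Suc k)" by simp
    also have "\<dots> = top_minor (\<lambda>a l. F a (if l = i' then j' else l)) is"
      unfolding top_minor_def T_def
    proof (rule ldet_cong)
      fix a c assume "a \<in> {1..?s}" "c \<in> {1..?s}"
      then show "(if c = Suc k then evder N i j (F a (is ! (c - 1))) else F a (is ! (c - 1))) =
          F a (if is ! (c - 1) = i' then j' else is ! (c - 1))"
        using uniq[of c] F[of a "is ! (c - 1)"] mem[of c] by (cases "c = Suc k") simp_all
    qed
    finally show ?thesis unfolding exp using True by (simp only: if_True)
  next
    case False
    have "(\<Sum>c = 1..?s. T c) = 0"
    proof (intro sum.neutral ballI zero)
      fix c assume "c \<in> {1..?s}"
      then show "is ! (c - 1) \<noteq> i'" using mem[of c] False by metis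
    qed
    then show ?thesis unfolding exp using False by (simp only: if_False)
  qed
qed

lemma evder_top_minor_zero:
  assumes "\<And>a l. a \<in> {1..length is} \<Longrightarrow> l \<in> set is \<Longrightarrow> evder N i j (F a l) = 0"
  shows "evder N i j (top_minor F is) = 0"
  unfolding top_minor_def evder_ldet
  by (intro sum.neutral ballI, rule ldet_zero_column) (use assms in auto)

lemma evder_cgen:
  assumes "k \<in> {1..m + n}" "(i \<le> m) = (j \<le> m)"
  shows "evder (m + n) i j (cgen m k l) = (if l = i then cgen m k j else 0)"
  using assms by (auto simp: cgen_def evder_evvar evder_oddvar)

text \<open>
  Differentiate \<open>C\<^sub>1\<^sub>1 Y = C\<^sub>1\<^sub>2\<close> and cancel \<open>C\<^sub>1\<^sub>1\<close>: the derivation acts on \<open>Y\<close> by the negative of the dual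
  substitution, on the row indices.
\<close>

lemma evder_yel_plus:
  assumes ij: "i \<in> {1..m}" "j \<in> {1..m}" and k: "k \<in> {1..m}" and l: "m < l"
  shows "evder (m + n) i j (yel m k l) = (if k = j then - yel m i l else 0 :: 'k::field salg)"
proof (rule cgen_cancel[OF _ k, of "\<lambda>k. evder (m + n) i j (yel m k l)" "\<lambda>k. if k = j then - yel m i l else 0"])
  fix a assume a: "a \<in> {1..m}"
  let ?E = "evder (m + n) i j :: 'k salg \<Rightarrow> 'k salg"
  have E: "?E (cgen m a p) = (if p = i then cgen m a j else 0)" for p
    by (rule evder_cgen) (use a ij in auto)
  have "0 = ?E (cgen m a l)" using E l ij by auto
  also have "cgen m a l = (\<Sum>p = 1..m. cgen m a p * yel m p l)" by (rule yel_equation[OF a, symmetric])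
  also have "?E \<dots> = (\<Sum>p = 1..m. if p = i then cgen m a j * yel m p l else 0) + (\<Sum>p = 1..m. cgen m a p * ?E (yel m p l))"
    unfolding evder_sum evder_mult E sum.distrib[symmetric] by (intro sum.cong refl) simp
  also have "(\<Sum>p = 1..m. if p = i then cgen m a j * yel m p l else 0) = cgen m a j * yel m i l"
    using ij by simp
  finally have "(\<Sum>p = 1..m. cgen m a p * ?E (yel m p l)) = - (cgen m a j * yel m i l)"
    by (simp add: eq_neg_iff_add_eq_0 add.commute)
  also have "\<dots> = (\<Sum>p = 1..m. if p = j then - (cgen m a p * yel m i l) else 0)"
    using ij by simp
  also have "\<dots> = (\<Sum>p = 1..m. cgen m a p * (if p = j then - yel m i l else 0))"
    by (intro sum.cong refl) simp
  finally show "(\<Sum>p = 1..m. cgen m a p * ?E (yel m p l)) = \<dots>" .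
qed

lemma evder_yel_minus:
  assumes ij: "m < i" "m < j" and k: "k \<in> {1..m}"
  shows "evder (m + n) i j (yel m k l) = (if l = i then yel m k j else 0 :: 'k::field salg)"
proof (rule cgen_cancel[OF _ k, of "\<lambda>k. evder (m + n) i j (yel m k l)" "\<lambda>k. if l = i then yel m k j else 0"])
  fix a assume a: "a \<in> {1..m}"
  let ?E = "evder (m + n) i j :: 'k salg \<Rightarrow> 'k salg"
  have E: "?E (cgen m a p) = (if p = i then cgen m a j else 0)" for p
    by (rule evder_cgen) (use a ij in auto)
  have "(\<Sum>p = 1..m. cgen m a p * ?E (yel m p l)) = ?E (\<Sum>p = 1..m. cgen m a p * yel m p l)"
    unfolding evder_sum evder_mult E using ij by (intro sum.cong refl) auto
  also have "\<dots> = (if l = i then cgen m a j else 0)" unfolding yel_equation[OF a] E ..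
  also have "\<dots> = (\<Sum>p = 1..m. cgen m a p * (if l = i then yel m p j else 0))"
    by (simp add: yel_equation[OF a] del: One_nat_def)
  finally show "(\<Sum>p = 1..m. cgen m a p * ?E (yel m p l)) = \<dots>" .
qed

text \<open>
  The two terms of the derivative of \<open>C\<^sub>2\<^sub>1 Y\<close> cancel: \<open>\<phi>(C\<^sub>2\<^sub>2)\<close> is invariant under \<open>GL(m)\<close>.
\<close>

lemma evder_phic_plus:
  assumes ij: "i \<in> {1..m}" "j \<in> {1..m}" and k: "k \<in> {1..m + n}" and l: "m < l"
  shows "evder (m + n) i j (phic m k l) = (0 :: 'k::field salg)"
proof -
  let ?E = "evder (m + n) i j :: 'k salg \<Rightarrow> 'k salg"
  have E: "?E (cgen m k p) = (if p = i then cgen m k j else 0)" for p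
    by (rule evder_cgen) (use k ij in auto)
  have "?E (\<Sum>p = 1..m. cgen m k p * yel m p l) =
      (\<Sum>p = 1..m. (if p = i then cgen m k j * yel m p l else 0) + (if p = j then - (cgen m k p * yel m i l) else 0))"
    unfolding evder_sum evder_mult E
    by (intro sum.cong refl) (simp add: evder_yel_plus[OF ij _ l])
  also have "\<dots> = 0" using ij by (simp add: sum.distrib)
  finally show ?thesis using l ij by (auto simp: phic_yel evder_diff E)
qed

lemma evder_phic_minus:
  assumes ij: "m < i" "m < j" and k: "k \<in> {1..m + n}"
  shows "evder (m + n) i j (phic m k l) = (if l = i then phic m k j else 0 :: 'k::field salg)"
proof -
  let ?E = "evder (m + n) i j :: 'k salg \<Rightarrow> 'k salg"
  have E: "?E (cgen m k p) = (if p = i then cgen m k j else 0)" for p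
    by (rule evder_cgen) (use k ij in auto)
  have "?E (\<Sum>p = 1..m. cgen m k p * yel m p l) = (\<Sum>p = 1..m. cgen m k p * (if l = i then yel m p j else 0))"
    unfolding evder_sum evder_mult E using ij by (intro sum.cong refl) (auto simp: evder_yel_minus)
  then show ?thesis by (simp add: phic_yel evder_diff E)
qed

text \<open>
  If \<open>i\<close> is one of the first \<open>i' - 1\<close> columns and \<open>j < i\<close>, the substitution repeats the column \<open>j\<close>, and the
  determinant vanishes. So for \<open>j < i\<close> only the last column \<open>r\<close> matters; this is the term that will
  cancel against the action on \<open>y\<^bsub>r,m+s\<^esub>\<close>.
\<close>

lemma evder_next_minor:
  assumes ij: "i \<in> {1..m}" "j \<in> {1..i}" and i': "i' \<in> {1..m}" and r: "r \<in> {1..m}"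
  shows "evder (m + n) i j (of_even (next_minor (even_c m) i' r)) =
    (of_even ((if i = j \<and> i < i' then next_minor (even_c m) i' r else 0) +
      (if r = i then next_minor (even_c m) i' j else 0)) :: 'k::field salg)"
proof (cases "r < i'")
  case True
  then show ?thesis using ij r by (auto simp: next_minor_less evder_0)
next
  case False
  let ?is = "[1..<i'] @ [r]" and ?C = "even_c m :: nat \<Rightarrow> nat \<Rightarrow> 'k even_alg"
  have "evder (m + n) i j (of_even (next_minor ?C i' r)) =
      (if i \<in> set ?is then top_minor (\<lambda>a l. of_even (?C a (if l = i then j else l))) ?is else 0)"
    unfolding next_minor_def of_even_top_minor
  proof (rule evder_top_minor)
    fix a l assume "a \<in> {1..length ?is}" "l \<in> set ?is"
    then have "a \<in> {1..m}" "l \<in> {1..m}" using i' r by auto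
    then show "evder (m + n) i j (of_even (?C a l)) = (if l = i then of_even (?C a j) else 0)"
      using ij evder_cgen[of a m n i j l] by (auto simp: of_even_even_c)
  qed (use False in auto)
  also have "top_minor (\<lambda>a l. of_even (?C a (if l = i then j else l))) ?is =
      of_even (top_minor (\<lambda>a l. ?C a (if l = i then j else l)) ?is)"
    by (simp only: of_even_top_minor)
  also have "top_minor (\<lambda>a l. ?C a (if l = i then j else l)) ?is = top_minor ?C (map (\<lambda>l. if l = i then j else l) ?is)"
    unfolding top_minor_def length_map by (rule ldet_cong, subst nth_map) (auto simp del: upt_Suc)
  also have "map (\<lambda>l. if l = i then j else l) ?is =
      (if i < i' then map (\<lambda>l. if l = i then j else l) ?is else [1..<i'] @ [if r = i then j else r])"
    by (auto intro!: map_idI)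
  finally have main: "evder (m + n) i j (of_even (next_minor ?C i' r)) = (if i \<in> set ?is then
      of_even (top_minor ?C (if i < i' then map (\<lambda>l. if l = i then j else l) ?is else [1..<i'] @ [if r = i then j else r])) else 0)" .
  show ?thesis
  proof (cases "i = j")
    case True
    have "map (\<lambda>l. if l = j then j else l) ?is = ?is" by (rule map_idI) simp
    then show ?thesis using main True ij False by (auto simp: next_minor_def)
  next
    case ne: False
    have "\<not> distinct (map (\<lambda>l. if l = i then j else l) ?is)" if "i < i'"
    proof
      assume "distinct (map (\<lambda>l. if l = i then j else l) ?is)"
      then have "inj_on (\<lambda>l. if l = i then j else l) (set ?is)" unfolding distinct_map by blast
      moreover have "i \<in> set ?is" "j \<in> set ?is" using that ij by auto
      ultimately have "i = j" using inj_onD[of "\<lambda>l. if l = i then j else l" "set ?is" i j] by simp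
      then show False using ne by simp
    qed
    then have "top_minor ?C (map (\<lambda>l. if l = i then j else l) ?is) = 0" if "i < i'"
      using that top_minor_not_distinct by blast
    then show ?thesis using main ne ij False by (auto simp: next_minor_def)
  qed
qed

text \<open>
  The counterpart for \<open>GL(n)\<close>. The cofactors transform dually to the columns, and their derivative
  cancels against the action on the column index of \<open>y\<^bsub>r,m+s\<^esub>\<close>. The value \<open>j' = n + 1\<close> is included because
  \<open>D\<^sup>-(m + 1, \<dots>, m + j)\<close> is the diagonal cofactor with index \<open>j + 1\<close>.
\<close>

lemma evder_row_cofactor:
  assumes ab: "a \<in> {1..n}" "b \<in> {1..a}" and j': "j' \<in> {1..n + 1}" and s: "1 \<le> s"
  shows "evder (m + n) (m + a) (m + b) (of_even (row_cofactor (even_phi m) j' s)) =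
    (of_even ((if a = b \<and> a \<le> j' then row_cofactor (even_phi m) j' s else 0) -
      (if s = b then row_cofactor (even_phi m) j' a else 0)) :: 'k::field salg)"
proof (cases "s \<le> j'")
  case False
  then show ?thesis using ab by (auto simp: row_cofactor_def evder_0)
next
  case sj: True
  let ?F = "even_phi m :: nat \<Rightarrow> nat \<Rightarrow> 'k even_alg" and ?is = "filter (\<lambda>x. x \<noteq> s) [1..<j' + 1]"
  have len: "length ?is = j' - 1"
    unfolding filter_neq_upt[OF s sj] using s sj by (simp del: upt_Suc)
  let ?E = "evder (m + n) (m + a) (m + b) :: 'k salg \<Rightarrow> 'k salg"
  let ?G = "\<lambda>x l. of_even (?F x l)" and ?F' = "\<lambda>x l. ?F x (if l = a then b else l)"
  have "?E (of_even (row_cofactor ?F j' s)) = (- 1) ^ (s + j') * ?E (top_minor ?G ?is)"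
    unfolding of_even_row_cofactor unfolding row_cofactor_top_minor[OF s sj] by (rule evder_minus_one_power)
  also have "?E (top_minor ?G ?is) =
      (if a \<in> set ?is then top_minor (\<lambda>x l. ?G x (if l = a then b else l)) ?is else 0)"
  proof (rule evder_top_minor)
    fix x l assume "x \<in> {1..length ?is}" "l \<in> set ?is"
    then have "1 \<le> x" "x \<le> n" "1 \<le> l" using len j' by auto
    then show "?E (?G x l) = (if l = a then ?G x b else 0)"
      using ab evder_phic_minus[of m "m + a" "m + b" "m + x" n "m + l"] by (auto simp: of_even_even_phi)
  qed simp
  also have "top_minor (\<lambda>x l. ?G x (if l = a then b else l)) ?is = of_even (top_minor ?F' ?is)"
    by (simp only: of_even_top_minor)
  also have "(- 1) ^ (s + j') * (if a \<in> set ?is then of_even (top_minor ?F' ?is) else 0) =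
      (if a \<in> set ?is then of_even (row_cofactor ?F' j' s) else 0)"
    unfolding row_cofactor_top_minor[OF s sj]
    by (cases "a \<in> set ?is") (simp_all only: if_True if_False mult_zero_right of_even_simps of_even_power)
  finally have main: "?E (of_even (row_cofactor ?F j' s)) = (if a \<in> set ?is then of_even (row_cofactor ?F' j' s) else 0)" .
  have mem: "a \<in> set ?is \<longleftrightarrow> a \<le> j' \<and> a \<noteq> s" using ab by auto
  show ?thesis
  proof (cases "a = b")
    case True
    then have "?F' = ?F" by auto
    then show ?thesis using main mem True sj by auto
  next
    case ne: False
    have "row_cofactor ?F' j' s = (if s = b then - row_cofactor ?F j' a else 0)" if "a \<le> j'" "a \<noteq> s"
      by (rule row_cofactor_replace_column) (use that ab ne s sj in auto)
    moreover have "row_cofactor ?F j' a = 0" if "\<not> a \<le> j'" using that by (simp add: row_cofactor_def)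
    ultimately show ?thesis using main mem ne by auto
  qed
qed

lemma evder_next_minor_zero:
  assumes ij: "m < i" "m < j" and i': "i' \<in> {1..m}" and r: "r \<in> {1..m}"
  shows "evder (m + n) i j (of_even (next_minor (even_c m) i' r)) = (0 :: 'k::field salg)"
  unfolding next_minor_def of_even_top_minor
proof (rule evder_top_minor_zero)
  fix a l assume "a \<in> {1..length ([1..<i'] @ [r])}" "l \<in> set ([1..<i'] @ [r])"
  then have "a \<in> {1..m}" "l \<in> {1..m}" using i' r by auto
  then show "evder (m + n) i j (of_even (even_c m a l)) = (0 :: 'k salg)"
    using ij evder_cgen[of a m n i j l] by (auto simp: of_even_even_c)
qed

lemma evder_row_cofactor_zero:
  assumes ij: "i \<in> {1..m}" "j \<in> {1..m}" and j': "j' \<in> {1..n + 1}" and s: "1 \<le> s"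
  shows "evder (m + n) i j (of_even (row_cofactor (even_phi m) j' s)) = (0 :: 'k::field salg)"
proof (cases "s \<le> j'")
  case False
  then show ?thesis by (auto simp: row_cofactor_def evder_0)
next
  case True
  let ?is = "filter (\<lambda>x. x \<noteq> s) [1..<j' + 1]"
  have len: "length ?is = j' - 1"
    unfolding filter_neq_upt[OF s True] using s True by (simp del: upt_Suc)
  have "evder (m + n) i j (top_minor (\<lambda>a b. of_even (even_phi m a b)) ?is) = (0 :: 'k salg)"
  proof (rule evder_top_minor_zero)
    fix x l assume "x \<in> {1..length ?is}" "l \<in> set ?is"
    then have "1 \<le> x" "x \<le> n" "1 \<le> l" using len j' by auto
    then show "evder (m + n) i j (of_even (even_phi m x l)) = (0 :: 'k salg)"
      using evder_phic_plus[OF ij, of "m + x" n "m + l"] by (simp add: of_even_even_phi)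
  qed
  then show ?thesis
    unfolding of_even_row_cofactor unfolding row_cofactor_top_minor[OF s True] by (simp only: evder_minus_one_power mult_zero_right)
qed

section \<open>Tensors and the Leibniz action\<close>

text \<open>
  Every tensor is a difference of sums of pure tensors.
\<close>

lemma tens_induct [case_names zero pure diff]:
  assumes "P 0" "\<And>a ys. P (tpure a ys)" "\<And>x y. P x \<Longrightarrow> P y \<Longrightarrow> P (x - y)"
  shows "P (w :: 'k::field tens)"
proof -
  have minus: "abs_tens (a - b) = abs_tens a - abs_tens b" for a b :: "'k salg \<times> 'k salg list \<Rightarrow>\<^sub>0 int"
    by (rule minus_tens.abs_eq[symmetric]; simp add: trel_def tnull.zero)
  have "P (abs_tens c)" for c
  proof (induction c rule: frag_ind)
    case zero
    then show ?case using assms(1) by (simp add: zero_tens_def)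
  next
    case (one p)
    then show ?case using assms(2)[of "fst p" "snd p"] by (simp add: tpure.abs_eq)
  next
    case (diff a b)
    then show ?case using assms(3) by (simp add: minus)
  qed
  then show ?thesis by (metis Quotient3_abs_rep Quotient3_tens)
qed

lemma tpure_0 [simp]: "tpure 0 ys = 0"
  using tpure_add_head[of 0 0 ys] by simp

lemma tpure_sum: "tpure (sum f A) ys = (\<Sum>i\<in>A. tpure (f i) ys)"
  by (induction A rule: infinite_finite_induct) (simp_all add: tpure_add_head)

lemma tpure_uminus: "tpure (- a) ys = - tpure a ys"
  using tpure_add_head[of a "- a" ys] by (simp add: eq_neg_iff_add_eq_0 add.commute)

lemma tpure_slot_add: "tpure a [x + y] = tpure a [x] + tpure a [y]"
  by transfer (use tnull.slot[of _ "[]" _ _ "[]"] in \<open>simp add: trel_def algebra_simps\<close>)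

lemma tpure_slot_0 [simp]: "tpure a [0] = 0"
  using tpure_slot_add[of a 0 0] by simp

lemma tpure_slot_uminus: "tpure a [- x] = - tpure a [x]"
  using tpure_slot_add[of a x "- x"] by (simp add: eq_neg_iff_add_eq_0 add.commute)

lemma tact_diff: "tact D (x - y) = tact D x - tact D y"
proof -
  have "tact D (x - y) + tact D y = tact D x" unfolding tact_add[symmetric] by simp
  then show ?thesis by (simp add: eq_diff_eq)
qed

lemma tact_sum: "tact D (sum f A) = (\<Sum>i\<in>A. tact D (f i))"
  by (induction A rule: infinite_finite_induct) (simp_all add: tact_zero tact_add)

lemma tcoeff_kconst_commute: "tcoeff (kconst c) * w = w * tcoeff (kconst c)"
  by (induction w rule: tens_induct) (simp_all add: tpure_mult kconst_commute algebra_simps)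

lemma tscale_mult_left: "tscale c x * y = tscale c (x * y)"
  by (simp add: tscale_def mult.assoc)

lemma tscale_mult_right: "x * tscale c y = tscale c (x * y)"
  unfolding tscale_def by (metis mult.assoc tcoeff_kconst_commute)

lemma tscale_tpure: "tscale c (tpure a ys) = tpure (kscale c a) ys"
  by (simp add: tscale_def kscale_def tpure_mult)

lemma tscale_sum: "tscale c (sum f A) = (\<Sum>i\<in>A. tscale c (f i))"
  unfolding tscale_def by (rule sum_distrib_left)

lemma tscale_0 [simp]: "tscale c 0 = 0" "tscale 0 w = 0"
  by (simp_all add: tscale_def kconst_0)

lemma tscale_1 [simp]: "tscale 1 w = w"
  by (simp add: tscale_def kconst_simps tcoeff_1)

lemma tscale_add_left: "tscale (a + b) w = tscale a w + tscale b w"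
  by (simp add: tscale_def kconst_simps tpure_add_head distrib_right)

text \<open>
  The product concatenates the slots, so the Leibniz action splits into the slots of either factor.
\<close>

lemma tact_mult:
  assumes lin: "Vector_Spaces.linear kscale kscale D"
    and leib: "\<And>x y. D (x * y) = D x * y + x * D y"
  shows "tact D (v * w) = tact D v * w + v * tact D w"
proof (induction v rule: tens_induct)
  case (pure a us)
  show ?case
  proof (induction w rule: tens_induct)
    case (pure b vs)
    let ?f = "\<lambda>l. tpure (a * b) ((us @ vs)[l := D ((us @ vs) ! l)])"
    have split: "sum f {..<p + q} = sum f {..<p} + (\<Sum>l<q. f (p + l))" for f :: "nat \<Rightarrow> 'a tens" and p q
      by (induction q) (simp_all add: add.assoc)
    have 1: "sum ?f {..<length us} = (\<Sum>l<length us. tpure a (us[l := D (us ! l)])) * tpure b vs"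
      unfolding sum_distrib_right
      by (intro sum.cong refl) (simp add: tpure_mult list_update_append nth_append)
    have 2: "(\<Sum>l<length vs. ?f (length us + l)) = tpure a us * (\<Sum>l<length vs. tpure b (vs[l := D (vs ! l)]))"
      unfolding sum_distrib_left
      by (intro sum.cong refl) (simp add: tpure_mult list_update_append nth_append)
    have "tact D (tpure a us * tpure b vs) =
        tpure (D a * b + a * D b) (us @ vs) + (sum ?f {..<length us} + (\<Sum>l<length vs. ?f (length us + l)))"
      by (simp add: tpure_mult tact_tpure[OF lin] leib split)
    also have "\<dots> = tact D (tpure a us) * tpure b vs + tpure a us * tact D (tpure b vs)"
      unfolding 1 2 by (simp add: tact_tpure[OF lin] tpure_mult tpure_add_head distrib_left distrib_right)
    finally show ?case .
  qed (simp_all add: tact_zero tact_diff right_diff_distrib)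
qed (simp_all add: tact_zero tact_diff left_diff_distrib)

text \<open>
  The index pairs of the derivations that span a Borel subalgebra of the Lie algebra of \<open>G\<^bsub>ev\<^esub>\<close>: the torus
  (\<open>i = j\<close>) and the operators that annihilate primitive vectors (\<open>j < i\<close>).
\<close>

definition borel_pair :: "nat \<Rightarrow> nat \<Rightarrow> nat \<Rightarrow> nat \<Rightarrow> bool" where
  "borel_pair m n i j \<longleftrightarrow> i \<in> {1..m + n} \<and> j \<in> {1..m + n} \<and> (i \<le> m) = (j \<le> m) \<and> j \<le> i"

lemma evder_linear:
  assumes "borel_pair m n i j"
  shows "Vector_Spaces.linear kscale kscale (evder (m + n) i j :: 'k::field salg \<Rightarrow> 'k salg)"
  using is_evder_evder[of i m n j, where 'k = 'k] assms by (simp add: borel_pair_def is_evder_def)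

definition tensor_eigen :: "('k::field salg \<Rightarrow> 'k salg) \<Rightarrow> int \<Rightarrow> 'k tens \<Rightarrow> bool" where
  "tensor_eigen E c w \<longleftrightarrow> tact E w = tscale (of_int c) w"

lemma tensor_eigen_mult:
  assumes "borel_pair m n i j" "tensor_eigen (evder (m + n) i j) c v" "tensor_eigen (evder (m + n) i j) d w"
  shows "tensor_eigen (evder (m + n) i j) (c + d) (v * w)"
  using assms(2,3) unfolding tensor_eigen_def
  by (simp add: tact_mult[OF evder_linear[OF assms(1)] evder_mult] tscale_mult_left tscale_mult_right
      tscale_add_left)

lemma tensor_eigen_scale:
  assumes "borel_pair m n i j" "tensor_eigen (evder (m + n) i j) c w"
  shows "tensor_eigen (evder (m + n) i j) c (tscale a w)"
proof -
  have "tensor_eigen (evder (m + n) i j) 0 (tcoeff (kconst a))"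
    by (simp add: tensor_eigen_def tact_tpure[OF evder_linear[OF assms(1)]] evder_kconst)
  from tensor_eigen_mult[OF assms(1) this assms(2)] show ?thesis by (simp add: tscale_def)
qed

lemma tensor_eigen_sum:
  assumes "\<And>x. x \<in> A \<Longrightarrow> tensor_eigen E c (f x)"
  shows "tensor_eigen E c (sum f A)"
  using assms by (simp add: tensor_eigen_def tact_sum tscale_sum)

definition scalar_eigen :: "('k::field salg \<Rightarrow> 'k salg) \<Rightarrow> int \<Rightarrow> 'k salg \<Rightarrow> bool" where
  "scalar_eigen E c x \<longleftrightarrow> E x = kscale (of_int c) x"

lemma kscale_add_left: "kscale (a + b) x = kscale a x + kscale b x"
  by (simp add: kscale_def kconst_simps distrib_right)

lemma kscale_uminus_left: "kscale (- a) x = - kscale a x"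
  by (simp add: kscale_def kconst_uminus)

lemma kscale_0_1 [simp]: "kscale 0 x = 0" "kscale 1 x = x"
  by (simp_all add: kscale_def kconst_0 kconst_simps)

lemma scalar_eigen_1: "scalar_eigen (evder N i j) 0 1"
  by (simp add: scalar_eigen_def evder_1)

lemma scalar_eigen_mult: "scalar_eigen (evder N i j) c x \<Longrightarrow> scalar_eigen (evder N i j) d y \<Longrightarrow> scalar_eigen (evder N i j) (c + d) (x * y)"
  by (simp add: scalar_eigen_def evder_mult kscale_mult_left kscale_mult_right kscale_add_left)

lemma scalar_eigen_inverse:
  assumes "scalar_eigen (evder N i j) c x" "x * y = 1" "y * x = 1"
  shows "scalar_eigen (evder N i j) (- c) y"
proof -
  have "kscale (of_int c) x * y + x * evder N i j y = 0"
    using evder_mult[of N i j x y] assms by (simp add: scalar_eigen_def evder_1)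
  then have "x * evder N i j y = - kscale (of_int c) 1"
    by (simp add: kscale_mult_left assms(2) add_eq_0_iff)
  then have "y * (x * evder N i j y) = kscale (- of_int c) y"
    by (simp add: kscale_mult_right kscale_uminus_left)
  then show ?thesis by (simp add: mult.assoc[symmetric] assms(3) scalar_eigen_def)
qed

lemma tensor_eigen_tcoeff:
  assumes "borel_pair m n i j" "scalar_eigen (evder (m + n) i j) c x"
  shows "tensor_eigen (evder (m + n) i j) c (tcoeff x)"
  using assms(2) by (simp add: tensor_eigen_def scalar_eigen_def tact_tpure[OF evder_linear[OF assms(1)]] tscale_tpure)

section \<open>The weight of \<open>\<rho>\<close>\<close>

text \<open>
  The summation ranges in the definition of \<open>\<rho>\<^bsub>i|j\<^esub>\<close> can be enlarged to all indices, since the added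
  coefficients vanish. Only over the full ranges is the sum visibly a contraction of dual bases.
\<close>

lemma rho_expansion:
  assumes i: "i \<in> {1..m}" and j: "j \<in> {1..n}"
  shows "rho m i j = (\<Sum>r = 1..m. \<Sum>s = 1..n.
    tpure (of_even (next_minor (even_c m) i r * row_cofactor (even_phi m) j s)) [yel m r (m + s)] :: 'k::field tens)"
proof -
  let ?t = "\<lambda>r s. tpure (of_even (next_minor (even_c m) i r * row_cofactor (even_phi m) j s)) [yel m r (m + s)] :: 'k tens"
  have "rho m i j = (\<Sum>r = i..m. \<Sum>s = 1..j. ?t r s)"
    unfolding rho_def
  proof (intro sum.cong refl)
    fix r s assume r: "r \<in> {i..m}" and s: "s \<in> {1..j}"
    have 1: "Dplus m ([1..<i] @ [r]) = (of_even (next_minor (even_c m) i r) :: 'k salg)"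
      unfolding next_minor_def by (rule Dplus_of_even) (use i r in auto)
    have "filter (\<lambda>x. x \<noteq> m + s) [m + 1..<m + j + 1] = map ((+) m) (filter (\<lambda>x. x \<noteq> s) [1..<j + 1])"
      using map_plus_upt[of m 1 "j + 1", symmetric] by (simp add: filter_map o_def del: upt_Suc)
    then have 2: "Dminus m (filter (\<lambda>x. x \<noteq> m + s) [m + 1..<m + j + 1]) =
        (of_even (top_minor (even_phi m) (filter (\<lambda>x. x \<noteq> s) [1..<j + 1])) :: 'k salg)"
      by (simp only:) (rule Dminus_of_even, auto)
    show "tpure (Dplus m ([1..<i] @ [r]) *
        ((- 1) ^ (s + j) * Dminus m (filter (\<lambda>x. x \<noteq> m + s) [m + 1..<m + j + 1]))) [yel m r (m + s)] = ?t r s"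
      unfolding 1 2 using row_cofactor_top_minor[of s j "even_phi m :: nat \<Rightarrow> nat \<Rightarrow> 'k even_alg"] s by (simp add: of_even_power del: upt_Suc)
  qed
  also have "\<dots> = (\<Sum>r = i..m. \<Sum>s = 1..n. ?t r s)"
    by (intro sum.cong refl sum.mono_neutral_left) (use j in \<open>auto simp: row_cofactor_def\<close>)
  also have "\<dots> = (\<Sum>r = 1..m. \<Sum>s = 1..n. ?t r s)"
    by (intro sum.mono_neutral_left) (use i in \<open>auto simp: next_minor_less intro!: sum.neutral\<close>)
  finally show ?thesis .
qed

text \<open>
  The weight of \<open>\<rho>\<^bsub>i'|j'\<^esub>\<close> is \<open>\<epsilon>\<^sub>1 + \<cdots> + \<epsilon>\<^bsub>i'-1\<^esub> + \<epsilon>\<^bsub>m+1\<^esub> + \<cdots> + \<epsilon>\<^bsub>m+j'\<^esub>\<close>; the value \<open>0\<close> for \<open>i \<noteq> j\<close> expresses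
  annihilation, which allows both cases to be treated together.
\<close>

definition rho_weight :: "nat \<Rightarrow> nat \<Rightarrow> nat \<Rightarrow> nat \<Rightarrow> nat \<Rightarrow> int" where
  "rho_weight m i j i' j' =
    (if i \<noteq> j then 0 else if i \<le> m then (if i < i' then 1 else 0) else if i \<le> m + j' then 1 else 0)"

text \<open>
  The coefficients and the elements \<open>y\<^bsub>r,m+s\<^esub>\<close> transform dually, so of the derivative of their contraction
  only the weight term is left. In either case the two \<open>?B\<close> terms below are the two halves of this
  cancellation.
\<close>

lemma tensor_eigen_rho:
  assumes blk: "borel_pair m n i j" and i': "i' \<in> {1..m}" and j': "j' \<in> {1..n}"
  shows "tensor_eigen (evder (m + n) i j) (rho_weight m i j i' j') (rho m i' j' :: 'k::field tens)"
proof -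
  let ?E = "evder (m + n) i j :: 'k salg \<Rightarrow> 'k salg"
  let ?M = "next_minor (even_c m) i' :: nat \<Rightarrow> 'k even_alg" and ?U = "row_cofactor (even_phi m) j' :: nat \<Rightarrow> 'k even_alg"
  let ?y = "\<lambda>r s. yel m r (m + s) :: 'k salg"
  let ?c = "rho_weight m i j i' j'"
  have E: "tact ?E (tpure a [y]) = tpure (?E a) [y] + tpure a [?E y]" for a y
    by (simp add: tact_tpure[OF evder_linear[OF blk]])
  have act: "tact ?E (rho m i' j') = (\<Sum>r = 1..m. \<Sum>s = 1..n.
      tpure (?E (of_even (?M r)) * of_even (?U s) + of_even (?M r) * ?E (of_even (?U s))) [?y r s] +
      tpure (of_even (?M r * ?U s)) [?E (?y r s)])"
    unfolding rho_expansion[OF i' j'] tact_sum E by (simp add: evder_mult)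
  have target: "tscale (of_int ?c) (rho m i' j') =
      (\<Sum>r = 1..m. \<Sum>s = 1..n. tscale (of_int ?c) (tpure (of_even (?M r * ?U s)) [?y r s]))"
    unfolding rho_expansion[OF i' j'] tscale_sum ..
  show ?thesis
  proof (cases "i \<le> m")
    case True
    then have ij: "i \<in> {1..m}" "j \<in> {1..m}" "j \<in> {1..i}" using blk by (auto simp: borel_pair_def)
    let ?A = "\<lambda>r s. tscale (of_int ?c) (tpure (of_even (?M r * ?U s)) [?y r s])"
    let ?B = "\<lambda>s. tpure (of_even (?M j * ?U s)) [?y i s]"
    have "tact ?E (rho m i' j') = (\<Sum>r = 1..m. \<Sum>s = 1..n.
        ?A r s + ((if r = i then ?B s else 0) - (if r = j then ?B s else 0)))"
      unfolding act
    proof (intro sum.cong refl)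
      fix r s assume r: "r \<in> {1..m}" and s: "s \<in> {1..n}"
      have "?E (of_even (?U s)) = 0" by (rule evder_row_cofactor_zero[OF ij(1,2)]) (use j' s in auto)
      moreover have "?E (?y r s) = (if r = j then - ?y i s else 0)"
        by (rule evder_yel_plus[OF ij(1,2) r]) (use s in auto)
      moreover have "?E (of_even (?M r)) = of_even ((if i = j \<and> i < i' then ?M r else 0) + (if r = i then ?M j else 0))"
        by (rule evder_next_minor[OF ij(1,3) i' r])
      ultimately show "tpure (?E (of_even (?M r)) * of_even (?U s) + of_even (?M r) * ?E (of_even (?U s))) [?y r s] +
          tpure (of_even (?M r * ?U s)) [?E (?y r s)] =
          ?A r s + ((if r = i then ?B s else 0) - (if r = j then ?B s else 0))"
        using True by (auto simp: rho_weight_def distrib_right tpure_add_head tpure_slot_uminus)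
    qed
    also have "\<dots> = (\<Sum>r = 1..m. \<Sum>s = 1..n. ?A r s) +
        ((\<Sum>r = 1..m. if r = i then (\<Sum>s = 1..n. ?B s) else 0) - (\<Sum>r = 1..m. if r = j then (\<Sum>s = 1..n. ?B s) else 0))"
      unfolding sum.distrib[symmetric] sum_subtractf[symmetric]
      by (intro sum.cong refl) (auto simp: sum.distrib sum_subtractf)
    also have "\<dots> = (\<Sum>r = 1..m. \<Sum>s = 1..n. ?A r s)"
      using ij by simp
    finally show ?thesis unfolding tensor_eigen_def target .
  next
    case False
    define a b where "a = i - m" and "b = j - m"
    have ab: "i = m + a" "j = m + b" "a \<in> {1..n}" "b \<in> {1..a}" "b \<in> {1..n}"
      using False blk by (auto simp: borel_pair_def a_def b_def)
    let ?A = "\<lambda>r s. tscale (of_int ?c) (tpure (of_even (?M r * ?U s)) [?y r s])"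
    let ?B = "\<lambda>r. tpure (of_even (?M r * ?U a)) [?y r b]"
    have "tact ?E (rho m i' j') = (\<Sum>r = 1..m. \<Sum>s = 1..n.
        ?A r s + ((if s = a then ?B r else 0) - (if s = b then ?B r else 0)))"
      unfolding act
    proof (intro sum.cong refl)
      fix r s assume r: "r \<in> {1..m}" and s: "s \<in> {1..n}"
      have "?E (of_even (?M r)) = 0" by (rule evder_next_minor_zero) (use ab i' r in auto)
      moreover have "?E (?y r s) = (if s = a then ?y r b else 0)"
        by (subst evder_yel_minus) (use ab r in auto)
      moreover have "?E (of_even (?U s)) = of_even ((if a = b \<and> a \<le> j' then ?U s else 0) - (if s = b then ?U a else 0))"
        unfolding ab(1,2) by (rule evder_row_cofactor[OF ab(3,4)]) (use j' s in auto)
      moreover have "tpure (x - z) ys = tpure x ys - tpure z ys" for x z :: "'k salg" and ys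
        unfolding diff_conv_add_uminus tpure_add_head tpure_uminus ..
      ultimately show "tpure (?E (of_even (?M r)) * of_even (?U s) + of_even (?M r) * ?E (of_even (?U s))) [?y r s] +
          tpure (of_even (?M r * ?U s)) [?E (?y r s)] =
          ?A r s + ((if s = a then ?B r else 0) - (if s = b then ?B r else 0))"
        using ab by (auto simp: rho_weight_def right_diff_distrib)
    qed
    also have "\<dots> = (\<Sum>r = 1..m. \<Sum>s = 1..n. ?A r s)"
      using ab by (simp add: sum.distrib sum_subtractf)
    finally show ?thesis unfolding tensor_eigen_def target .
  qed
qed

lemma tensor_eigen_rho_multi:
  assumes blk: "borel_pair m n i j" and "length K = length L" "set K \<subseteq> {1..m}" "set L \<subseteq> {1..n}"
  shows "tensor_eigen (evder (m + n) i j) (sum_list (map2 (rho_weight m i j) K L)) (rho_multi m K L :: 'k::field tens)"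
  using assms(2-)
proof (induction K L rule: list_induct2)
  case Nil
  have "tact (evder (m + n) i j) (1 :: 'k tens) = 0"
    unfolding tcoeff_1[symmetric] by (simp add: tact_tpure[OF evder_linear[OF blk]] evder_1)
  then show ?case by (simp add: rho_multi_def tensor_eigen_def)
next
  case (Cons k K l L)
  then show ?case
    using tensor_eigen_mult[OF blk tensor_eigen_rho[OF blk, of k l]] by (simp add: rho_multi_def)
qed

text \<open>
  For each fixed \<open>i\<close> the weight involves either only the indices in \<open>K\<close> or only those in \<open>L\<close>, so it is
  determined by the content.
\<close>

lemma rho_weight_sum_mset:
  assumes "length K = length L" "length K' = length L'" "mset K = mset K'" "mset L = mset L'"
  shows "sum_list (map2 (rho_weight m i j) K L) = sum_list (map2 (rho_weight m i j) K' L')"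
proof -
  have fst: "sum_list (map2 (\<lambda>x y. f x) K L) = sum_mset (image_mset f (mset K))"
    if "length K = length L" for f :: "nat \<Rightarrow> int" and K L :: "nat list"
    using that by (induction K L rule: list_induct2) simp_all
  have snd: "sum_list (map2 (\<lambda>x y. f y) K L) = sum_mset (image_mset f (mset L))"
    if "length K = length L" for f :: "nat \<Rightarrow> int" and K L :: "nat list"
    using that by (induction K L rule: list_induct2) simp_all
  have "rho_weight m i j = (\<lambda>x y. rho_weight m i j x 0) \<or> rho_weight m i j = (\<lambda>x y. rho_weight m i j 0 y)"
    by (cases "i \<le> m") (auto simp: rho_weight_def fun_eq_iff)
  then show ?thesis
  proof
    assume *: "rho_weight m i j = (\<lambda>x y. rho_weight m i j x 0)"
    show ?thesis by (subst (1 2) *) (simp only: fst[OF assms(1)] fst[OF assms(2)] assms(3))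
  next
    assume *: "rho_weight m i j = (\<lambda>x y. rho_weight m i j 0 y)"
    show ?thesis by (subst (1 2) *) (simp only: snd[OF assms(1)] snd[OF assms(2)] assms(4))
  qed
qed

lemma rho_weight_sum_0:
  assumes "i \<noteq> j"
  shows "sum_list (map2 (rho_weight m i j) K L) = 0"
proof -
  have "rho_weight m i j = (\<lambda>_ _. 0)" using assms by (simp add: rho_weight_def fun_eq_iff)
  then show ?thesis by (induction K L rule: list_induct2') simp_all
qed

section \<open>The weight of \<open>v\<^bsub>I|J\<^esub>\<close>\<close>

text \<open>
  The numerator \<open>v\<close> and the denominator of \<open>v\<^bsub>I|J\<^esub>\<close> in the commutative ring.
\<close>

definition hw_even :: "nat \<Rightarrow> nat \<Rightarrow> (nat \<Rightarrow> nat) \<Rightarrow> 'k::field even_alg" where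
  "hw_even m n lam =
    (\<Prod>a = 1..m. ldet a (even_c m) ^ (lamplus m lam a - lamplus m lam (a + 1))) *
    (\<Prod>b = 1..n. ldet b (even_phi m) ^ (lamminus m n lam b - lamminus m n lam (b + 1)))"

definition den_even :: "nat \<Rightarrow> nat list \<Rightarrow> nat list \<Rightarrow> 'k::field even_alg" where
  "den_even m I J = prod_list (map (\<lambda>i. ldet i (even_c m)) I) * prod_list (map (\<lambda>j. ldet (j - 1) (even_phi m)) J)"

lemma hwvec_even: "hwvec m n lam = (of_even (hw_even m n lam) :: 'a::field salg)"
proof -
  have D: "Dplus m [Suc 0..<Suc a] = (of_even (ldet a (even_c m)) :: 'a salg)" if "a \<le> m" for a
    using Dplus_leading[OF that, where 'a = 'a] by (simp del: upt_Suc)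
  have 1: "prod_list (map (\<lambda>a. Dplus m [1..<a + 1] ^ e a) [1..<m + 1]) = (of_even (\<Prod>a = 1..m. ldet a (even_c m) ^ e a) :: 'a salg)" for e
    unfolding atLeastLessThanSuc_atLeastAtMost[symmetric] prod_list_upt[symmetric] of_even_prod_list map_map o_def of_even_power
    by (intro arg_cong[of _ _ prod_list] map_cong) (auto simp: D simp del: upt_Suc)
  have 2: "prod_list (map (\<lambda>b. Dminus m [m + 1..<m + b + 1] ^ e b) [1..<n + 1]) = (of_even (\<Prod>b = 1..n. ldet b (even_phi m) ^ e b) :: 'a salg)" for e
    unfolding atLeastLessThanSuc_atLeastAtMost[symmetric] prod_list_upt[symmetric] of_even_prod_list map_map o_def of_even_power
      Dminus_leading by simp
  show ?thesis unfolding hwvec_def hw_even_def 1 2 by simp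
qed

lemma den_even_unit:
  assumes "set I \<subseteq> {1..m}" "set J \<subseteq> {1..n}"
  shows "\<exists>P. den_even m I J * P = 1 \<and> of_even P \<in> (Kmn m n :: 'k::field salg set)"
proof -
  have units: "\<exists>P. prod_list (map f xs) * P = 1 \<and> of_even P \<in> Kmn m n"
    if "\<And>x. x \<in> set xs \<Longrightarrow> \<exists>P. f x * P = 1 \<and> of_even P \<in> Kmn m n" for f :: "nat \<Rightarrow> 'k even_alg" and xs
    using that
  proof (induction xs)
    case Nil
    then show ?case by (intro exI[of _ 1]) (simp add: Kmn_0_1)
  next
    case (Cons x xs)
    obtain P where P: "prod_list (map f xs) * P = 1" "of_even P \<in> Kmn m n"
      using Cons.IH Cons.prems by (metis list.set_intros(2))
    obtain Q where Q: "f x * Q = 1" "of_even Q \<in> Kmn m n" using Cons.prems by (metis list.set_intros(1))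
    have "prod_list (map f (x # xs)) * (Q * P) = (f x * Q) * (prod_list (map f xs) * P)"
      by (simp add: ac_simps)
    then show ?case using P Q by (intro exI[of _ "Q * P"]) (simp add: Kmn_mult)
  qed
  have "\<exists>P. ldet i (even_c m) * P = (1 :: 'k even_alg) \<and> of_even P \<in> Kmn m n" if "i \<in> set I" for i
    by (rule even_c_minor_unit) (use subsetD[OF assms(1) that] in auto)
  then obtain P where P: "prod_list (map (\<lambda>i. ldet i (even_c m)) I) * P = (1 :: 'k even_alg)" "of_even P \<in> Kmn m n"
    using units[of I "\<lambda>i. ldet i (even_c m)"] by blast
  have "\<exists>P. ldet (j - 1) (even_phi m) * P = (1 :: 'k even_alg) \<and> of_even P \<in> Kmn m n" if "j \<in> set J" for j
    by (rule even_phi_minor_unit) (use subsetD[OF assms(2) that] in auto)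
  then obtain Q where Q: "prod_list (map (\<lambda>j. ldet (j - 1) (even_phi m)) J) * Q = (1 :: 'k even_alg)" "of_even Q \<in> Kmn m n"
    using units[of J "\<lambda>j. ldet (j - 1) (even_phi m)"] by blast
  have "den_even m I J * (P * Q) =
      (prod_list (map (\<lambda>i. ldet i (even_c m)) I) * P) * (prod_list (map (\<lambda>j. ldet (j - 1) (even_phi m)) J) * Q)"
    by (simp add: den_even_def ac_simps)
  then show ?thesis using P Q by (intro exI[of _ "P * Q"]) (simp add: Kmn_mult)
qed

lemma vfrac_even:
  assumes "set I \<subseteq> {1..m}" "set J \<subseteq> {1..n}" "den_even m I J * P = 1"
  shows "vfrac m n lam I J = (of_even (hw_even m n lam * P) :: 'k::field salg)"
proof -
  have 1: "prod_list (map (\<lambda>i. Dplus m [1..<i + 1]) I) = (of_even (prod_list (map (\<lambda>i. ldet i (even_c m)) I)) :: 'k salg)"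
    unfolding of_even_prod_list map_map o_def
    by (intro arg_cong[of _ _ prod_list] map_cong Dplus_leading refl) (use assms(1) in auto)
  have "Dminus m [m + 1..<m + j] = (of_even (ldet (j - 1) (even_phi m)) :: 'k salg)" if "j \<in> set J" for j
    using Dminus_leading[of m "j - 1"] that assms(2) by (auto simp del: upt_Suc)
  then have 2: "prod_list (map (\<lambda>j. Dminus m [m + 1..<m + j]) J) =
      (of_even (prod_list (map (\<lambda>j. ldet (j - 1) (even_phi m)) J)) :: 'k salg)"
    unfolding of_even_prod_list map_map o_def by (intro arg_cong[of _ _ prod_list] map_cong refl)
  have "rinv (prod_list (map (\<lambda>i. Dplus m [1..<i + 1]) I) * prod_list (map (\<lambda>j. Dminus m [m + 1..<m + j]) J)) =
      (of_even P :: 'k salg)"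
    unfolding 1 2 of_even_simps(4)[symmetric] den_even_def[symmetric] by (rule rinv_of_even[OF assms(3)])
  then show ?thesis unfolding vfrac_def hwvec_even by simp
qed

lemma den_even_mset: "mset I = mset I' \<Longrightarrow> mset J = mset J' \<Longrightarrow> den_even m I J = den_even m I' J'"
  unfolding den_even_def by (simp flip: prod_mset_prod_list)

lemma vfrac_mset:
  assumes "set I \<subseteq> {1..m}" "set J \<subseteq> {1..n}" "mset I = mset I'" "mset J = mset J'"
  shows "vfrac m n lam I J = (vfrac m n lam I' J' :: 'k::field salg)"
proof -
  obtain P :: "'k even_alg" where P: "den_even m I J * P = 1" using den_even_unit[OF assms(1,2)] by blast
  have "set I' = set I" "set J' = set J" using assms(3,4) by (metis set_mset_mset)+
  then show ?thesis
    using vfrac_even[OF assms(1,2) P] vfrac_even[of I' m J' n P] assms P den_even_mset[OF assms(3,4), of m] by metis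
qed

text \<open>
  Weights and annihilation are treated at once, because both pass from the leading minors to products
  and inverses, hence to fractions such as \<open>v\<^bsub>I|J\<^esub>\<close>.
\<close>

definition weighted :: "nat \<Rightarrow> nat \<Rightarrow> nat \<Rightarrow> 'k::field salg \<Rightarrow> bool" where
  "weighted N i j x \<longleftrightarrow> (\<exists>c. scalar_eigen (evder N i j) c x \<and> (i \<noteq> j \<longrightarrow> c = 0))"

lemma weighted_1: "weighted N i j 1"
  unfolding weighted_def using scalar_eigen_1 by blast

lemma weighted_mult: "weighted N i j x \<Longrightarrow> weighted N i j y \<Longrightarrow> weighted N i j (x * y)"
  unfolding weighted_def using scalar_eigen_mult[of N i j] by (metis add_0)

lemma weighted_power: "weighted N i j x \<Longrightarrow> weighted N i j (x ^ k)"
  by (induction k) (simp_all add: weighted_1 weighted_mult)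

lemma weighted_prod: "(\<And>x. x \<in> A \<Longrightarrow> weighted N i j (of_even (f x))) \<Longrightarrow> weighted N i j (of_even (prod f A))"
  by (induction A rule: infinite_finite_induct) (simp_all add: weighted_1 weighted_mult)

lemma weighted_prod_list: "(\<And>x. x \<in> set xs \<Longrightarrow> weighted N i j (of_even (f x))) \<Longrightarrow> weighted N i j (of_even (prod_list (map f xs)))"
  by (induction xs) (simp_all add: weighted_1 weighted_mult)

text \<open>
  The minor is \<open>D\<^sup>+(1, \<dots>, s - 1, r)\<close> with \<open>r = s\<close>.
\<close>

lemma weighted_even_c:
  assumes blk: "borel_pair m n i j" and s: "s \<le> m"
  shows "weighted (m + n) i j (of_even (ldet s (even_c m)) :: 'k::field salg)"
proof (cases "s = 0")
  case False
  let ?M = "next_minor (even_c m) s :: nat \<Rightarrow> 'k even_alg"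
  have eq: "ldet s (even_c m) = ?M s" using False by (simp add: next_minor_diag)
  show ?thesis
  proof (cases "i \<le> m")
    case True
    then have "evder (m + n) i j (of_even (?M s)) =
        of_even ((if i = j \<and> i < s then ?M s else 0) + (if s = i then ?M j else 0))"
      using blk s False by (intro evder_next_minor) (auto simp: borel_pair_def)
    moreover have "?M j = 0" if "i \<noteq> j" "s = i"
      using that blk by (intro next_minor_less) (auto simp: borel_pair_def)
    ultimately have "scalar_eigen (evder (m + n) i j) (if i = j \<and> i \<le> s then 1 else 0) (of_even (?M s))"
      by (auto simp: scalar_eigen_def)
    then show ?thesis unfolding weighted_def eq by (intro exI[of _ "if i = j \<and> i \<le> s then 1 else 0"]) auto
  next
    case out: False
    then have "evder (m + n) i j (of_even (?M s)) = 0"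
      using blk s False by (intro evder_next_minor_zero) (auto simp: borel_pair_def)
    then have "scalar_eigen (evder (m + n) i j) 0 (of_even (?M s))" by (simp add: scalar_eigen_def)
    then show ?thesis unfolding weighted_def eq by blast
  qed
qed (simp add: weighted_1)

lemma weighted_even_phi:
  assumes blk: "borel_pair m n i j" and s: "s \<le> n"
  shows "weighted (m + n) i j (of_even (ldet s (even_phi m)) :: 'k::field salg)"
proof -
  let ?U = "row_cofactor (even_phi m) (s + 1) :: nat \<Rightarrow> 'k even_alg"
  have eq: "ldet s (even_phi m) = ?U (s + 1)" by (simp add: row_cofactor_diag)
  show ?thesis
  proof (cases "i \<le> m")
    case True
    then have "evder (m + n) i j (of_even (?U (s + 1))) = 0"
      using blk s by (intro evder_row_cofactor_zero) (auto simp: borel_pair_def)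
    then have "scalar_eigen (evder (m + n) i j) 0 (of_even (?U (s + 1)))" by (simp add: scalar_eigen_def)
    then show ?thesis unfolding weighted_def eq by blast
  next
    case False
    define a b where "a = i - m" and "b = j - m"
    have ab: "i = m + a" "j = m + b" "a \<in> {1..n}" "b \<in> {1..a}"
      using False blk by (auto simp: borel_pair_def a_def b_def)
    have "evder (m + n) i j (of_even (?U (s + 1))) =
        of_even ((if a = b \<and> a \<le> s + 1 then ?U (s + 1) else 0) - (if s + 1 = b then ?U a else 0))"
      unfolding ab(1,2) by (rule evder_row_cofactor[OF ab(3,4)]) (use s in auto)
    moreover have "?U a = 0" if "a > s + 1" using that by (simp add: row_cofactor_def)
    ultimately have "scalar_eigen (evder (m + n) i j) (if a = b \<and> a \<le> s then 1 else 0) (of_even (?U (s + 1)))"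
      using ab(4) by (auto simp: scalar_eigen_def)
    then show ?thesis unfolding weighted_def eq ab(1,2)
      by (intro exI[of _ "if a = b \<and> a \<le> s then 1 else 0"]) auto
  qed
qed

lemma weighted_vfrac:
  assumes blk: "borel_pair m n i j" and "set I \<subseteq> {1..m}" "set J \<subseteq> {1..n}"
  shows "weighted (m + n) i j (vfrac m n lam I J :: 'k::field salg)"
proof -
  obtain P :: "'k even_alg" where P: "den_even m I J * P = 1" using den_even_unit[OF assms(2,3)] by blast
  have I: "i \<le> m" if "i \<in> set I" for i using subsetD[OF assms(2) that] by simp
  have J: "j - 1 \<le> n" if "j \<in> set J" for j using subsetD[OF assms(3) that] by auto
  have "weighted (m + n) i j (of_even (hw_even m n lam) :: 'k salg)"
    unfolding hw_even_def of_even_simps(4)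
    by (intro weighted_mult weighted_prod; unfold of_even_power; intro weighted_power weighted_even_c[OF blk] weighted_even_phi[OF blk]) auto
  moreover have "weighted (m + n) i j (of_even (den_even m I J) :: 'k salg)"
    unfolding den_even_def of_even_simps(4)
    by (intro weighted_mult weighted_prod_list weighted_even_c[OF blk] weighted_even_phi[OF blk]) (use I J in auto)
  then have "weighted (m + n) i j (of_even P :: 'k salg)"
    unfolding weighted_def using scalar_eigen_inverse[of "m + n" i j _ "of_even (den_even m I J)" "of_even P"] P
    by (metis mult.commute neg_equal_0_iff_equal of_even_simps(2,4))
  ultimately show ?thesis unfolding vfrac_even[OF assms(2,3) P] of_even_simps(4) by (rule weighted_mult)
qed

section \<open>Tensors over \<open>K(m|n)\<close>\<close>

text \<open>
  Tensors all of whose components lie in \<open>K(m|n)\<close>. On these an operator satisfying the defining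
  conditions of \<open>\<^sub>i\<^sub>jD\<close> acts like the explicit derivation, whatever its values elsewhere.
\<close>

inductive_set Ktens :: "nat \<Rightarrow> nat \<Rightarrow> 'k::field tens set" for m n where
  pure: "a \<in> Kmn m n \<Longrightarrow> set ys \<subseteq> Kmn m n \<Longrightarrow> tpure a ys \<in> Ktens m n"
| add: "v \<in> Ktens m n \<Longrightarrow> w \<in> Ktens m n \<Longrightarrow> v + w \<in> Ktens m n"

lemma Ktens_0: "0 \<in> Ktens m n"
  using Ktens.pure[of 0 m n "[]"] by (simp add: Kmn_0_1)

lemma Ktens_sum: "(\<And>x. x \<in> A \<Longrightarrow> f x \<in> Ktens m n) \<Longrightarrow> sum f A \<in> Ktens m n"
  by (induction A rule: infinite_finite_induct) (auto intro: Ktens_0 Ktens.add)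

lemma Ktens_mult:
  assumes "v \<in> Ktens m n" "w \<in> Ktens m n"
  shows "v * w \<in> Ktens m n"
  using assms(1)
proof induction
  case (pure a us)
  show ?case using assms(2)
    by induction (use pure in \<open>auto simp: tpure_mult distrib_left intro!: Ktens.intros Kmn_mult\<close>)
qed (simp add: distrib_right Ktens.add)

lemma Ktens_tscale: "w \<in> Ktens m n \<Longrightarrow> tscale c w \<in> Ktens m n"
  unfolding tscale_def by (intro Ktens_mult Ktens.pure) (auto intro: Kmn_kconst)

text \<open>
  Two derivations that agree on the generators agree on \<open>A(m|n)\<close>. For \<open>x = a / f\<close> compare the
  derivatives of \<open>x f = a\<close> and cancel the unit \<open>f\<close>.
\<close>

lemma is_evder_evder_eq:
  assumes D: "is_evder m n i j D" and blk: "borel_pair m n i j" and x: "x \<in> (Kmn m n :: 'k::field salg set)"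
  shows "D x = evder (m + n) i j x"
proof -
  let ?E = "evder (m + n) i j :: 'k salg \<Rightarrow> 'k salg"
  interpret D: Vector_Spaces.linear kscale kscale D using D by (simp add: is_evder_def)
  have leib: "D (x * y) = D x * y + x * D y" if "x \<in> Kmn m n" "y \<in> Kmn m n" for x y
    using D that by (simp add: is_evder_def)
  have "D 1 = 0" using leib[of 1 1] by (simp add: Kmn_0_1)
  then have const: "D (kconst a) = 0" for a using D.scale[of a 1] by (simp add: kscale_def)
  have A: "D x = ?E x" if "x \<in> Amn m n" for x
    using that
  proof induction
    case (gen k l)
    have "?E (cgen m k l) = (if l = i then cgen m k j else 0)"
      by (rule evder_cgen) (use gen blk in \<open>auto simp: borel_pair_def\<close>)
    then show ?case using gen D by (simp add: is_evder_def)
  qed (simp_all add: const evder_kconst D.add evder_add evder_mult leib Amn_Kmn)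
  obtain a f where af: "x = a * rinv f" "a \<in> Amn m n" "f \<in> Aev m n" "f \<noteq> 0"
    using x by (auto simp: Kmn_def)
  note inv = Aev_fractions(5,6)[OF af(3,4) af(3,4)]
  have fA: "f \<in> Amn m n" using af(3) Aev_subset by blast
  have xf: "x * f = a" unfolding af(1) mult.assoc inv by simp
  \<comment> \<open>Both sides are derivatives of \<open>a\<close>.\<close>
  have "D x * f + x * D f = ?E x * f + x * ?E f"
    using leib[OF x Amn_Kmn[OF fA]] evder_mult[of "m + n" i j x f] A[OF af(2)] unfolding xf by simp
  then have "D x * f = ?E x * f" using A[OF fA] by simp
  then have "D x * (f * rinv f) = ?E x * (f * rinv f)" by (simp only: mult.assoc[symmetric])
  then show ?thesis by (simp add: inv)
qed

lemma tact_evder_eq: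
  assumes D: "is_evder m n i j D" and blk: "borel_pair m n i j" and w: "w \<in> (Ktens m n :: 'k::field tens set)"
  shows "tact D w = tact (evder (m + n) i j) w"
  using w
proof induction
  case (pure a ys)
  have lin: "Vector_Spaces.linear kscale kscale D" using D by (simp add: is_evder_def)
  have "D (ys ! l) = evder (m + n) i j (ys ! l)" if "l < length ys" for l
    using that pure(2) by (intro is_evder_evder_eq[OF D blk]) auto
  then show ?case
    using is_evder_evder_eq[OF D blk pure(1)] by (simp add: tact_tpure[OF lin] tact_tpure[OF evder_linear[OF blk]])
qed (simp add: tact_add)

lemma Ktens_rho:
  assumes i: "i \<in> {1..m}" and j: "j \<in> {1..n}"
  shows "rho m i j \<in> (Ktens m n :: 'k::field tens set)"
  unfolding rho_expansion[OF assms]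
proof (intro Ktens_sum Ktens.pure)
  fix r s assume r: "r \<in> {1..m}" and s: "s \<in> {1..n}"
  have "of_even (next_minor (even_c m) i r) \<in> (Kmn m n :: 'k salg set)"
    unfolding next_minor_def top_minor_def of_even_ldet
  proof (rule Kmn_ldet)
    fix a b assume ab: "a \<in> {1..length ([1..<i] @ [r])}" "b \<in> {1..length ([1..<i] @ [r])}"
    then have "([1..<i] @ [r]) ! (b - 1) \<in> set ([1..<i] @ [r])" by (intro nth_mem) auto
    then have "([1..<i] @ [r]) ! (b - 1) \<in> {1..m}" using i r by auto
    then show "of_even (even_c m a (([1..<i] @ [r]) ! (b - 1))) \<in> (Kmn m n :: 'k salg set)"
      using ab i by (subst of_even_even_c) (auto intro!: Kmn_cgen)
  qed
  moreover have "of_even (row_cofactor (even_phi m) j s) \<in> (Kmn m n :: 'k salg set)"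
  proof (cases "s \<le> j")
    case True
    have "of_even (ldet (j - 1) (\<lambda>a b. even_phi m a (if b < s then b else Suc b))) \<in> (Kmn m n :: 'k salg set)"
      unfolding of_even_ldet
    proof (rule Kmn_ldet)
      fix a b assume "a \<in> {1..j - 1}" "b \<in> {1..j - 1}"
      then show "of_even (even_phi m a (if b < s then b else Suc b)) \<in> (Kmn m n :: 'k salg set)"
        using j by (subst of_even_even_phi) (auto intro!: Kmn_phic)
    qed
    then show ?thesis
      using True by (auto simp: row_cofactor_def of_even_power intro!: Kmn_mult Kmn_power Kmn_uminus Kmn_0_1)
  qed (simp add: row_cofactor_def Kmn_0_1)
  ultimately show "of_even (next_minor (even_c m) i r * row_cofactor (even_phi m) j s) \<in> (Kmn m n :: 'k salg set)"
    by (simp add: Kmn_mult)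
  show "set [yel m r (m + s)] \<subseteq> (Kmn m n :: 'k salg set)"
    using r s by (auto intro!: Kmn_yel)
qed

lemma Ktens_rho_multi:
  assumes "length K = length L" "set K \<subseteq> {1..m}" "set L \<subseteq> {1..n}"
  shows "rho_multi m K L \<in> (Ktens m n :: 'k::field tens set)"
  using assms
proof (induction K L rule: list_induct2)
  case Nil
  have "(1 :: 'k tens) \<in> Ktens m n"
    unfolding tcoeff_1[symmetric] by (intro Ktens.pure) (auto simp: Kmn_0_1)
  then show ?case by (simp add: rho_multi_def)
next
  case (Cons k K l L)
  then show ?case by (simp add: rho_multi_def Ktens_mult Ktens_rho)
qed

lemma Kmn_vfrac:
  assumes "set I \<subseteq> {1..m}" "set J \<subseteq> {1..n}"
  shows "vfrac m n lam I J \<in> (Kmn m n :: 'k::field salg set)"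
proof -
  obtain P :: "'k even_alg" where P: "den_even m I J * P = 1" "of_even P \<in> Kmn m n"
    using den_even_unit[OF assms] by blast
  have C: "of_even (ldet a (even_c m)) \<in> (Kmn m n :: 'k salg set)" if "a \<le> m" for a
    unfolding of_even_ldet using that by (intro Kmn_ldet) (auto simp: of_even_even_c intro!: Kmn_cgen)
  have F: "of_even (ldet b (even_phi m)) \<in> (Kmn m n :: 'k salg set)" if "b \<le> n" for b
    unfolding of_even_ldet using that by (intro Kmn_ldet) (auto simp: of_even_even_phi intro!: Kmn_phic)
  have prod: "of_even (prod f A) \<in> Kmn m n" if "\<And>x. x \<in> A \<Longrightarrow> of_even (f x) \<in> Kmn m n"
    for f :: "nat \<Rightarrow> 'k even_alg" and A
    using that by (induction A rule: infinite_finite_induct) (auto intro: Kmn_mult Kmn_0_1)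
  have "of_even (hw_even m n lam) \<in> (Kmn m n :: 'k salg set)"
    unfolding hw_even_def of_even_simps(4)
    by (intro Kmn_mult prod) (auto simp: of_even_power intro!: Kmn_power C F)
  then show ?thesis unfolding vfrac_even[OF assms P(1)] of_even_simps(4) using P(2) by (rule Kmn_mult)
qed

section \<open>Sums over permutations preserving the lines of a diagram\<close>

text \<open>
  A permutation contributing to a block triangular determinant maps \<open>A\<close> into itself, hence also \<open>B\<close>, and so is
  the product of its restrictions.
\<close>

lemma det_on_Un:
  assumes fin: "finite A" "finite B" and dis: "A \<inter> B = {}"
    and zero: "\<And>x y. x \<in> B \<Longrightarrow> y \<in> A \<Longrightarrow> H x y = 0"
  shows "det_on (A \<union> B) H = det_on A H * (det_on B H :: 'a::comm_ring_1)"
proof -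
  let ?t = "\<lambda>\<pi>. of_int (sign \<pi>) * (\<Prod>c\<in>A \<union> B. H (\<pi> c) c)"
  let ?P = "{\<pi>. \<pi> permutes (A \<union> B) \<and> \<pi> ` A \<subseteq> A}"
  have "det_on (A \<union> B) H = sum ?t ?P"
    unfolding det_on_def
  proof (rule sum.mono_neutral_right)
    show "finite {\<pi>. \<pi> permutes (A \<union> B)}" using fin by (simp add: finite_permutations)
    show "\<forall>\<pi>\<in>{\<pi>. \<pi> permutes (A \<union> B)} - ?P. ?t \<pi> = 0"
    proof
      fix \<pi> assume "\<pi> \<in> {\<pi>. \<pi> permutes (A \<union> B)} - ?P"
      then obtain c where c: "c \<in> A" "\<pi> c \<notin> A" and p: "\<pi> permutes (A \<union> B)" by auto
      then have "\<pi> c \<in> B" using permutes_in_image[OF p, of c] by auto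
      then have "H (\<pi> c) c = 0" using c by (intro zero)
      then have "(\<Prod>c\<in>A \<union> B. H (\<pi> c) c) = 0" using c fin by (intro prod_zero) auto
      then show "?t \<pi> = 0" by simp
    qed
  qed auto
  also have "\<dots> = (\<Sum>(p, q)\<in>{p. p permutes A} \<times> {q. q permutes B}.
      (of_int (sign p) * (\<Prod>c\<in>A. H (p c) c)) * (of_int (sign q) * (\<Prod>c\<in>B. H (q c) c)))"
  proof (rule sum.reindex_bij_witness[of _ "\<lambda>(p, q). p \<circ> q" "\<lambda>\<pi>. (restrict_id \<pi> A, restrict_id \<pi> B)"])
    fix \<pi> assume "\<pi> \<in> ?P"
    then have p: "\<pi> permutes (A \<union> B)" and sub: "\<pi> ` A \<subseteq> A" by auto
    have inj: "inj \<pi>" by (rule permutes_inj[OF p])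
    have A: "\<pi> ` A = A" using sub fin(1) inj by (metis endo_inj_surj inj_on_subset subset_UNIV)
    have "\<pi> ` (A \<union> B) = A \<union> B" by (rule permutes_image[OF p])
    then have B: "\<pi> ` B = B" using A dis inj by (metis Diff_cancel Un_Diff_Int Un_commute Diff_triv image_Un image_set_diff Int_commute Un_Diff Un_empty_right)
    have pA: "restrict_id \<pi> A permutes A"
      using A inj by (intro permutes_restrict_id) (auto simp: bij_betw_def intro: inj_on_subset)
    have pB: "restrict_id \<pi> B permutes B"
      using B inj by (intro permutes_restrict_id) (auto simp: bij_betw_def intro: inj_on_subset)
    have comp: "restrict_id \<pi> A \<circ> restrict_id \<pi> B = \<pi>"
    proof
      fix x
      consider "x \<in> A" | "x \<in> B" | "x \<notin> A \<union> B" by blast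
      then show "(restrict_id \<pi> A \<circ> restrict_id \<pi> B) x = \<pi> x"
      proof cases
        case 1
        then have "x \<notin> B" using dis by blast
        then show ?thesis using 1 by simp
      next
        case 2
        then have "\<pi> x \<notin> A" using B dis by blast
        then show ?thesis using 2 by simp
      next
        case 3
        then show ?thesis using permutes_not_in[OF p 3] by simp
      qed
    qed
    show "(case (restrict_id \<pi> A, restrict_id \<pi> B) of (p, q) \<Rightarrow> p \<circ> q) = \<pi>" using comp by simp
    show "(restrict_id \<pi> A, restrict_id \<pi> B) \<in> {p. p permutes A} \<times> {q. q permutes B}" using pA pB by simp
    have "sign \<pi> = sign (restrict_id \<pi> A) * sign (restrict_id \<pi> B)"
      using sign_compose[OF permutes_imp_permutation[OF fin(1) pA] permutes_imp_permutation[OF fin(2) pB]]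
      unfolding comp .
    moreover have "(\<Prod>c\<in>A \<union> B. H (\<pi> c) c) =
        (\<Prod>c\<in>A. H (restrict_id \<pi> A c) c) * (\<Prod>c\<in>B. H (restrict_id \<pi> B c) c)"
      by (subst prod.union_disjoint[OF fin dis]) simp
    ultimately show "(case (restrict_id \<pi> A, restrict_id \<pi> B) of (p, q) \<Rightarrow>
        (of_int (sign p) * (\<Prod>c\<in>A. H (p c) c)) * (of_int (sign q) * (\<Prod>c\<in>B. H (q c) c))) = ?t \<pi>"
      by (simp add: ac_simps)
  next
    fix pq assume "pq \<in> {p. p permutes A} \<times> {q. q permutes B}"
    then obtain p q where pq: "pq = (p, q)" "p permutes A" "q permutes B" by blast
    have onA: "(p \<circ> q) c = p c" "p c \<in> A" if "c \<in> A" for c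
    proof -
      have "c \<notin> B" using that dis by blast
      then show "(p \<circ> q) c = p c" using permutes_not_in[OF pq(3)] by simp
      show "p c \<in> A" using permutes_in_image[OF pq(2)] that by simp
    qed
    have onB: "(p \<circ> q) c = q c" if "c \<in> B" for c
    proof -
      have "q c \<in> B" using permutes_in_image[OF pq(3)] that by simp
      then have "q c \<notin> A" using dis by blast
      then show ?thesis using permutes_not_in[OF pq(2)] by simp
    qed
    have "restrict_id (p \<circ> q) A = p"
    proof
      fix x show "restrict_id (p \<circ> q) A x = p x"
        using onA[of x] permutes_not_in[OF pq(2), of x] by (cases "x \<in> A") simp_all
    qed
    moreover have "restrict_id (p \<circ> q) B = q"
    proof
      fix x show "restrict_id (p \<circ> q) B x = q x"
        using onB[of x] permutes_not_in[OF pq(3), of x] by (cases "x \<in> B") simp_all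
    qed
    ultimately show "(restrict_id (case pq of (p, q) \<Rightarrow> p \<circ> q) A, restrict_id (case pq of (p, q) \<Rightarrow> p \<circ> q) B) = pq"
      using pq(1) by simp
    have "p \<circ> q permutes A \<union> B"
      by (rule permutes_compose) (rule permutes_subset[OF pq(3)], simp, rule permutes_subset[OF pq(2)], simp)
    then show "(case pq of (p, q) \<Rightarrow> p \<circ> q) \<in> ?P" using onA pq(1) by auto
  qed
  also have "\<dots> = det_on A H * det_on B H"
    unfolding det_on_def sum_product by (rule sum.cartesian_product[symmetric])
  finally show ?thesis .
qed

lemma det_on_block_diagonal:
  assumes "finite D" and "finite S" and "f ` D \<subseteq> S"
    and "\<And>x y. x \<in> D \<Longrightarrow> y \<in> D \<Longrightarrow> f x \<noteq> f y \<Longrightarrow> H x y = 0"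
  shows "det_on D H = (\<Prod>s\<in>S. det_on {c \<in> D. f c = s} H :: 'a::comm_ring_1)"
  using assms(2,1,3,4)
proof (induction S arbitrary: D rule: finite_induct)
  case empty
  then show ?case by (simp add: det_on_def)
next
  case (insert s S)
  let ?A = "{c \<in> D. f c = s}" and ?B = "{c \<in> D. f c \<in> S}"
  have D: "D = ?A \<union> ?B" using insert.prems(2) by auto
  have "det_on D H = det_on (?A \<union> ?B) H" using D by simp
  also have "\<dots> = det_on ?A H * det_on ?B H"
  proof (rule det_on_Un)
    fix x y assume xy: "x \<in> ?B" "y \<in> ?A"
    then have "f x \<noteq> f y" using insert.hyps by auto
    then show "H x y = 0" using insert.prems(3)[of x y] xy by simp
  qed (use insert.prems insert.hyps in auto)
  also have "det_on ?B H = (\<Prod>s'\<in>S. det_on {c \<in> ?B. f c = s'} H)"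
    by (rule insert.IH) (use insert.prems in auto)
  also have "\<dots> = (\<Prod>s'\<in>S. det_on {c \<in> D. f c = s'} H)"
    by (rule prod.cong[OF refl], rule arg_cong[of _ _ "\<lambda>E. det_on E H"]) auto
  finally show ?case using insert.hyps by simp
qed

text \<open>
  The group of permutations preserving the rows (or columns) of a diagram appears by setting to zero the
  entries of a determinant that join different rows.
\<close>

lemma sum_fiber_permutations:
  assumes fin: "finite D" "finite S" and "f ` D \<subseteq> S"
  shows "(\<Sum>\<alpha> | \<alpha> permutes D \<and> (\<forall>c\<in>D. f (\<alpha> c) = f c). of_int (sign \<alpha>) * (\<Prod>c\<in>D. G (\<alpha> c) c)) =
    (\<Prod>s\<in>S. det_on {c \<in> D. f c = s} G :: 'a::comm_ring_1)" (is "?lhs = _")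
proof -
  define H where "H = (\<lambda>x y. if f x = f y then G x y else 0)"
  have "det_on D H = (\<Sum>\<alpha> | \<alpha> permutes D \<and> (\<forall>c\<in>D. f (\<alpha> c) = f c). of_int (sign \<alpha>) * (\<Prod>c\<in>D. H (\<alpha> c) c))"
    unfolding det_on_def
  proof (rule sum.mono_neutral_right)
    show "\<forall>\<alpha>\<in>{\<alpha>. \<alpha> permutes D} - {\<alpha>. \<alpha> permutes D \<and> (\<forall>c\<in>D. f (\<alpha> c) = f c)}.
        of_int (sign \<alpha>) * (\<Prod>c\<in>D. H (\<alpha> c) c) = 0"
    proof
      fix \<alpha> assume "\<alpha> \<in> {\<alpha>. \<alpha> permutes D} - {\<alpha>. \<alpha> permutes D \<and> (\<forall>c\<in>D. f (\<alpha> c) = f c)}"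
      then obtain c where "c \<in> D" "f (\<alpha> c) \<noteq> f c" by auto
      then have "(\<Prod>c\<in>D. H (\<alpha> c) c) = 0" using fin by (intro prod_zero) (auto simp: H_def)
      then show "of_int (sign \<alpha>) * (\<Prod>c\<in>D. H (\<alpha> c) c) = 0" by simp
    qed
  qed (use fin in \<open>auto simp: finite_permutations\<close>)
  also have "\<dots> = ?lhs"
    by (intro sum.cong refl arg_cong2[of _ _ _ _ "(*)"] prod.cong) (auto simp: H_def)
  finally have "?lhs = det_on D H" by simp
  also have "\<dots> = (\<Prod>s\<in>S. det_on {c \<in> D. f c = s} H)"
    by (rule det_on_block_diagonal[OF fin(1,2) assms(3)]) (simp add: H_def)
  also have "\<dots> = (\<Prod>s\<in>S. det_on {c \<in> D. f c = s} G)"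
    by (intro prod.cong refl det_on_cong) (auto simp: H_def)
  finally show ?thesis .
qed

text \<open>
  Rows of \<open>\<D>\<^sup>+\<close> and columns of \<open>\<D>\<^sup>-\<close> are treated together: a line \<open>s\<close> of the diagram is a fibre of \<open>f\<close>, and
  \<open>g\<close> is the other coordinate, which runs through the interval \<open>{q s + 1..p s}\<close>. The second formula
  distributes a product over the multiindex, such as the denominator of \<open>v\<^bsub>I|J\<^esub>\<close>, over the lines.
\<close>

lemma skew_diagram_sum:
  fixes W :: "nat \<Rightarrow> nat \<Rightarrow> 'a::comm_ring_1" and P :: "nat \<Rightarrow> 'c"
  assumes P: "bij_betw P {..<k} D" and fS: "f ` D \<subseteq> S" and S: "finite S"
    and h: "\<And>s. s \<in> S \<Longrightarrow> bij_betw (h s) {q s + 1..p s} {c \<in> D. f c = s}"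
    and g: "\<And>s i. g (h s i) = i"
  shows "(\<Sum>\<alpha> | \<alpha> permutes D \<and> (\<forall>c\<in>D. f (\<alpha> c) = f c).
      of_int (sign \<alpha>) * (\<Prod>l<k. W (g (\<alpha> (P l))) (r l))) =
    (\<Prod>s\<in>S. det_on {q s + 1..p s} (\<lambda>i c. W i (r (inv_into {..<k} P (h s c)))))"
    and "(\<Prod>l<k. d (g (P l)) :: 'a) = (\<Prod>s\<in>S. \<Prod>i = q s + 1..p s. d i)"
proof -
  have fin: "finite D" using P bij_betw_finite by blast
  have inv: "inv_into {..<k} P (P l) = l" if "l < k" for l
    using P that by (intro inv_into_f_f) (auto simp: bij_betw_def)
  have reindex: "(\<Prod>c\<in>D. F c) = (\<Prod>l<k. F (P l))" for F :: "'c \<Rightarrow> 'a"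
    by (rule prod.reindex_bij_betw[OF P, symmetric])
  have "(\<Sum>\<alpha> | \<alpha> permutes D \<and> (\<forall>c\<in>D. f (\<alpha> c) = f c).
      of_int (sign \<alpha>) * (\<Prod>l<k. W (g (\<alpha> (P l))) (r l))) =
    (\<Sum>\<alpha> | \<alpha> permutes D \<and> (\<forall>c\<in>D. f (\<alpha> c) = f c).
      of_int (sign \<alpha>) * (\<Prod>c\<in>D. W (g (\<alpha> c)) (r (inv_into {..<k} P c))))"
    unfolding reindex by (intro sum.cong refl arg_cong2[of _ _ _ _ "(*)"] prod.cong) (simp add: inv)
  also have "\<dots> = (\<Prod>s\<in>S. det_on {c \<in> D. f c = s} (\<lambda>x c. W (g x) (r (inv_into {..<k} P c))))"
    by (rule sum_fiber_permutations[OF fin S fS])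
  also have "\<dots> = (\<Prod>s\<in>S. det_on {q s + 1..p s} (\<lambda>i c. W i (r (inv_into {..<k} P (h s c)))))"
  proof (rule prod.cong[OF refl])
    fix s assume s: "s \<in> S"
    show "det_on {c \<in> D. f c = s} (\<lambda>x c. W (g x) (r (inv_into {..<k} P c))) =
        det_on {q s + 1..p s} (\<lambda>i c. W i (r (inv_into {..<k} P (h s c))))"
      unfolding det_on_reindex[OF h[OF s] finite_atLeastAtMost] g ..
  qed
  finally show "(\<Sum>\<alpha> | \<alpha> permutes D \<and> (\<forall>c\<in>D. f (\<alpha> c) = f c).
      of_int (sign \<alpha>) * (\<Prod>l<k. W (g (\<alpha> (P l))) (r l))) =
    (\<Prod>s\<in>S. det_on {q s + 1..p s} (\<lambda>i c. W i (r (inv_into {..<k} P (h s c)))))" .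
  have "(\<Prod>l<k. d (g (P l))) = (\<Prod>c\<in>D. d (g c))" unfolding reindex ..
  also have "\<dots> = (\<Prod>s\<in>S. \<Prod>c\<in>{c \<in> D. f c = s}. d (g c))"
    by (rule prod.group[symmetric, OF fin S fS])
  also have "\<dots> = (\<Prod>s\<in>S. \<Prod>i = q s + 1..p s. d i)"
  proof (rule prod.cong[OF refl])
    fix s assume s: "s \<in> S"
    show "(\<Prod>c\<in>{c \<in> D. f c = s}. d (g c)) = (\<Prod>i = q s + 1..p s. d i)"
      unfolding prod.reindex_bij_betw[OF h[OF s], symmetric] g ..
  qed
  finally show "(\<Prod>l<k. d (g (P l))) = (\<Prod>s\<in>S. \<Prod>i = q s + 1..p s. d i)" .
qed

section \<open>Conjugate partitions and skew diagrams\<close>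

definition decreasing_upto :: "nat \<Rightarrow> (nat \<Rightarrow> nat) \<Rightarrow> bool" where
  "decreasing_upto m g \<longleftrightarrow> (\<forall>i. 1 \<le> i \<and> i < m \<longrightarrow> g (i + 1) \<le> g i)"

definition conj_part :: "nat \<Rightarrow> (nat \<Rightarrow> nat) \<Rightarrow> nat \<Rightarrow> nat" where
  "conj_part m g s = card {i \<in> {1..m}. s \<le> g i}"

lemma antitone_le:
  assumes "decreasing_upto m g" and "1 \<le> i" "i \<le> j" "j \<le> m"
  shows "g j \<le> g i"
  using assms(3,4)
proof (induction j rule: dec_induct)
  case (step j)
  then have "g (j + 1) \<le> g j" using assms(1,2) unfolding decreasing_upto_def by simp
  with step show ?case by simp
qed simp

text \<open>
  The set on the left is an initial segment of \<open>{1..m}\<close> because \<open>g\<close> decreases.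
\<close>

lemma conj_part_set:
  assumes "decreasing_upto m g"
  shows "{i \<in> {1..m}. s \<le> g i} = {1..conj_part m g s}"
proof (cases "{i \<in> {1..m}. s \<le> g i} = {}")
  case True
  then show ?thesis unfolding conj_part_def True by simp
next
  case False
  let ?A = "{i \<in> {1..m}. s \<le> g i}"
  define p where "p = Max ?A"
  have fin: "finite ?A" by simp
  have p: "p \<in> ?A" unfolding p_def by (rule Max_in[OF fin False])
  have "?A = {1..p}"
  proof
    show "?A \<subseteq> {1..p}" using Max_ge[OF fin] by (auto simp: p_def)
    show "{1..p} \<subseteq> ?A"
    proof
      fix i assume i: "i \<in> {1..p}"
      then have "g p \<le> g i" by (intro antitone_le[OF assms]) (use p in auto)
      then show "i \<in> ?A" using i p by auto
    qed
  qed
  then show ?thesis unfolding conj_part_def by simp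
qed

lemma conj_part_le: "conj_part m g s \<le> m"
proof -
  have "card {i \<in> {1..m}. s \<le> g i} \<le> card {1..m}" by (rule card_mono) auto
  then show ?thesis by (simp add: conj_part_def)
qed

lemma conj_part_mono:
  assumes "\<And>i. i \<in> {1..m} \<Longrightarrow> g i \<le> g' i"
  shows "conj_part m g s \<le> conj_part m g' s"
  unfolding conj_part_def by (rule card_mono) (auto intro: order_trans[OF _ assms])

lemma le_conj_part_iff:
  assumes "decreasing_upto m g" and "i \<in> {1..m}"
  shows "i \<le> conj_part m g s \<longleftrightarrow> s \<le> g i"
proof -
  have "i \<in> {i \<in> {1..m}. s \<le> g i} \<longleftrightarrow> i \<in> {1..conj_part m g s}"
    by (simp only: conj_part_set[OF assms(1)])
  then show ?thesis using assms(2) by auto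
qed

lemma card_conj_part_level:
  assumes anti: "decreasing_upto m g" and last: "g (m + 1) = 0"
    and L: "g 1 \<le> L" and a: "a \<in> {1..m}"
  shows "card {s \<in> {1..L}. conj_part m g s = a} = g a - g (a + 1)"
proof -
  have "{s \<in> {1..L}. conj_part m g s = a} = {g (a + 1) + 1..g a}"
  proof (rule Set.set_eqI)
    fix s
    have 1: "a \<le> conj_part m g s \<longleftrightarrow> s \<le> g a" by (rule le_conj_part_iff[OF anti a])
    have 2: "a + 1 \<le> conj_part m g s \<longleftrightarrow> s \<le> g (a + 1)" if "1 \<le> s"
    proof (cases "a = m")
      case True
      then show ?thesis using conj_part_le[of m g s] last that by simp
    next
      case False
      then show ?thesis using a by (intro le_conj_part_iff[OF anti]) auto
    qed
    have "g a \<le> g 1" by (rule antitone_le[OF anti]) (use a in auto)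
    then show "s \<in> {s \<in> {1..L}. conj_part m g s = a} \<longleftrightarrow> s \<in> {g (a + 1) + 1..g a}"
      using 1 2 L by (cases "1 \<le> s") auto
  qed
  then show ?thesis by simp
qed

text \<open>
  The exponents of \<open>v\<close> count the lines of each length in the Young diagram of \<open>\<lambda>\<^sup>+\<close> or \<open>\<lambda>\<^sup>-\<close>, so \<open>v\<close> is a product
  with one factor for each line. Lines beyond the diagram are harmless, as \<open>d 0 = 1\<close>; this is used
  for \<open>\<lambda>\<^sup>-\<close>, whose diagram may have fewer columns than that of \<open>\<nu>\<close>.
\<close>

lemma prod_conj_part:
  fixes d :: "nat \<Rightarrow> 'a::comm_ring_1"
  assumes anti: "decreasing_upto m g" and last: "g (m + 1) = 0"
    and L: "g 1 \<le> L" and d0: "d 0 = 1"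
  shows "(\<Prod>s = 1..L. d (conj_part m g s)) = (\<Prod>a = 1..m. d a ^ (g a - g (a + 1)))"
proof -
  have "(\<Prod>s = 1..L. d (conj_part m g s)) =
      (\<Prod>a\<in>{0..m}. \<Prod>s\<in>{s \<in> {1..L}. conj_part m g s = a}. d (conj_part m g s))"
    by (rule prod.group[symmetric]) (auto simp: conj_part_le)
  also have "\<dots> = (\<Prod>a\<in>{0..m}. d a ^ card {s \<in> {1..L}. conj_part m g s = a})"
    by (intro prod.cong refl) simp
  also have "\<dots> = (\<Prod>a\<in>{1..m}. d a ^ card {s \<in> {1..L}. conj_part m g s = a})"
    by (rule prod.mono_neutral_right) (auto simp: d0 not_less_eq_eq)
  also have "\<dots> = (\<Prod>a = 1..m. d a ^ (g a - g (a + 1)))"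
    by (intro prod.cong refl) (simp only: card_conj_part_level[OF anti last L])
  finally show ?thesis .
qed

lemma antitone_lamplus:
  assumes "hook_partition m n lam"
  shows "decreasing_upto m (lamplus m lam)"
  using assms by (simp add: decreasing_upto_def hook_partition_def is_partition_def lamplus_def)

lemma antitone_lamminus:
  assumes "hook_partition m n lam"
  shows "decreasing_upto n (lamminus m n lam)"
  unfolding decreasing_upto_def
proof (intro allI impI)
  fix j assume j: "1 \<le> j \<and> j < n"
  obtain N where N: "\<And>i. i > N \<Longrightarrow> lam i = 0"
    using assms(1) by (auto simp: hook_partition_def is_partition_def)
  have "{i. i > m \<and> j \<le> lam i} \<subseteq> {..N}"
  proof
    fix i assume i: "i \<in> {i. i > m \<and> j \<le> lam i}"
    show "i \<in> {..N}"
    proof (rule ccontr)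
      assume "i \<notin> {..N}"
      then have "lam i = 0" by (intro N) simp
      then show False using i j by simp
    qed
  qed
  then have "finite {i. i > m \<and> j \<le> lam i}" by (rule finite_subset) simp
  then have "card {i. i > m \<and> j + 1 \<le> lam i} \<le> card {i. i > m \<and> j \<le> lam i}"
    by (intro card_mono) auto
  then show "lamminus m n lam (j + 1) \<le> lamminus m n lam j" by (simp add: lamminus_def)
qed

lemma antitone_mu: "admissible m n lam I J \<Longrightarrow> decreasing_upto m (\<lambda>i. nat (mu m lam I i))"
  unfolding decreasing_upto_def admissible_def by (blast intro: nat_mono)

lemma antitone_nu: "admissible m n lam I J \<Longrightarrow> decreasing_upto n (\<lambda>j. nat (nu m n lam J j))"
  unfolding decreasing_upto_def admissible_def by (blast intro: nat_mono)

lemma diagplus_row: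
  assumes hook: "hook_partition m n lam" and adm: "admissible m n lam I J"
    and mu: "\<forall>i\<in>{1..m}. mu m lam I i \<ge> 0"
  shows "bij_betw (Pair s) {conj_part m (\<lambda>i. nat (mu m lam I i)) s + 1..conj_part m (lamplus m lam) s}
    {c \<in> diagplus m lam I. fst c = s}"
proof -
  note p = conj_part_set[OF antitone_lamplus[OF hook], of s]
  note q = conj_part_set[OF antitone_mu[OF adm], of s]
  have "(s, i) \<in> diagplus m lam I \<longleftrightarrow>
      i \<in> {conj_part m (\<lambda>i. nat (mu m lam I i)) s + 1..conj_part m (lamplus m lam) s}" for i
  proof -
    have "i \<in> {i \<in> {1..m}. s \<le> lamplus m lam i} \<longleftrightarrow> i \<in> {1..conj_part m (lamplus m lam) s}"
      by (simp only: p)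
    moreover have "i \<in> {i \<in> {1..m}. s \<le> nat (mu m lam I i)} \<longleftrightarrow> i \<in> {1..conj_part m (\<lambda>i. nat (mu m lam I i)) s}"
      by (simp only: q)
    moreover have "mu m lam I i < int s \<longleftrightarrow> \<not> s \<le> nat (mu m lam I i)" if "i \<in> {1..m}"
      using mu that by (auto simp: le_nat_iff)
    ultimately show ?thesis by (auto simp: diagplus_def)
  qed
  then show ?thesis by (intro bij_betwI[of _ _ _ snd]) auto
qed

lemma diagminus_column:
  assumes hook: "hook_partition m n lam" and adm: "admissible m n lam I J"
  shows "bij_betw (\<lambda>j. (j, l)) {conj_part n (lamminus m n lam) l + 1..conj_part n (\<lambda>j. nat (nu m n lam J j)) l}
    {c \<in> diagminus m n lam J. snd c = l}"
proof -
  note p = conj_part_set[OF antitone_lamminus[OF hook], of l]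
  note q = conj_part_set[OF antitone_nu[OF adm], of l]
  have "(j, l) \<in> diagminus m n lam J \<longleftrightarrow>
      j \<in> {conj_part n (lamminus m n lam) l + 1..conj_part n (\<lambda>j. nat (nu m n lam J j)) l}" for j
  proof -
    have "j \<in> {j \<in> {1..n}. l \<le> lamminus m n lam j} \<longleftrightarrow> j \<in> {1..conj_part n (lamminus m n lam) l}"
      by (simp only: p)
    moreover have "j \<in> {j \<in> {1..n}. l \<le> nat (nu m n lam J j)} \<longleftrightarrow> j \<in> {1..conj_part n (\<lambda>j. nat (nu m n lam J j)) l}"
      by (simp only: q)
    moreover have "int l \<le> nu m n lam J j \<longleftrightarrow> l \<le> nat (nu m n lam J j)"
      by (auto simp: le_nat_iff nu_def)
    ultimately show ?thesis by (auto simp: diagminus_def)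
  qed
  then show ?thesis by (intro bij_betwI[of _ _ _ fst]) auto
qed

section \<open>Symmetrization cancels the denominators\<close>

text \<open>
  The coefficient of a tensor \<open>y\<^bsub>r 0,*\<^esub> \<otimes> y\<^bsub>r 1,*\<^esub> \<otimes> \<cdots>\<close> in the sum over \<open>X\<^sup>+\<close>, multiplied by the part of \<open>v\<close>
  built from \<open>D\<^sup>+\<close>, is the corresponding part of the denominator times a single product of determinants of
  the required sizes. Each row of the diagram of \<open>\<lambda>\<^sup>+\<close> contributes one determinant; a row without cells of
  \<open>\<D>\<^sup>+\<close> keeps its factor of \<open>v\<close>.
\<close>

lemma plus_coefficient:
  assumes hook: "hook_partition m n lam" and adm: "admissible m n lam I J"
    and mu: "\<forall>i\<in>{1..m}. mu m lam I i \<ge> 0" and P: "positioning_plus m lam I Pp"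
    and r: "\<And>l. l < length I \<Longrightarrow> r l \<in> {1..m}"
    and units: "\<And>i. i \<le> m \<Longrightarrow> \<exists>e. ldet i F * e = (1 :: 'a::comm_ring_1)"
  obtains ps where "\<forall>is\<in>set ps. length is \<in> {1..m} \<and> set is \<subseteq> {1..m}"
    and "\<forall>a\<in>{1..m}. length (filter (\<lambda>is. length is = a) ps) = lamplus m lam a - lamplus m lam (a + 1)"
    and "(\<Sum>\<alpha>\<in>Xplus m lam I. of_int (sign \<alpha>) * (\<Prod>l<length I. next_minor F (snd (\<alpha> (Pp l))) (r l))) *
        (\<Prod>a = 1..m. ldet a F ^ (lamplus m lam a - lamplus m lam (a + 1))) =
      prod_list (map (\<lambda>i. ldet i F) I) * prod_list (map (top_minor F) ps)"
proof -
  let ?k = "length I" and ?D = "diagplus m lam I" and ?S = "{1..lamplus m lam 1}"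
  let ?p = "conj_part m (lamplus m lam)" and ?q = "conj_part m (\<lambda>i. nat (mu m lam I i))"
  let ?inv = "inv_into {..<?k} Pp"
  have bij: "bij_betw Pp {..<?k} ?D" and col: "\<And>l. l < ?k \<Longrightarrow> snd (Pp l) = I ! l"
    using P by (auto simp: positioning_plus_def)
  note anti = antitone_lamplus[OF hook]
  have fS: "fst ` ?D \<subseteq> ?S"
  proof
    fix s assume "s \<in> fst ` ?D"
    then obtain i where i: "i \<in> {1..m}" "mu m lam I i < int s" "s \<le> lamplus m lam i"
      by (auto simp: diagplus_def)
    moreover have "lamplus m lam i \<le> lamplus m lam 1"
      by (rule antitone_le[OF anti]) (use i in auto)
    moreover have "mu m lam I i \<ge> 0" using mu i by blast
    ultimately show "s \<in> ?S" by auto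
  qed
  have qp: "?q s \<le> ?p s" for s by (rule conj_part_mono) (simp add: mu_def)
  note rows = diagplus_row[OF hook adm mu]
  define cols where "cols = (\<lambda>s. [1..<?q s + 1] @ map (\<lambda>c. r (?inv (s, c))) [?q s + 1..<?p s + 1])"
  have len: "length (cols s) = ?p s" for s using qp[of s] by (simp add: cols_def del: upt_Suc)
  have sub: "set (cols s) \<subseteq> {1..m}" for s
  proof -
    have "r (?inv (s, c)) \<in> {1..m}" if "c \<in> {?q s + 1..?p s}" for c
    proof -
      have "(s, c) \<in> ?D" using bij_betwE[OF rows[of s]] that by auto
      then have "?inv (s, c) \<in> {..<?k}" using bij by (intro inv_into_into) (auto simp: bij_betw_def)
      then show ?thesis using r by simp
    qed
    moreover have "{1..?q s} \<subseteq> {1..m}" using conj_part_le[of m "\<lambda>i. nat (mu m lam I i)" s] by auto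
    ultimately show ?thesis by (auto simp: cols_def simp del: upt_Suc)
  qed
  let ?C = "\<Sum>\<alpha>\<in>Xplus m lam I. of_int (sign \<alpha>) * (\<Prod>l<?k. next_minor F (snd (\<alpha> (Pp l))) (r l))"
  have "?C = (\<Prod>s\<in>?S. det_on {?q s + 1..?p s} (\<lambda>i c. next_minor F i (r (?inv (s, c)))))"
    unfolding Xplus_def
    by (rule skew_diagram_sum(1)[OF bij fS _ rows, where g = snd]) simp_all
  moreover have "(\<Prod>a = 1..m. ldet a F ^ (lamplus m lam a - lamplus m lam (a + 1))) = (\<Prod>s\<in>?S. ldet (?p s) F)"
    by (rule prod_conj_part[OF anti, symmetric]) (simp_all add: lamplus_def)
  moreover have "(\<Prod>s\<in>?S. det_on {?q s + 1..?p s} (\<lambda>i c. next_minor F i (r (?inv (s, c))))) * (\<Prod>s\<in>?S. ldet (?p s) F) =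
      (\<Prod>s\<in>?S. \<Prod>i = ?q s + 1..?p s. ldet i F) * (\<Prod>s\<in>?S. top_minor F (cols s))"
    unfolding prod.distrib[symmetric] cols_def
  proof (rule prod.cong[OF refl], rule row_minor[OF qp])
    fix s i assume "i \<in> {1..?q s}"
    then show "\<exists>e. ldet i F * e = 1" using conj_part_le[of m "\<lambda>i. nat (mu m lam I i)" s] by (intro units) auto
  qed
  moreover have "(\<Prod>s\<in>?S. \<Prod>i = ?q s + 1..?p s. ldet i F) = prod_list (map (\<lambda>i. ldet i F) I)"
  proof -
    have "(\<Prod>s\<in>?S. \<Prod>i = ?q s + 1..?p s. ldet i F) = (\<Prod>l<?k. ldet (snd (Pp l)) F)"
      by (rule skew_diagram_sum(2)[OF bij fS _ rows, where g = snd, symmetric]) simp_all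
    also have "\<dots> = (\<Prod>l<?k. map (\<lambda>i. ldet i F) I ! l)" by (rule prod.cong) (simp_all add: col)
    also have "\<dots> = prod_list (map (\<lambda>i. ldet i F) I)" by (simp add: prod.list_conv_set_nth lessThan_atLeast0)
    finally show ?thesis .
  qed
  moreover define ps where "ps = filter (\<lambda>is. is \<noteq> []) (map cols [1..<lamplus m lam 1 + 1])"
  moreover have "prod_list (map (top_minor F) (filter (\<lambda>is. is \<noteq> []) xs)) = prod_list (map (top_minor F) xs)" for xs
    by (induction xs) auto
  then have "prod_list (map (top_minor F) ps) = (\<Prod>s\<in>?S. top_minor F (cols s))"
    unfolding ps_def by (simp add: prod_list_upt o_def atLeastLessThanSuc_atLeastAtMost del: upt_Suc)
  ultimately have main: "?C * (\<Prod>a = 1..m. ldet a F ^ (lamplus m lam a - lamplus m lam (a + 1))) =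
      prod_list (map (\<lambda>i. ldet i F) I) * prod_list (map (top_minor F) ps)" by simp
  have "length is \<in> {1..m} \<and> set is \<subseteq> {1..m}" if mem: "is \<in> set ps" for "is"
  proof -
    obtain s where s: "is = cols s" "is \<noteq> []" using mem by (auto simp: ps_def)
    then have "0 < length is" by simp
    then show ?thesis using s(1) len[of s] sub[of s] conj_part_le[of m "lamplus m lam" s] by simp
  qed
  moreover have "length (filter (\<lambda>is. length is = a) ps) = lamplus m lam a - lamplus m lam (a + 1)"
    if a: "a \<in> {1..m}" for a
  proof -
    have "filter (\<lambda>is. length is = a) ps = filter (\<lambda>is. length is = a) (map cols [1..<lamplus m lam 1 + 1])"
      unfolding ps_def filter_filter by (rule filter_cong) (use a in auto)
    then have "length (filter (\<lambda>is. length is = a) ps) = length (filter (\<lambda>s. ?p s = a) [1..<lamplus m lam 1 + 1])"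
      by (simp add: filter_map o_def len del: upt_Suc)
    also have "\<dots> = card ({s. ?p s = a} \<inter> set [1..<lamplus m lam 1 + 1])"
      by (rule distinct_length_filter) simp
    also have "{s. ?p s = a} \<inter> set [1..<lamplus m lam 1 + 1] = {s \<in> {1..lamplus m lam 1}. ?p s = a}"
      by auto
    also have "card \<dots> = lamplus m lam a - lamplus m lam (a + 1)"
      by (rule card_conj_part_level[OF anti _ _ a]) (simp_all add: lamplus_def)
    finally show ?thesis .
  qed
  ultimately show ?thesis using that[of ps] main by blast
qed

text \<open>
  The analogous statement for \<open>X\<^sup>-\<close>. Each column of \<open>\<D>\<^sup>-\<close> now contributes an integral combination of
  determinants of one size; \<open>bs\<close> lists the sizes.
\<close>

lemma minus_coefficient:
  assumes hook: "hook_partition m n lam" and adm: "admissible m n lam I J"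
    and P: "positioning_minus m n lam J Pm"
    and s: "\<And>l. l < length J \<Longrightarrow> 1 \<le> s l"
    and units: "\<And>i. i \<le> n \<Longrightarrow> \<exists>e. ldet i F * e = (1 :: 'a::comm_ring_1)"
  obtains xs bs where "\<forall>b\<in>set bs. b \<le> n"
    and "\<forall>b\<in>{1..n}. length (filter (\<lambda>b'. b' = b) bs) = lamminus m n lam b - lamminus m n lam (b + 1)"
    and "list_all2 (\<lambda>x b. x \<in> additive_hull (top_minor F ` {js. length js = b \<and> set js \<subseteq> {1..n}})) xs bs"
    and "(\<Sum>\<beta>\<in>Xminus m n lam J. of_int (sign \<beta>) * (\<Prod>l<length J. row_cofactor F (fst (\<beta> (Pm l))) (s l))) *
        (\<Prod>b = 1..n. ldet b F ^ (lamminus m n lam b - lamminus m n lam (b + 1))) =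
      prod_list (map (\<lambda>j. ldet (j - 1) F) J) * prod_list xs"
proof -
  let ?k = "length J" and ?D = "diagminus m n lam J"
  let ?p = "conj_part n (lamminus m n lam)" and ?q = "conj_part n (\<lambda>j. nat (nu m n lam J j))"
  let ?inv = "inv_into {..<?k} Pm"
  define L where "L = nat (nu m n lam J 1)"
  let ?S = "{1..L}"
  have bij: "bij_betw Pm {..<?k} ?D" and row: "\<And>l. l < ?k \<Longrightarrow> fst (Pm l) = J ! l"
    using P by (auto simp: positioning_minus_def)
  note anti = antitone_lamminus[OF hook]
  note anti_nu = antitone_nu[OF adm]
  have fS: "snd ` ?D \<subseteq> ?S"
  proof
    fix l assume "l \<in> snd ` ?D"
    then obtain j where j: "j \<in> {1..n}" "lamminus m n lam j < l" "int l \<le> nu m n lam J j"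
      by (auto simp: diagminus_def)
    moreover have "nat (nu m n lam J j) \<le> L" unfolding L_def
      by (rule antitone_le[OF anti_nu]) (use j in auto)
    ultimately show "l \<in> ?S" by auto
  qed
  have L: "lamminus m n lam 1 \<le> L" by (simp add: L_def nu_def)
  have pq: "?p l \<le> ?q l" for l by (rule conj_part_mono) (simp add: nu_def)
  have qn: "?q l \<le> n" for l by (rule conj_part_le)
  note columns = diagminus_column[OF hook adm]
  define X where "X = (\<lambda>l. ldet (?q l) (\<lambda>a b. if a \<le> ?p l then F a b else if b = s (?inv (a, l)) then 1 else 0))"
  let ?C = "\<Sum>\<beta>\<in>Xminus m n lam J. of_int (sign \<beta>) * (\<Prod>l<?k. row_cofactor F (fst (\<beta> (Pm l))) (s l))"
  have "?C = (\<Prod>l\<in>?S. det_on {?p l + 1..?q l} (\<lambda>j c. row_cofactor F j (s (?inv (c, l)))))"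
    unfolding Xminus_def
    by (rule skew_diagram_sum(1)[OF bij fS _ columns, where g = fst]) simp_all
  moreover have "(\<Prod>b = 1..n. ldet b F ^ (lamminus m n lam b - lamminus m n lam (b + 1))) = (\<Prod>l\<in>?S. ldet (?p l) F)"
    by (rule prod_conj_part[OF anti _ L, symmetric]) (simp_all add: lamminus_def)
  moreover have "(\<Prod>l\<in>?S. det_on {?p l + 1..?q l} (\<lambda>j c. row_cofactor F j (s (?inv (c, l))))) * (\<Prod>l\<in>?S. ldet (?p l) F) =
      (\<Prod>l\<in>?S. \<Prod>j = ?p l + 1..?q l. ldet (j - 1) F) * (\<Prod>l\<in>?S. X l)"
    unfolding prod.distrib[symmetric] X_def
  proof (rule prod.cong[OF refl], rule column_minor[OF pq])
    fix l i assume "i \<in> {1..?p l}"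
    then show "\<exists>e. ldet i F * e = 1" using conj_part_le[of n "lamminus m n lam" l] by (intro units) auto
  next
    fix l c assume "c \<in> {?p l + 1..?q l}"
    then have "(c, l) \<in> ?D" using bij_betwE[OF columns[of l]] by auto
    then have "?inv (c, l) \<in> {..<?k}" using bij by (intro inv_into_into) (auto simp: bij_betw_def)
    then show "1 \<le> s (?inv (c, l))" using s by simp
  qed
  moreover have "(\<Prod>l\<in>?S. \<Prod>j = ?p l + 1..?q l. ldet (j - 1) F) = prod_list (map (\<lambda>j. ldet (j - 1) F) J)"
  proof -
    have "(\<Prod>l\<in>?S. \<Prod>j = ?p l + 1..?q l. ldet (j - 1) F) = (\<Prod>l<?k. ldet (fst (Pm l) - 1) F)"
      by (rule skew_diagram_sum(2)[OF bij fS _ columns, where g = fst and d = "\<lambda>j. ldet (j - 1) F", symmetric]) simp_all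
    also have "\<dots> = (\<Prod>l<?k. map (\<lambda>j. ldet (j - 1) F) J ! l)" by (rule prod.cong) (simp_all add: row)
    also have "\<dots> = prod_list (map (\<lambda>j. ldet (j - 1) F) J)" by (simp add: prod.list_conv_set_nth lessThan_atLeast0)
    finally show ?thesis .
  qed
  moreover define xs where "xs = map X [1..<L + 1]"
  moreover have "prod_list xs = (\<Prod>l\<in>?S. X l)"
    unfolding xs_def prod_list_upt by (simp add: atLeastLessThanSuc_atLeastAtMost)
  ultimately have main: "?C * (\<Prod>b = 1..n. ldet b F ^ (lamminus m n lam b - lamminus m n lam (b + 1))) =
      prod_list (map (\<lambda>j. ldet (j - 1) F) J) * prod_list xs" by simp
  define bs where "bs = map ?p [1..<L + 1]"
  have "\<forall>b\<in>set bs. b \<le> n" by (auto simp: bs_def conj_part_le)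
  moreover have "length (filter (\<lambda>b'. b' = b) bs) = lamminus m n lam b - lamminus m n lam (b + 1)"
    if b: "b \<in> {1..n}" for b
  proof -
    have "length (filter (\<lambda>b'. b' = b) bs) = length (filter (\<lambda>l. ?p l = b) [1..<L + 1])"
      by (simp add: bs_def filter_map o_def del: upt_Suc)
    also have "\<dots> = card ({l. ?p l = b} \<inter> set [1..<L + 1])"
      by (rule distinct_length_filter) simp
    also have "{l. ?p l = b} \<inter> set [1..<L + 1] = {l \<in> {1..L}. ?p l = b}"
      by auto
    also have "card \<dots> = lamminus m n lam b - lamminus m n lam (b + 1)"
      by (rule card_conj_part_level[OF anti _ L b]) (simp_all add: lamminus_def)
    finally show ?thesis .
  qed
  moreover have "list_all2 (\<lambda>x b. x \<in> additive_hull (top_minor F ` {js. length js = b \<and> set js \<subseteq> {1..n}})) xs bs"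
    unfolding xs_def bs_def list_all2_map1 list_all2_map2
  proof (rule list_all2_refl)
    fix l
    let ?z = "\<lambda>a b. if b = s (?inv (a, l)) then 1 else (0 :: 'a)"
    have q: "?q l = ?p l + (?q l - ?p l)" using pq[of l] by simp
    have "ldet (?p l + (?q l - ?p l)) (\<lambda>a b. if a \<le> ?p l then F a ([1..<?q l + 1] ! (b - 1)) else ?z a b)
        \<in> additive_hull (top_minor F ` {js. length js = ?p l \<and> set js \<subseteq> {1..n}})"
    proof (rule ldet_unit_rows)
      show "length [1..<?q l + 1] = ?p l + (?q l - ?p l)" using q by (simp del: upt_Suc)
      show "set [1..<?q l + 1] \<subseteq> {1..n}" using qn[of l] by auto
    qed auto
    also have "ldet (?p l + (?q l - ?p l)) (\<lambda>a b. if a \<le> ?p l then F a ([1..<?q l + 1] ! (b - 1)) else ?z a b) = X l"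
      unfolding X_def q[symmetric] by (rule ldet_cong) (simp del: upt_Suc)
    finally show "X l \<in> additive_hull (top_minor F ` {js. length js = ?p l \<and> set js \<subseteq> {1..n}})" .
  qed
  ultimately show ?thesis using that[of bs xs] main by blast
qed

section \<open>Products of determinants in \<open>H\<^sup>0\<close>\<close>

lemma span_products:
  fixes S T U :: "'k::field salg set"
  assumes "x \<in> module.span kscale S" "y \<in> module.span kscale T"
    and "\<And>s t. s \<in> S \<Longrightarrow> t \<in> T \<Longrightarrow> s * t \<in> module.span kscale U"
  shows "x * y \<in> module.span kscale U"
proof -
  interpret K: vector_space "kscale :: 'k \<Rightarrow> 'k salg \<Rightarrow> 'k salg" by (rule vector_space_kscale)
  have st: "s * y \<in> K.span U" if "s \<in> S" for s
    using assms(2)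
  proof (induction rule: K.span_induct_alt)
    case base
    then show ?case by (simp add: K.span_zero)
  next
    case (step c t y)
    then show ?case
      using assms(3)[OF that] by (simp add: distrib_left kscale_mult_right K.span_add K.span_scale)
  qed
  show ?thesis
    using assms(1)
  proof (induction rule: K.span_induct_alt)
    case base
    then show ?case by (simp add: K.span_zero)
  next
    case (step c s x)
    then show ?case using st by (simp add: distrib_right kscale_mult_left K.span_add K.span_scale)
  qed
qed

lemma span_prod_list:
  fixes B :: "nat \<Rightarrow> nat list set" and f :: "nat list \<Rightarrow> 'k::field salg"
  assumes "length zs = length bs"
    and "\<And>l. l < length zs \<Longrightarrow> zs ! l \<in> module.span kscale (f ` B (bs ! l))"
  shows "prod_list zs \<in> module.span kscale {prod_list (map f qs) | qs. list_all2 (\<lambda>q b. q \<in> B b) qs bs}"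
  using assms
proof (induction zs bs rule: list_induct2)
  case Nil
  interpret K: vector_space "kscale :: 'k \<Rightarrow> 'k salg \<Rightarrow> 'k salg" by (rule vector_space_kscale)
  show ?case by (rule K.span_base) (auto intro: exI[of _ "[]"])
next
  case (Cons z zs b bs)
  interpret K: vector_space "kscale :: 'k \<Rightarrow> 'k salg \<Rightarrow> 'k salg" by (rule vector_space_kscale)
  have z: "z \<in> K.span (f ` B b)" using Cons.prems[of 0] by simp
  have zs: "prod_list zs \<in> K.span {prod_list (map f qs) | qs. list_all2 (\<lambda>q b. q \<in> B b) qs bs}"
  proof (rule Cons.IH)
    fix l assume "l < length zs"
    then show "zs ! l \<in> K.span (f ` B (bs ! l))" using Cons.prems[of "Suc l"] by simp
  qed
  have "z * prod_list zs \<in> K.span {prod_list (map f qs) | qs. list_all2 (\<lambda>q b. q \<in> B b) qs (b # bs)}"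
  proof (rule span_products[OF z zs])
    fix s t assume "s \<in> f ` B b" "t \<in> {prod_list (map f qs) | qs. list_all2 (\<lambda>q b. q \<in> B b) qs bs}"
    then obtain q qs where "q \<in> B b" "s = f q" "list_all2 (\<lambda>q b. q \<in> B b) qs bs" "t = prod_list (map f qs)"
      by blast
    then show "s * t \<in> K.span {prod_list (map f qs) | qs. list_all2 (\<lambda>q b. q \<in> B b) qs (b # bs)}"
      by (intro K.span_base CollectI exI[of _ "q # qs"]) simp
  qed
  then show ?case by simp
qed

lemma Dminus_Nil: "Dminus m [] = 1"
  using Dminus_of_even[of "[]" m] by simp

text \<open>
  Sizes \<open>0\<close> in \<open>bs\<close> come from columns of \<open>\<D>\<^sup>-\<close> outside the diagram of \<open>\<lambda>\<^sup>-\<close>. The corresponding factors are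
  scalars, and the empty lists are removed from a product without changing it, because
  \<open>D\<^sup>-(\<emptyset>) = 1\<close>.
\<close>

lemma H0ev_products:
  fixes xs :: "'k::field even_alg list"
  assumes ps: "\<forall>is\<in>set ps. length is \<in> {1..m} \<and> set is \<subseteq> {1..m}"
      "\<forall>a\<in>{1..m}. length (filter (\<lambda>is. length is = a) ps) = lamplus m lam a - lamplus m lam (a + 1)"
    and bs: "\<forall>b\<in>set bs. b \<le> n"
      "\<forall>b\<in>{1..n}. length (filter (\<lambda>b'. b' = b) bs) = lamminus m n lam b - lamminus m n lam (b + 1)"
    and xs: "list_all2 (\<lambda>x b. x \<in> additive_hull (top_minor (even_phi m) ` {js. length js = b \<and> set js \<subseteq> {1..n}})) xs bs"
  shows "of_even (prod_list (map (top_minor (even_c m)) ps) * prod_list xs) \<in> (H0ev m n lam :: 'k salg set)"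
proof -
  interpret K: vector_space "kscale :: 'k \<Rightarrow> 'k salg \<Rightarrow> 'k salg" by (rule vector_space_kscale)
  let ?B = "\<lambda>b. {js. length js = b \<and> set js \<subseteq> {m + 1..m + n}}"
  let ?Q = "{prod_list (map (Dminus m) qs) | qs. list_all2 (\<lambda>q b. q \<in> ?B b) qs bs} :: 'k salg set"
  have "prod_list (map of_even xs) \<in> K.span ?Q"
  proof (rule span_prod_list)
    fix l assume l: "l < length (map of_even xs)"
    let ?H = "additive_hull (top_minor (even_phi m) ` {js. length js = bs ! l \<and> set js \<subseteq> {1..n}})"
    have "of_even x \<in> K.span (Dminus m ` ?B (bs ! l))" if "x \<in> ?H" for x :: "'k even_alg"
      using that
    proof induction
      case (base x)
      then obtain js where js: "length js = bs ! l" "set js \<subseteq> {1..n}" "x = top_minor (even_phi m) js" by blast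
      then have "of_even x = (Dminus m (map ((+) m) js) :: 'k salg)"
        by (auto intro: Dminus_of_even[symmetric])
      moreover have "map ((+) m) js \<in> ?B (bs ! l)" using js by auto
      ultimately show ?case by (auto intro!: K.span_base)
    qed (simp_all add: K.span_zero K.span_add K.span_neg)
    moreover have "xs ! l \<in> ?H" using xs l by (simp add: list_all2_conv_all_nth)
    ultimately show "map of_even xs ! l \<in> K.span (Dminus m ` ?B (bs ! l))" using l by simp
  qed (use xs in \<open>simp add: list_all2_lengthD\<close>)
  moreover have "prod_list (map (Dplus m) ps) * t \<in> (bideterminants m n lam :: 'k salg set)" if t: "t \<in> ?Q" for t
  proof -
    obtain qs where qs: "t = prod_list (map (Dminus m) qs)" "list_all2 (\<lambda>q b. q \<in> ?B b) qs bs" using t by blast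
    let ?qs = "filter (\<lambda>q. q \<noteq> []) qs"
    have "prod_list (map (Dminus m) ?qs) = (prod_list (map (Dminus m) qs) :: 'k salg)"
      by (induction qs) (auto simp: Dminus_Nil)
    then have "t = prod_list (map (Dminus m) ?qs)" using qs(1) by simp
    moreover have "length js \<in> {1..n} \<and> set js \<subseteq> {m + 1..m + n}" if "js \<in> set ?qs" for js
    proof -
      obtain l where l: "l < length qs" "qs ! l = js" using \<open>js \<in> set ?qs\<close> by (auto simp: in_set_conv_nth)
      then have "js \<in> ?B (bs ! l)" "bs ! l \<in> set bs" using qs(2) by (auto simp: list_all2_conv_all_nth)
      moreover have "js \<noteq> []" using that by simp
      then have "0 < length js" by simp
      ultimately show ?thesis using bs(1) by (auto simp: Suc_le_eq)
    qed
    moreover have "length (filter (\<lambda>js. length js = b) ?qs) = lamminus m n lam b - lamminus m n lam (b + 1)"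
      if b: "b \<in> {1..n}" for b
    proof -
      have "filter (\<lambda>js. length js = b) ?qs = filter (\<lambda>js. length js = b) qs"
        unfolding filter_filter by (rule filter_cong) (use b in auto)
      moreover have "length (filter (\<lambda>js. length js = b) qs) = length (filter (\<lambda>b'. b' = b) bs)"
        using qs(2) by (induction rule: list_all2_induct) auto
      ultimately show ?thesis using bs(2) b by simp
    qed
    ultimately show ?thesis
      unfolding bideterminants_def using ps by (intro CollectI exI[of _ ps] exI[of _ ?qs]) blast
  qed
  ultimately have "prod_list (map (Dplus m) ps) * prod_list (map of_even xs) \<in> K.span (bideterminants m n lam)"
    by (intro span_products[of "prod_list (map (Dplus m) ps)" "{prod_list (map (Dplus m) ps)}" _ ?Q])
      (auto intro: K.span_base)
  moreover have "Dplus m is = (of_even (top_minor (even_c m) is) :: 'k salg)" if "is \<in> set ps" for "is"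
  proof -
    have "length is \<in> {1..m} \<and> set is \<subseteq> {1..m}" using ps(1) that by blast
    then show ?thesis by (intro Dplus_of_even) auto
  qed
  then have "prod_list (map (Dplus m) ps) = (of_even (prod_list (map (top_minor (even_c m)) ps)) :: 'k salg)"
    unfolding of_even_prod_list map_map o_def by (intro arg_cong[of _ _ prod_list] map_cong refl)
  ultimately show ?thesis unfolding H0ev_def by (simp add: of_even_prod_list)
qed

section \<open>Primitive vectors\<close>

lemma sum_lists_Suc:
  "(\<Sum>ys | set ys \<subseteq> B \<and> length ys = Suc k. h ys) =
    (\<Sum>p\<in>B. \<Sum>xs | set xs \<subseteq> B \<and> length xs = k. h (p # xs))"
proof -
  have "(\<Sum>ys | set ys \<subseteq> B \<and> length ys = Suc k. h ys) =
      (\<Sum>(xs, p)\<in>{xs. set xs \<subseteq> B \<and> length xs = k} \<times> B. h (p # xs))"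
    unfolding lists_length_Suc_eq by (subst sum.reindex) (auto simp: inj_on_def intro!: sum.cong)
  also have "\<dots> = (\<Sum>xs | set xs \<subseteq> B \<and> length xs = k. \<Sum>p\<in>B. h (p # xs))"
    by (rule sum.cartesian_product[symmetric])
  also have "\<dots> = (\<Sum>p\<in>B. \<Sum>xs | set xs \<subseteq> B \<and> length xs = k. h (p # xs))" by (rule sum.swap)
  finally show ?thesis .
qed

text \<open>
  The list \<open>xs\<close> contains the pairs of indices of the elements \<open>y\<^bsub>r,m+s\<^esub>\<close> in the slots. The coefficient
  separates into a factor depending on \<open>K\<close> and a factor depending on \<open>L\<close>, so that summation over \<open>X\<^sup>+\<close> and
  over \<open>X\<^sup>-\<close> can be carried out independently.
\<close>

lemma rho_multi_expansion:
  assumes "length K = length L" "set K \<subseteq> {1..m}" "set L \<subseteq> {1..n}"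
  shows "rho_multi m K L = (\<Sum>xs | set xs \<subseteq> {1..m} \<times> {1..n} \<and> length xs = length K.
    tpure (of_even ((\<Prod>l<length K. next_minor (even_c m) (K ! l) (fst (xs ! l))) *
        (\<Prod>l<length K. row_cofactor (even_phi m) (L ! l) (snd (xs ! l)))))
      (map (\<lambda>(r, s). yel m r (m + s)) xs) :: 'k::field tens)"
  using assms
proof (induction K L rule: list_induct2)
  case Nil
  have "{xs. set xs \<subseteq> {1..m} \<times> {1..n} \<and> length xs = 0} = {[]}" by auto
  then show ?case by (simp add: rho_multi_def tcoeff_1)
next
  case (Cons k K l L)
  let ?B = "{1..m} \<times> {1..n}"
  let ?t = "\<lambda>K L xs. tpure (of_even ((\<Prod>l<length K. next_minor (even_c m) (K ! l) (fst (xs ! l))) *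
        (\<Prod>l<length K. row_cofactor (even_phi m) (L ! l) (snd (xs ! l)))))
      (map (\<lambda>(r, s). yel m r (m + s)) xs) :: 'k tens"
  let ?u = "\<lambda>(r, s). tpure (of_even (next_minor (even_c m) k r * row_cofactor (even_phi m) l s)) [yel m r (m + s)] :: 'k tens"
  have "rho m k l = (\<Sum>p\<in>?B. ?u p)"
    using Cons.prems by (subst rho_expansion) (auto simp: sum.cartesian_product)
  moreover have "rho_multi m K L = (\<Sum>xs | set xs \<subseteq> ?B \<and> length xs = length K. ?t K L xs)"
    using Cons.prems by (intro Cons.IH) auto
  ultimately have "rho_multi m (k # K) (l # L) =
      (\<Sum>p\<in>?B. \<Sum>xs | set xs \<subseteq> ?B \<and> length xs = length K. ?u p * ?t K L xs)"
    by (simp add: rho_multi_def sum_product)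
  also have "\<dots> = (\<Sum>p\<in>?B. \<Sum>xs | set xs \<subseteq> ?B \<and> length xs = length K. ?t (k # K) (l # L) (p # xs))"
  proof (intro sum.cong refl)
    fix p :: "nat \<times> nat" and xs :: "(nat \<times> nat) list"
    obtain r s where p: "p = (r, s)" by (cases p)
    show "?u p * ?t K L xs = ?t (k # K) (l # L) (p # xs)"
      unfolding p prod.case tpure_mult of_even_simps(4)[symmetric] length_Cons
        prod.lessThan_Suc_shift nth_Cons_0 nth_Cons_Suc fst_conv snd_conv list.map append_Cons append_Nil
      by (simp only: ac_simps)
  qed
  also have "\<dots> = (\<Sum>xs | set xs \<subseteq> ?B \<and> length xs = Suc (length K). ?t (k # K) (l # L) xs)"
    by (rule sum_lists_Suc[symmetric])
  finally show ?case by simp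
qed

text \<open>
  A permutation of the cells only rearranges the entries of the multiindex, so the content is kept.
\<close>

lemma permuted_cells_mset:
  assumes P: "bij_betw P {..<k} D" and \<alpha>: "\<alpha> permutes D"
    and I: "length I = k" "\<And>l. l < k \<Longrightarrow> g (P l) = I ! l"
  shows "mset (map (\<lambda>l. g (\<alpha> (P l))) [0..<k]) = mset I"
proof -
  have *: "mset (map (\<lambda>l. g (Q l)) [0..<k]) = image_mset g (mset_set D)" if Q: "bij_betw Q {..<k} D" for Q
  proof -
    have "mset (map (\<lambda>l. g (Q l)) [0..<k]) = image_mset g (image_mset Q (mset_set {..<k}))"
      by (simp add: multiset.map_comp o_def lessThan_atLeast0)
    also have "image_mset Q (mset_set {..<k}) = mset_set D"
      using Q by (subst image_mset_mset_set) (auto simp: bij_betw_def)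
    finally show ?thesis .
  qed
  have "bij_betw (\<alpha> \<circ> P) {..<k} D" by (rule bij_betw_trans[OF P permutes_imp_bij[OF \<alpha>]])
  from *[OF this] have "mset (map (\<lambda>l. g (\<alpha> (P l))) [0..<k]) = mset (map (\<lambda>l. g (P l)) [0..<k])"
    using *[OF P] by simp
  also have "map (\<lambda>l. g (P l)) [0..<k] = I" by (rule nth_equalityI) (simp_all add: I)
  finally show ?thesis .
qed

lemma kconst_of_int: "kconst (of_int c) = of_int c"
proof -
  have "kconst (of_nat k) = of_nat k" for k by (induction k) (simp_all add: kconst_0 kconst_simps)
  then show ?thesis by (cases c rule: int_cases2) (simp_all add: kconst_uminus)
qed

lemma tscale_of_int_sum: "tscale (of_int (sum f A)) w = (\<Sum>x\<in>A. tscale (of_int (f x)) w)"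
  by (induction A rule: infinite_finite_induct) (simp_all add: tscale_add_left)

theorem theorem4p3:
  fixes m n :: nat and lam :: "nat \<Rightarrow> nat" and I J :: "nat list"
    and Pp Pm :: "nat \<Rightarrow> nat \<times> nat"
  assumes "m \<ge> 1" and "n \<ge> 1"
    and "hook_partition m n lam"
    and "admissible m n lam I J"
    and "\<forall>i\<in>{1..m}. mu m lam I i \<ge> 0"
    and "positioning_plus m lam I Pp"
    and "positioning_minus m n lam J Pm"
  shows "let w = tcoeff (vfrac m n lam I J) * sigma_rho m n lam Pp Pm I J
             :: 'k::{alg_closed_field, field_char_0} tens
    in w \<in> H0ev_tensor m n lam (length I) \<and>
       even_primitive m n w \<and>
       (\<exists>S (a :: nat list \<times> nat list \<Rightarrow> int). finite S \<and>
          S \<subseteq> {(K, L). multiindex m n K L \<and> length K = length I \<and> cont K L = cont I J} \<and>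
          w = (\<Sum>(K, L)\<in>S. tscale (of_int (a (K, L))) (pi_vec m n lam K L)))"
proof -
  define k where "k = length I"
  define X Z where "X = Xplus m lam I" and "Z = Xminus m n lam J"
  define K where "K = (\<lambda>\<alpha> :: nat \<times> nat \<Rightarrow> nat \<times> nat. map (\<lambda>l. snd (\<alpha> (Pp l))) [0..<k])"
  define L where "L = (\<lambda>\<beta> :: nat \<times> nat \<Rightarrow> nat \<times> nat. map (\<lambda>l. fst (\<beta> (Pm l))) [0..<k])"
  define v where "v = (vfrac m n lam I J :: 'k salg)"
  define w where "w = tcoeff v * (sigma_rho m n lam Pp Pm I J :: 'k tens)"
  have IJ: "length J = k" "set I \<subseteq> {1..m}" "set J \<subseteq> {1..n}"
    using assms(4) by (auto simp: admissible_def multiindex_def k_def)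
  have sigma: "sigma_rho m n lam Pp Pm I J =
      (\<Sum>\<alpha>\<in>X. \<Sum>\<beta>\<in>Z. tscale (of_int (sign \<alpha> * sign \<beta>)) (rho_multi m (K \<alpha>) (L \<beta>)) :: 'k tens)"
    by (simp add: sigma_rho_def X_def Z_def K_def L_def IJ k_def)
  have Pp: "bij_betw Pp {..<k} (diagplus m lam I)" "\<And>l. l < k \<Longrightarrow> snd (Pp l) = I ! l"
    using assms(6) by (auto simp: positioning_plus_def k_def)
  have Pm: "bij_betw Pm {..<k} (diagminus m n lam J)" "\<And>l. l < k \<Longrightarrow> fst (Pm l) = J ! l"
    using assms(7) by (auto simp: positioning_minus_def IJ)
  have KI: "mset (K \<alpha>) = mset I" if "\<alpha> \<in> X" for \<alpha>
    unfolding K_def by (rule permuted_cells_mset[OF Pp(1)]) (use that Pp in \<open>auto simp: X_def Xplus_def k_def\<close>)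
  have LJ: "mset (L \<beta>) = mset J" if "\<beta> \<in> Z" for \<beta>
    unfolding L_def by (rule permuted_cells_mset[OF Pm(1)]) (use that Pm IJ in \<open>auto simp: Z_def Xminus_def\<close>)
  have len: "length (K \<alpha>) = k" "length (L \<beta>) = k" for \<alpha> \<beta> by (simp_all add: K_def L_def)
  have sub: "set (K \<alpha>) \<subseteq> {1..m}" if "\<alpha> \<in> X" for \<alpha>
    using KI[OF that] IJ(2) by (metis set_mset_mset)
  have sub': "set (L \<beta>) \<subseteq> {1..n}" if "\<beta> \<in> Z" for \<beta>
    using LJ[OF that] IJ(3) by (metis set_mset_mset)
  have finX: "finite X"
    by (rule finite_subset[of _ "{\<alpha>. \<alpha> permutes diagplus m lam I}"])
      (use bij_betw_finite[OF Pp(1)] in \<open>auto simp: X_def Xplus_def finite_permutations\<close>)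
  have finZ: "finite Z"
    by (rule finite_subset[of _ "{\<beta>. \<beta> permutes diagminus m n lam J}"])
      (use bij_betw_finite[OF Pm(1)] in \<open>auto simp: Z_def Xminus_def finite_permutations\<close>)

  have membership: "w \<in> H0ev_tensor m n lam k"
  proof -
    interpret T: vector_space "tscale :: 'k \<Rightarrow> 'k tens \<Rightarrow> 'k tens" by (rule vector_space_tscale)
    interpret K: vector_space "kscale :: 'k \<Rightarrow> 'k salg \<Rightarrow> 'k salg" by (rule vector_space_kscale)
    obtain P :: "'k even_alg" where P: "den_even m I J * P = 1" using den_even_unit[OF IJ(2,3)] by blast
    have v: "v = of_even (hw_even m n lam * P)" unfolding v_def by (rule vfrac_even[OF IJ(2,3) P])
    let ?S = "{xs :: (nat \<times> nat) list. set xs \<subseteq> {1..m} \<times> {1..n} \<and> length xs = k}"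
    let ?y = "map (\<lambda>(r, s). yel m r (m + s)) :: (nat \<times> nat) list \<Rightarrow> 'k salg list"
    let ?A = "\<lambda>xs \<alpha>. \<Prod>l<k. next_minor (even_c m) (snd (\<alpha> (Pp l))) (fst (xs ! l)) :: 'k even_alg"
    let ?B = "\<lambda>xs \<beta>. \<Prod>l<k. row_cofactor (even_phi m) (fst (\<beta> (Pm l))) (snd (xs ! l)) :: 'k even_alg"
    let ?CA = "\<lambda>xs. \<Sum>\<alpha>\<in>X. of_int (sign \<alpha>) * ?A xs \<alpha>" and ?CB = "\<lambda>xs. \<Sum>\<beta>\<in>Z. of_int (sign \<beta>) * ?B xs \<beta>"
    \<comment> \<open>The coefficient of each tensor of elements \<open>y\<^bsub>r,m+s\<^esub>\<close> is the product of an alternating sum over \<open>X\<^sup>+\<close> and one over \<open>X\<^sup>-\<close>.\<close>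
    have "sigma_rho m n lam Pp Pm I J = (\<Sum>\<alpha>\<in>X. \<Sum>\<beta>\<in>Z. \<Sum>xs\<in>?S.
        tpure (of_even ((of_int (sign \<alpha>) * ?A xs \<alpha>) * (of_int (sign \<beta>) * ?B xs \<beta>))) (?y xs) :: 'k tens)"
      unfolding sigma
    proof (intro sum.cong refl)
      fix \<alpha> \<beta> assume ab: "\<alpha> \<in> X" "\<beta> \<in> Z"
      have "rho_multi m (K \<alpha>) (L \<beta>) = (\<Sum>xs\<in>?S. tpure (of_even (?A xs \<alpha> * ?B xs \<beta>)) (?y xs) :: 'k tens)"
        unfolding rho_multi_expansion[OF trans[OF len(1) len(2)[symmetric]] sub[OF ab(1)] sub'[OF ab(2)]] len
        by (intro sum.cong refl arg_cong2[of _ _ _ _ tpure] arg_cong[of _ _ of_even]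
            arg_cong2[of _ _ _ _ "(*)"] prod.cong) (simp_all add: K_def L_def)
      moreover have "tscale (of_int (sign \<alpha> * sign \<beta>)) (tpure (of_even (a * b)) ys) =
          (tpure (of_even ((of_int (sign \<alpha>) * a) * (of_int (sign \<beta>) * b))) ys :: 'k tens)" for a b ys
      proof -
        have "kscale (of_int (sign \<alpha> * sign \<beta>)) (of_even (a * b)) =
            (of_even (of_int (sign \<alpha> * sign \<beta>) * (a * b)) :: 'k salg)"
          unfolding kscale_def kconst_of_int of_even_simps(4) of_even_of_int ..
        also have "of_int (sign \<alpha> * sign \<beta>) * (a * b) = (of_int (sign \<alpha>) * a) * (of_int (sign \<beta>) * b)"
          by (simp only: of_int_mult ac_simps)
        finally show ?thesis unfolding tscale_tpure by (rule arg_cong)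
      qed
      ultimately show "tscale (of_int (sign \<alpha> * sign \<beta>)) (rho_multi m (K \<alpha>) (L \<beta>)) = (\<Sum>xs\<in>?S.
        tpure (of_even ((of_int (sign \<alpha>) * ?A xs \<alpha>) * (of_int (sign \<beta>) * ?B xs \<beta>))) (?y xs) :: 'k tens)"
        by (simp only: tscale_sum)
    qed
    also have "\<dots> = (\<Sum>\<alpha>\<in>X. \<Sum>xs\<in>?S. \<Sum>\<beta>\<in>Z.
        tpure (of_even ((of_int (sign \<alpha>) * ?A xs \<alpha>) * (of_int (sign \<beta>) * ?B xs \<beta>))) (?y xs))"
      by (intro sum.cong refl sum.swap)
    also have "\<dots> = (\<Sum>xs\<in>?S. \<Sum>\<alpha>\<in>X. \<Sum>\<beta>\<in>Z.
        tpure (of_even ((of_int (sign \<alpha>) * ?A xs \<alpha>) * (of_int (sign \<beta>) * ?B xs \<beta>))) (?y xs))"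
      by (rule sum.swap)
    also have "\<dots> = (\<Sum>xs\<in>?S. tpure (of_even (?CA xs * ?CB xs)) (?y xs))"
      unfolding sum_product of_even_sum tpure_sum ..
    finally have w: "w = (\<Sum>xs\<in>?S. tpure (v * of_even (?CA xs * ?CB xs)) (?y xs))"
      by (simp add: w_def sum_distrib_left tpure_mult)
    have inH: "v * of_even (?CA xs * ?CB xs) \<in> H0ev m n lam" if xs: "xs \<in> ?S" for xs
    proof -
      have nth: "fst (xs ! l) \<in> {1..m}" "1 \<le> snd (xs ! l)" if "l < k" for l
      proof -
        have "xs ! l \<in> {1..m} \<times> {1..n}" using xs that nth_mem[of l xs] by blast
        then show "fst (xs ! l) \<in> {1..m}" "1 \<le> snd (xs ! l)" by auto
      qed
      have unitsC: "\<exists>e. ldet i (even_c m) * e = (1 :: 'k even_alg)" if "i \<le> m" for i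
        using even_c_minor_unit[OF that] by blast
      have unitsF: "\<exists>e. ldet i (even_phi m) * e = (1 :: 'k even_alg)" if "i \<le> n" for i
        using even_phi_minor_unit[OF that] by blast
      obtain ps where ps: "\<forall>is\<in>set ps. length is \<in> {1..m} \<and> set is \<subseteq> {1..m}"
          "\<forall>a\<in>{1..m}. length (filter (\<lambda>is. length is = a) ps) = lamplus m lam a - lamplus m lam (a + 1)"
        and CA: "?CA xs * (\<Prod>a = 1..m. ldet a (even_c m) ^ (lamplus m lam a - lamplus m lam (a + 1))) =
          prod_list (map (\<lambda>i. ldet i (even_c m)) I) * prod_list (map (top_minor (even_c m)) ps)"
        using nth(1)
        by (rule plus_coefficient[OF assms(3,4,5,6) _ unitsC, where r = "\<lambda>l. fst (xs ! l)", folded k_def X_def])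
      obtain zs bs where bs: "\<forall>b\<in>set bs. b \<le> n"
          "\<forall>b\<in>{1..n}. length (filter (\<lambda>b'. b' = b) bs) = lamminus m n lam b - lamminus m n lam (b + 1)"
        and zs: "list_all2 (\<lambda>x b. x \<in> additive_hull (top_minor (even_phi m) ` {js. length js = b \<and> set js \<subseteq> {1..n}})) zs bs"
        and CB: "?CB xs * (\<Prod>b = 1..n. ldet b (even_phi m) ^ (lamminus m n lam b - lamminus m n lam (b + 1))) =
          prod_list (map (\<lambda>j. ldet (j - 1) (even_phi m)) J) * prod_list zs"
        using nth(2)
        by (rule minus_coefficient[OF assms(3,4,7) _ unitsF, where s = "\<lambda>l. snd (xs ! l)", folded Z_def, unfolded IJ(1)])
      \<comment> \<open>Here the denominators of \<open>v\<^bsub>I|J\<^esub>\<close> disappear.\<close>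
      have "hw_even m n lam * P * (?CA xs * ?CB xs) = (den_even m I J * P) * (prod_list (map (top_minor (even_c m)) ps) * prod_list zs)"
      proof -
        have "hw_even m n lam * P * (?CA xs * ?CB xs) =
            P * ((?CA xs * (\<Prod>a = 1..m. ldet a (even_c m) ^ (lamplus m lam a - lamplus m lam (a + 1)))) *
              (?CB xs * (\<Prod>b = 1..n. ldet b (even_phi m) ^ (lamminus m n lam b - lamminus m n lam (b + 1)))))"
          unfolding hw_even_def by (simp only: ac_simps)
        also have "\<dots> = (den_even m I J * P) * (prod_list (map (top_minor (even_c m)) ps) * prod_list zs)"
          unfolding CA CB den_even_def by (simp only: ac_simps)
        finally show ?thesis .
      qed
      then have "v * of_even (?CA xs * ?CB xs) = of_even (prod_list (map (top_minor (even_c m)) ps) * prod_list zs)"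
        unfolding v of_even_simps(4)[symmetric] P by simp
      also have "\<dots> \<in> H0ev m n lam" by (rule H0ev_products[OF ps bs zs])
      finally show ?thesis .
    qed
    have inY: "set (?y xs) \<subseteq> Yset m n" if "xs \<in> ?S" for xs
    proof
      fix z assume "z \<in> set (?y xs)"
      then obtain r s where "(r, s) \<in> set xs" and z: "z = yel m r (m + s)" by auto
      then have "r \<in> {1..m}" "m + s \<in> {m + 1..m + n}" using that by auto
      then show "z \<in> Yset m n" unfolding z Yset_def by (intro K.span_base) blast
    qed
    show ?thesis
      unfolding w H0ev_tensor_def
    proof (intro T.span_sum T.span_base CollectI exI conjI)
      fix xs assume xs: "xs \<in> ?S"
      show "v * of_even (?CA xs * ?CB xs) \<in> H0ev m n lam" "set (?y xs) \<subseteq> Yset m n"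
        by (rule inH[OF xs], rule inY[OF xs])
      show "length (?y xs) = k" using xs by simp
    qed (rule refl)
  qed

  \<comment> \<open>All summands of \<open>w\<close> have the same weight, and each is annihilated when \<open>i \<noteq> j\<close>.\<close>
  have eigen: "\<exists>c. tensor_eigen (evder (m + n) i j) c w \<and> (i \<noteq> j \<longrightarrow> c = 0)" if blk: "borel_pair m n i j" for i j
  proof -
    obtain c where c: "scalar_eigen (evder (m + n) i j) c v" "i \<noteq> j \<longrightarrow> c = 0"
      using weighted_vfrac[OF blk IJ(2,3)] unfolding weighted_def v_def by blast
    let ?d = "sum_list (map2 (rho_weight m i j) I J)"
    have "tensor_eigen (evder (m + n) i j) ?d (sigma_rho m n lam Pp Pm I J :: 'k tens)"
      unfolding sigma
    proof (intro tensor_eigen_sum tensor_eigen_scale[OF blk])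
      fix \<alpha> \<beta> assume ab: "\<alpha> \<in> X" "\<beta> \<in> Z"
      have "?d = sum_list (map2 (rho_weight m i j) (K \<alpha>) (L \<beta>))"
        by (rule rho_weight_sum_mset) (use KI LJ ab len IJ in \<open>auto simp: k_def\<close>)
      then show "tensor_eigen (evder (m + n) i j) ?d (rho_multi m (K \<alpha>) (L \<beta>) :: 'k tens)"
        using tensor_eigen_rho_multi[OF blk trans[OF len(1) len(2)[symmetric]] sub[OF ab(1)] sub'[OF ab(2)]] by simp
    qed
    then have "tensor_eigen (evder (m + n) i j) (c + ?d) w"
      unfolding w_def by (intro tensor_eigen_mult[OF blk] tensor_eigen_tcoeff[OF blk] c)
    moreover have "?d = 0" if "i \<noteq> j" by (rule rho_weight_sum_0[OF that])
    ultimately show ?thesis using c(2) by (intro exI[of _ "c + ?d"]) auto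
  qed
  have "w \<in> Ktens m n"
    unfolding w_def sigma
  proof (intro Ktens_mult Ktens_sum Ktens_tscale)
    show "tcoeff v \<in> Ktens m n"
      unfolding v_def by (rule Ktens.pure[OF Kmn_vfrac[OF IJ(2,3)]]) simp
    fix \<alpha> \<beta> assume "\<alpha> \<in> X" "\<beta> \<in> Z"
    then show "rho_multi m (K \<alpha>) (L \<beta>) \<in> (Ktens m n :: 'k tens set)"
      by (intro Ktens_rho_multi sub sub') (simp add: len)
  qed
  note act = tact_evder_eq[OF _ _ this]
  have primitive: "even_primitive m n w"
    unfolding even_primitive_def weight_vector_def
  proof (intro conjI allI impI)
    have "\<forall>i\<in>{1..m + n}. \<exists>c. tensor_eigen (evder (m + n) i i) c w"
    proof
      fix i assume "i \<in> {1..m + n}"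
      then have "borel_pair m n i i" by (simp add: borel_pair_def)
      from eigen[OF this] show "\<exists>c. tensor_eigen (evder (m + n) i i) c w" by blast
    qed
    then obtain \<chi> where \<chi>: "\<forall>i\<in>{1..m + n}. tensor_eigen (evder (m + n) i i) (\<chi> i) w"
      by (rule bchoice[THEN exE])
    show "\<exists>\<chi> :: nat \<Rightarrow> int. \<forall>i\<in>{1..m + n}. \<forall>D. is_evder m n i i D \<longrightarrow> tact D w = tscale (of_int (\<chi> i)) w"
    proof (intro exI[of _ \<chi>] ballI allI impI)
      fix i and D :: "'k salg \<Rightarrow> 'k salg" assume i: "i \<in> {1..m + n}" and D: "is_evder m n i i D"
      have "tact D w = tact (evder (m + n) i i) w"
        by (rule act[OF D]) (use i in \<open>simp add: borel_pair_def\<close>)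
      then show "tact D w = tscale (of_int (\<chi> i)) w" using \<chi> i by (simp add: tensor_eigen_def)
    qed
  next
    fix i j and D :: "'k salg \<Rightarrow> 'k salg"
    assume ij: "j < i \<and> (i \<in> {1..m} \<and> j \<in> {1..m} \<or> i \<in> {m + 1..m + n} \<and> j \<in> {m + 1..m + n})"
      and D: "is_evder m n i j D"
    have blk: "borel_pair m n i j" using ij by (auto simp: borel_pair_def)
    have "tensor_eigen (evder (m + n) i j) 0 w" using eigen[OF blk] ij by auto
    then show "tact D w = 0" using act[OF D blk] by (simp add: tensor_eigen_def)
  qed

  have combination: "\<exists>S (a :: nat list \<times> nat list \<Rightarrow> int). finite S \<and>
      S \<subseteq> {(K, L). multiindex m n K L \<and> length K = length I \<and> cont K L = cont I J} \<and>
      w = (\<Sum>(K, L)\<in>S. tscale (of_int (a (K, L))) (pi_vec m n lam K L))"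
  proof -
    define \<kappa> where "\<kappa> = (\<lambda>(\<alpha>, \<beta>). (K \<alpha>, L \<beta>))"
    define sg :: "(nat \<times> nat \<Rightarrow> nat \<times> nat) \<times> (nat \<times> nat \<Rightarrow> nat \<times> nat) \<Rightarrow> int"
      where "sg = (\<lambda>(\<alpha>, \<beta>). sign \<alpha> * sign \<beta>)"
    let ?T = "X \<times> Z"
    \<comment> \<open>Different permutations may give the same multiindex; their signs are added.\<close>
    define a where "a = (\<lambda>q. \<Sum>p\<in>{p \<in> ?T. \<kappa> p = q}. sg p)"
    have "\<kappa> ` ?T \<subseteq> {(K, L). multiindex m n K L \<and> length K = length I \<and> cont K L = cont I J}"
    proof
      fix q assume "q \<in> \<kappa> ` ?T"
      then obtain \<alpha> \<beta> where ab: "\<alpha> \<in> X" "\<beta> \<in> Z" and q: "q = (K \<alpha>, L \<beta>)" by (auto simp: \<kappa>_def)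
      have "count_list (K \<alpha>) x = count_list I x" "count_list (L \<beta>) x = count_list J x" for x
        using KI[OF ab(1)] LJ[OF ab(2)] by (simp_all flip: count_mset)
      then have "cont (K \<alpha>) (L \<beta>) = cont I J" by (auto simp: cont_def)
      then show "q \<in> {(K, L). multiindex m n K L \<and> length K = length I \<and> cont K L = cont I J}"
        unfolding q using len sub[OF ab(1)] sub'[OF ab(2)] by (simp add: multiindex_def k_def)
    qed
    moreover have "finite (\<kappa> ` ?T)" using finX finZ by simp
    moreover have "w = (\<Sum>(K, L)\<in>\<kappa> ` ?T. tscale (of_int (a (K, L))) (pi_vec m n lam K L))"
    proof -
      let ?pi = "\<lambda>(K, L). pi_vec m n lam K L :: 'k tens"
      have "w = (\<Sum>\<alpha>\<in>X. \<Sum>\<beta>\<in>Z. tscale (of_int (sign \<alpha> * sign \<beta>)) (pi_vec m n lam (K \<alpha>) (L \<beta>)))"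
        unfolding w_def sigma sum_distrib_left
      proof (intro sum.cong refl)
        fix \<alpha> \<beta> assume ab: "\<alpha> \<in> X" "\<beta> \<in> Z"
        have "vfrac m n lam (K \<alpha>) (L \<beta>) = v" unfolding v_def
          by (rule vfrac_mset[OF sub[OF ab(1)] sub'[OF ab(2)] KI[OF ab(1)] LJ[OF ab(2)]])
        then show "tcoeff v * tscale (of_int (sign \<alpha> * sign \<beta>)) (rho_multi m (K \<alpha>) (L \<beta>)) =
            tscale (of_int (sign \<alpha> * sign \<beta>)) (pi_vec m n lam (K \<alpha>) (L \<beta>))"
          by (simp add: pi_vec_def tscale_mult_right)
      qed
      also have "\<dots> = (\<Sum>p\<in>?T. tscale (of_int (sg p)) (?pi (\<kappa> p)))"
        unfolding sum.cartesian_product by (intro sum.cong refl) (auto simp: sg_def \<kappa>_def)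
      also have "\<dots> = (\<Sum>q\<in>\<kappa> ` ?T. \<Sum>p\<in>{p \<in> ?T. \<kappa> p = q}. tscale (of_int (sg p)) (?pi (\<kappa> p)))"
        by (rule sum.image_gen) (use finX finZ in simp)
      also have "\<dots> = (\<Sum>q\<in>\<kappa> ` ?T. tscale (of_int (a q)) (?pi q))"
        unfolding a_def tscale_of_int_sum by (intro sum.cong refl) auto
      also have "\<dots> = (\<Sum>(K, L)\<in>\<kappa> ` ?T. tscale (of_int (a (K, L))) (pi_vec m n lam K L))"
        by (intro sum.cong refl) auto
      finally show ?thesis .
    qed
    ultimately show ?thesis by blast
  qed

  show ?thesis
    unfolding Let_def using membership primitive combination unfolding w_def v_def k_def by blast
qed

end
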